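(* Let $W_0=(w_0,\dot w_0)\in H^1\times L^2(\mathbb{T}^d)$ and $\dot w_f\in L^2(\mathbb{T}^d)$ be such that $\dot w_f-\dot w_0=0$ a.e. on $Z(w_0)$. Then the target $(w_0,\dot w_f)$ is approximately reachable in time $0^+$ from $W_0$ (small-time approximately reachable). In particular, if $|Z(w_0)|=0$, every target in $\{w_0\}\times L^2(\mathbb{T}^d)$ is small-time approximately reachable from $W_0$.
   Context: Setting: $d\ge 1$ is an integer, $\mathbb{T}^d=\mathbb{R}^d/2\pi\mathbb{Z}^d$ with Lebesgue measure $|\cdot|$; all functions are real-valued. Let $\rho=2$ if $d=1$, $\rho$ be a fixed exponent $>2$ if $d=2$, and $\rho=d$ if $d\ge 3$. Fix $V\in L^\rho(\mathbb{T}^d)$. Control potentials: $V_0(x)=1$, $V_{2j-1}(x)=\sin(x_j)$, $V_{2j}(x)=\cos(x_j)$ for $j=1,\dots,d$. On $H^1\times L^2(\mathbb{T}^d)$, equipped with the norm $\|(w_1,w_2)\|^2=\int_{\mathbb{T}^d}(|\nabla w_1|^2+|w_1|^2+|w_2|^2)$, consider $A=\begin{pmatrix}0&1\\ \Delta-1&0\end{pmatrix}$ (domain $H^2\times H^1$), generating a group $(e^{tA})$ of isometries, and $B=\begin{pmatrix}0&0\\1&0\end{pmatrix}$. For a bounded operator $L$ on $H^1\times L^2$, $\exp(t(A+L))W_0$ is the unique $W\in C^0(\mathbb{R},H^1\times L^2)$ with $W(t)=e^{tA}W_0+\int_0^te^{(t-s)A}LW(s)\,ds$. The control system is $\frac{dW}{dt}=\big(A+VB+\sum_{j=0}^{2d}u_j(t)V_jB\big)W$;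 for piecewise constant $u:[0,T]\to\mathbb{R}^{2d+1}$, $W(t;u,W_0)$ is the solution with $W(0)=W_0$ (composition of the groups $\exp(t(A+(V+\sum_j u_jV_j)B))$ on intervals of constancy). A target $W_f$ is approximately reachable in time $T^+$ from $W_0$ if for every $\epsilon>0$ there exist $T_1\in[T,T+\epsilon]$ and piecewise constant $u:[0,T_1]\to\mathbb{R}^{2d+1}$ with $\|W(T_1;u,W_0)-W_f\|<\epsilon$. $Z(f)=f^{-1}(\{0\})$ (up to null sets). *)

theory Defs
  imports "HOL-Analysis.Analysis"
begin

text \<open>The torus T^d is identified (measure-theoretically) with the cube
  Q = [0, 2 pi]^d; functions on T^d are functions real^'d => real, of which
  only the values on Q matter (test functions are 2pi-periodic on all of R^d).
  The dimension d is CARD('d).\<close>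

definition Qcube :: "(real^'d::finite) set" where
  "Qcube = cbox 0 (\<chi> i. 2 * pi)"

abbreviation tmeas :: "(real^'d::finite) measure" where
  "tmeas \<equiv> lebesgue_on Qcube"

definition Lp_fun :: "real \<Rightarrow> (real^'d::finite \<Rightarrow> real) \<Rightarrow> bool" where
  "Lp_fun p f \<longleftrightarrow> f \<in> borel_measurable tmeas \<and> integrable tmeas (\<lambda>x. \<bar>f x\<bar> powr p)"

definition L2_fun :: "(real^'d::finite \<Rightarrow> real) \<Rightarrow> bool" where
  "L2_fun f \<longleftrightarrow> f \<in> borel_measurable tmeas \<and> integrable tmeas (\<lambda>x. (f x)^2)"

definition pd :: "'d::finite \<Rightarrow> (real^'d \<Rightarrow> real) \<Rightarrow> real^'d \<Rightarrow> real" where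
  "pd j f x = frechet_derivative f (at x) (axis j 1)"

coinductive smooth_fun :: "(real^'d::finite \<Rightarrow> real) \<Rightarrow> bool" where
  "(\<forall>x. f differentiable (at x)) \<Longrightarrow> (\<forall>j. smooth_fun (pd j f)) \<Longrightarrow> smooth_fun f"

definition periodic_fun :: "(real^'d::finite \<Rightarrow> real) \<Rightarrow> bool" where
  "periodic_fun f \<longleftrightarrow> (\<forall>x j. f (x + (2 * pi) *\<^sub>R axis j 1) = f x)"

definition weak_pd :: "'d::finite \<Rightarrow> (real^'d \<Rightarrow> real) \<Rightarrow> (real^'d \<Rightarrow> real) \<Rightarrow> bool" where
  "weak_pd j f g \<longleftrightarrow> (\<forall>\<phi>. smooth_fun \<phi> \<and> periodic_fun \<phi> \<longrightarrow>
      (LINT x|tmeas. f x * pd j \<phi> x) = - (LINT x|tmeas. g x * \<phi> x))"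

definition H1_fun :: "(real^'d::finite \<Rightarrow> real) \<Rightarrow> bool" where
  "H1_fun f \<longleftrightarrow> L2_fun f \<and> (\<forall>j. \<exists>g. L2_fun g \<and> weak_pd j f g)"

definition wd :: "'d::finite \<Rightarrow> (real^'d \<Rightarrow> real) \<Rightarrow> real^'d \<Rightarrow> real" where
  "wd j f = (SOME g. L2_fun g \<and> weak_pd j f g)"

definition H2_fun :: "(real^'d::finite \<Rightarrow> real) \<Rightarrow> bool" where
  "H2_fun f \<longleftrightarrow> H1_fun f \<and> (\<forall>j. H1_fun (wd j f))"

definition wlap :: "(real^'d::finite \<Rightarrow> real) \<Rightarrow> real^'d \<Rightarrow> real" where
  "wlap f x = (\<Sum>j\<in>UNIV. wd j (wd j f) x)"

type_synonym 'd st = "(real^'d \<Rightarrow> real) \<times> (real^'d \<Rightarrow> real)"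

definition Xsp :: "'d::finite st \<Rightarrow> bool" where
  "Xsp W \<longleftrightarrow> H1_fun (fst W) \<and> L2_fun (snd W)"

definition DA :: "'d::finite st \<Rightarrow> bool" where
  "DA W \<longleftrightarrow> H2_fun (fst W) \<and> H1_fun (snd W)"

definition Aop :: "'d::finite st \<Rightarrow> 'd st" where
  "Aop W = (snd W, \<lambda>x. wlap (fst W) x - fst W x)"

definition sadd :: "'d::finite st \<Rightarrow> 'd st \<Rightarrow> 'd st" where
  "sadd W U = (\<lambda>x. fst W x + fst U x, \<lambda>x. snd W x + snd U x)"

definition sdiff :: "'d::finite st \<Rightarrow> 'd st \<Rightarrow> 'd st" where
  "sdiff W U = (\<lambda>x. fst W x - fst U x, \<lambda>x. snd W x - snd U x)"

definition sscale :: "real \<Rightarrow> 'd::finite st \<Rightarrow> 'd st" where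
  "sscale a W = (\<lambda>x. a * fst W x, \<lambda>x. a * snd W x)"

definition sinner :: "'d::finite st \<Rightarrow> 'd st \<Rightarrow> real" where
  "sinner W U = (LINT x|tmeas. (\<Sum>j\<in>UNIV. wd j (fst W) x * wd j (fst U) x)
                    + fst W x * fst U x + snd W x * snd U x)"

definition snorm :: "'d::finite st \<Rightarrow> real" where
  "snorm W = sqrt (sinner W W)"

definition mulpot :: "(real^'d::finite \<Rightarrow> real) \<Rightarrow> 'd st \<Rightarrow> 'd st" where
  "mulpot c W = (\<lambda>x. 0, \<lambda>x. c x * fst W x)"

text \<open>S is the strongly continuous group of bounded linear operators on H^1 x L^2
  (elements identified up to norm zero, i.e. a.e.) whose generator extends A
  on D(A) = H^2 x H^1; since A is itself a generator, this determines the group e^{tA}.\<close>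
definition wave_group :: "(real \<Rightarrow> 'd::finite st \<Rightarrow> 'd st) \<Rightarrow> bool" where
  "wave_group S \<longleftrightarrow>
     (\<forall>t W. Xsp W \<longrightarrow> Xsp (S t W)) \<and>
     (\<forall>t W U. Xsp W \<and> Xsp U \<and> snorm (sdiff W U) = 0 \<longrightarrow> snorm (sdiff (S t W) (S t U)) = 0) \<and>
     (\<forall>t a W U. Xsp W \<and> Xsp U \<longrightarrow>
        snorm (sdiff (S t (sadd (sscale a W) U)) (sadd (sscale a (S t W)) (S t U))) = 0) \<and>
     (\<forall>t. \<exists>M. \<forall>W. Xsp W \<longrightarrow> snorm (S t W) \<le> M * snorm W) \<and>
     (\<forall>W. Xsp W \<longrightarrow> snorm (sdiff (S 0 W) W) = 0) \<and>
     (\<forall>t s W. Xsp W \<longrightarrow> snorm (sdiff (S (t + s) W) (S t (S s W))) = 0) \<and>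
     (\<forall>W t0. Xsp W \<longrightarrow> ((\<lambda>t. snorm (sdiff (S t W) (S t0 W))) \<longlongrightarrow> 0) (at t0)) \<and>
     (\<forall>W. DA W \<longrightarrow>
        ((\<lambda>h. snorm (sdiff (sscale (1 / h) (sdiff (S h W) W)) (Aop W))) \<longlongrightarrow> 0) (at 0))"

definition expA :: "real \<Rightarrow> 'd::finite st \<Rightarrow> 'd st" where
  "expA = (SOME S. wave_group S)"

text \<open>I = integral from 0 to t of F(s) ds in H^1 x L^2 (oriented), characterised
  via the inner product (for continuous integrands this is the Bochner integral).\<close>
definition sint_eq :: "(real \<Rightarrow> 'd::finite st) \<Rightarrow> real \<Rightarrow> 'd st \<Rightarrow> bool" where
  "sint_eq F t I \<longleftrightarrow> Xsp I \<and> (\<forall>\<Phi>. Xsp \<Phi> \<longrightarrow>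
     (if 0 \<le> t then ((\<lambda>s. sinner (F s) \<Phi>) has_integral sinner I \<Phi>) {0..t}
      else ((\<lambda>s. sinner (F s) \<Phi>) has_integral - sinner I \<Phi>) {t..0}))"

text \<open>W = exp(t(A + cB)) W0 : the mild (Duhamel) solution, W in C^0(R, H^1 x L^2).\<close>
definition traj :: "(real^'d::finite \<Rightarrow> real) \<Rightarrow> 'd st \<Rightarrow> (real \<Rightarrow> 'd st) \<Rightarrow> bool" where
  "traj c W0 W \<longleftrightarrow> (\<forall>t. Xsp (W t)) \<and>
     (\<forall>t0. ((\<lambda>t. snorm (sdiff (W t) (W t0))) \<longlongrightarrow> 0) (at t0)) \<and>
     (\<forall>t. \<exists>I. sint_eq (\<lambda>s. expA (t - s) (mulpot c (W s))) t I \<and>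
              snorm (sdiff (W t) (sadd (expA t W0) I)) = 0)"

definition flow :: "(real^'d::finite \<Rightarrow> real) \<Rightarrow> real \<Rightarrow> 'd st \<Rightarrow> 'd st \<Rightarrow> bool" where
  "flow c \<tau> W0 W1 \<longleftrightarrow> (\<exists>W. traj c W0 W \<and> W1 = W \<tau>)"

definition pot :: "(real^'d::finite \<Rightarrow> real) \<Rightarrow> real \<Rightarrow> real^'d \<Rightarrow> real^'d \<Rightarrow> real^'d \<Rightarrow> real" where
  "pot V u0 us uc x = V x + u0 + (\<Sum>j\<in>UNIV. us $ j * sin (x $ j) + uc $ j * cos (x $ j))"

text \<open>A piecewise constant control is a list of pieces (duration, u_0, (u_{2j-1})_j, (u_{2j})_j).\<close>
fun run :: "(real^'d::finite \<Rightarrow> real) \<Rightarrow> (real \<times> real \<times> (real^'d) \<times> (real^'d)) list \<Rightarrow> 'd st \<Rightarrow> 'd st \<Rightarrow> bool" where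
  "run V [] W0 W1 \<longleftrightarrow> W1 = W0"
| "run V ((\<tau>, u0, us, uc) # cs) W0 W2 \<longleftrightarrow>
     (\<exists>W1. flow (pot V u0 us uc) \<tau> W0 W1 \<and> run V cs W1 W2)"

definition approx_reachable :: "(real^'d::finite \<Rightarrow> real) \<Rightarrow> real \<Rightarrow> 'd st \<Rightarrow> 'd st \<Rightarrow> bool" where
  "approx_reachable V T W0 Wf \<longleftrightarrow> (\<forall>\<epsilon>>0. \<exists>cs Wend.
      (\<forall>p\<in>set cs. fst p > 0) \<and>
      T \<le> sum_list (map fst cs) \<and> sum_list (map fst cs) \<le> T + \<epsilon> \<and>
      run V cs W0 Wend \<and> snorm (sdiff Wend Wf) < \<epsilon>)"

end

theory Submission
  imports Defs
begin

text \<open>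
  In a real Fourier basis the energy space becomes \<open>\<ell>\<^sup>2 \<times> \<ell>\<^sup>2\<close> and the free wave group a rotation by the
  angles \<open>t (1 + |k|\<^sup>2)\<^sup>1\<^sup>/\<^sup>2\<close>. By Sobolev embedding, multiplication by a potential in \<open>L\<^sup>\<rho>\<close> is bounded
  from \<open>H\<^sup>1\<close> to \<open>L\<^sup>2\<close>, so mild solutions exist and depend continuously on the initial state.

  As \<open>\<tau> \<rightarrow> 0\<close>, the control \<open>\<phi> / \<tau>\<close> acting during time \<open>\<tau>\<close> realises the impulse
  \<open>(w, v) \<mapsto> (w, v + \<phi> w)\<close>, and conjugating the uncontrolled evolution over time \<open>\<tau>\<close> by the impulses of
  \<open>\<plusminus> \<tau>\<^sup>-\<^sup>1\<^sup>/\<^sup>2 \<phi>\<close> realises the impulse of \<open>- \<phi>\<^sup>2\<close>. For \<open>\<phi> = cos (k \<bullet> x)\<close> and \<open>\<phi> = sin (k \<bullet> x)\<close> the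
  relation \<open>cos\<^sup>2 + sin\<^sup>2 = 1\<close> makes squares available with both signs, and then polarisation gives
  products. Starting from \<open>1\<close>, \<open>sin x\<^sub>j\<close>, \<open>cos x\<^sub>j\<close> this reaches the impulses of all trigonometric
  polynomials. These are dense in \<open>L\<^sup>2(w\<^sub>0\<^sup>2 dx)\<close>, hence the products \<open>\<phi> w\<^sub>0\<close> are dense among the
  square-integrable functions vanishing on the zero set of \<open>w\<^sub>0\<close>.
\<close>

subsection \<open>Square-integrable functions\<close>

text \<open>Write \<open>K\<close> for \<open>mult_op \<phi>\<close> and \<open>A\<close> for the
  free generator. Since \<open>K\<close> turns position into velocity, K K = 0. Conjugating the
  evolution over a time h^2 by impulses of size 1/h therefore leaves 1 - K A K in the limit: the
  terms in 1/h cancel, those in h vanish, and K A K sends (w, v) to (0, \<phi>^2 w). Time runs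
  forward, so this square comes with one sign only, and the other sign has to be obtained from cos^2
  + sin^2 = 1. The obstacle is that \<open>V\<close> is merely in L^\<rho> while the state has size
  1/h between the two impulses. The remainder caused by \<open>V\<close> is therefore measured in
  the weaker L^2 norm of its position, where it gains an extra factor of time. In dimension d \<ge>
  3 the exponent \<rho> = d is the endpoint, so H^1 must be embedded in L^p with the critical p =
  2d/(d-2). The group e^{tA} is given by a choice operator; hence every family satisfying
  \<open>wave_group\<close> is identified with the rotation before any trajectory can be
  exhibited.\<close>

definition square_int :: "'a measure \<Rightarrow> ('a \<Rightarrow> real) \<Rightarrow> bool" where
  "square_int M f \<longleftrightarrow> f \<in> borel_measurable M \<and> integrable M (\<lambda>x. (f x)\<^sup>2)"

lemma L2_fun_square_int: "L2_fun f \<longleftrightarrow> square_int tmeas f"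
  by (simp add: L2_fun_def square_int_def)

lemma square_int_measurable[measurable_dest]: "square_int M f \<Longrightarrow> f \<in> borel_measurable M"
  by (simp add: square_int_def)

lemma square_int_integrable: "square_int M f \<Longrightarrow> integrable M (\<lambda>x. (f x)\<^sup>2)"
  by (simp add: square_int_def)

lemma square_int_mult_integrable:
  assumes "square_int M f" "square_int M g"
  shows "integrable M (\<lambda>x. f x * g x)"
proof (rule Bochner_Integration.integrable_bound)
  show "integrable M (\<lambda>x. (f x)\<^sup>2 + (g x)\<^sup>2)"
    using assms by (simp add: square_int_def)
  show "(\<lambda>x. f x * g x) \<in> borel_measurable M"
    using assms by (auto simp: square_int_def)
  have "\<bar>f x * g x\<bar> \<le> (f x)\<^sup>2 + (g x)\<^sup>2" for x
  proof -
    have "2 * (\<bar>f x\<bar> * \<bar>g x\<bar>) \<le> (f x)\<^sup>2 + (g x)\<^sup>2"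
      using sum_squares_bound[of "\<bar>f x\<bar>" "\<bar>g x\<bar>"] by (simp add: mult.assoc)
    moreover have "0 \<le> \<bar>f x\<bar> * \<bar>g x\<bar>" by simp
    ultimately show ?thesis unfolding abs_mult by linarith
  qed
  then show "AE x in M. norm (f x * g x) \<le> norm ((f x)\<^sup>2 + (g x)\<^sup>2)"
    by auto
qed

lemma square_int_bound:
  assumes "square_int M g" "f \<in> borel_measurable M" "AE x in M. \<bar>f x\<bar> \<le> \<bar>g x\<bar>"
  shows "square_int M f"
  unfolding square_int_def
proof
  show "integrable M (\<lambda>x. (f x)\<^sup>2)"
  proof (rule Bochner_Integration.integrable_bound)
    show "integrable M (\<lambda>x. (g x)\<^sup>2)" using assms by (simp add: square_int_def)
    show "AE x in M. norm ((f x)\<^sup>2) \<le> norm ((g x)\<^sup>2)"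
      using assms(3) by eventually_elim (simp add: abs_le_square_iff)
  qed (use assms in auto)
qed (use assms in auto)

lemma square_int_zero[simp]: "square_int M (\<lambda>x. 0)"
  by (simp add: square_int_def)

lemma square_int_scale: "square_int M f \<Longrightarrow> square_int M (\<lambda>x. a * f x)"
  by (auto simp: square_int_def power_mult_distrib)

lemma square_int_add:
  assumes "square_int M f" "square_int M g"
  shows "square_int M (\<lambda>x. f x + g x)"
  using assms square_int_mult_integrable[OF assms]
  by (auto simp: square_int_def power2_sum mult.assoc)

lemma square_int_uminus: "square_int M f \<Longrightarrow> square_int M (\<lambda>x. - f x)"
  using square_int_scale[of M f "-1"] by simp

lemma square_int_diff:
  assumes "square_int M f" "square_int M g"
  shows "square_int M (\<lambda>x. f x - g x)"
  using square_int_add[OF assms(1) square_int_uminus[OF assms(2)]] by simp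

lemma square_int_sum:
  assumes "\<And>i. i \<in> I \<Longrightarrow> square_int M (f i)"
  shows "square_int M (\<lambda>x. \<Sum>i\<in>I. f i x)"
  using assms by (induction I rule: infinite_finite_induct) (auto intro: square_int_add)

lemma square_int_bounded_mult:
  assumes "square_int M f" "g \<in> borel_measurable M" "AE x in M. \<bar>g x\<bar> \<le> B"
  shows "square_int M (\<lambda>x. g x * f x)"
proof (rule square_int_bound)
  show "square_int M (\<lambda>x. B * f x)" by (rule square_int_scale) fact
  show "AE x in M. \<bar>g x * f x\<bar> \<le> \<bar>B * f x\<bar>"
    using assms(3) by eventually_elim (simp add: abs_mult mult_right_mono)
qed (use assms in \<open>auto simp: square_int_def\<close>)

lemma sq_add_le: "((a::real) + b)\<^sup>2 \<le> 2 * a\<^sup>2 + 2 * b\<^sup>2"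
  using sum_squares_bound[of a b] by (simp add: power2_sum)

lemma square_int_triangle:
  assumes "square_int M f" "square_int M g"
  shows "(LINT x|M. (f x + g x)\<^sup>2) \<le> 2 * (LINT x|M. (f x)\<^sup>2) + 2 * (LINT x|M. (g x)\<^sup>2)"
proof -
  have "(LINT x|M. (f x + g x)\<^sup>2) \<le> (LINT x|M. 2 * (f x)\<^sup>2 + 2 * (g x)\<^sup>2)"
    using square_int_add[OF assms] assms
    by (intro integral_mono) (auto simp: square_int_def sq_add_le)
  then show ?thesis using assms by (simp add: square_int_def)
qed

text \<open>Fatou's lemma for the squares. The threshold \<open>N\<close> admits bounds that hold
  only eventually, as along a Cauchy sequence.\<close>

lemma square_int_Fatou:
  assumes s: "\<And>n. square_int M (s n)" and f: "f \<in> borel_measurable M"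
    and lim: "AE x in M. (\<lambda>n. s n x) \<longlonglongrightarrow> f x"
    and B: "\<And>n. n \<ge> N \<Longrightarrow> (LINT x|M. (s n x)\<^sup>2) \<le> B"
  shows "square_int M f" "(LINT x|M. (f x)\<^sup>2) \<le> B"
proof -
  have [measurable]: "f \<in> borel_measurable M" "\<And>n. s n \<in> borel_measurable M"
    using f s by (auto simp: square_int_def)
  have B0: "B \<ge> 0"
    by (rule order_trans[OF _ B[of N]]) (auto intro!: Bochner_Integration.integral_nonneg)
  have "(\<integral>\<^sup>+x. ennreal ((f x)\<^sup>2) \<partial>M) = (\<integral>\<^sup>+x. liminf (\<lambda>n. ennreal ((s (n + N) x)\<^sup>2)) \<partial>M)"
  proof (rule nn_integral_cong_AE)
    show "AE x in M. ennreal ((f x)\<^sup>2) = liminf (\<lambda>n. ennreal ((s (n + N) x)\<^sup>2))"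
      using lim
    proof eventually_elim
      case (elim x)
      have "(\<lambda>n. ennreal ((s (n + N) x)\<^sup>2)) \<longlonglongrightarrow> ennreal ((f x)\<^sup>2)"
        by (intro tendsto_ennrealI tendsto_power) (rule LIMSEQ_ignore_initial_segment[OF elim])
      then show ?case
        by (metis lim_imp_Liminf trivial_limit_sequentially)
    qed
  qed
  also have "\<dots> \<le> liminf (\<lambda>n. \<integral>\<^sup>+x. ennreal ((s (n + N) x)\<^sup>2) \<partial>M)"
    by (rule nn_integral_liminf) auto
  also have "\<dots> \<le> ennreal B"
  proof (rule Liminf_le)
    show "\<forall>\<^sub>F n in sequentially. (\<integral>\<^sup>+x. ennreal ((s (n + N) x)\<^sup>2) \<partial>M) \<le> ennreal B"
    proof (intro always_eventually allI)
      fix n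
      have "(\<integral>\<^sup>+x. ennreal ((s (n + N) x)\<^sup>2) \<partial>M) = ennreal (LINT x|M. (s (n + N) x)\<^sup>2)"
        by (rule nn_integral_eq_integral) (use s in \<open>auto simp: square_int_def\<close>)
      also have "\<dots> \<le> ennreal B" using B[of "n + N"] by (simp add: ennreal_leI)
      finally show "(\<integral>\<^sup>+x. ennreal ((s (n + N) x)\<^sup>2) \<partial>M) \<le> ennreal B" .
    qed
  qed simp
  finally have le: "(\<integral>\<^sup>+x. ennreal ((f x)\<^sup>2) \<partial>M) \<le> ennreal B" .
  then have int: "integrable M (\<lambda>x. (f x)\<^sup>2)"
    by (intro integrableI_nonneg) (auto simp: top_unique less_top intro: le_less_trans)
  then show "square_int M f" by (simp add: square_int_def)
  have "ennreal (LINT x|M. (f x)\<^sup>2) \<le> ennreal B"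
    using nn_integral_eq_integral[OF int] le by simp
  then show "(LINT x|M. (f x)\<^sup>2) \<le> B" using B0 by simp
qed

text \<open>Riesz-Fischer: a subsequence with fast decreasing distances converges almost everywhere,
  and its pointwise limit is then shown to be the limit of the whole sequence in L^2.\<close>

lemma square_int_complete:
  assumes s: "\<And>n. square_int M (s n)"
    and C: "\<And>e. e > 0 \<Longrightarrow> \<exists>N. \<forall>m\<ge>N. \<forall>n\<ge>N. (LINT x|M. (s m x - s n x)\<^sup>2) < e"
  obtains f where "square_int M f" "(\<lambda>n. LINT x|M. (s n x - f x)\<^sup>2) \<longlonglongrightarrow> 0"
proof -
  have [measurable]: "\<And>n. s n \<in> borel_measurable M" using s by (simp add: square_int_def)
  have "\<exists>N. \<forall>m\<ge>N. \<forall>n\<ge>N. (LINT x|M. (s m x - s n x)\<^sup>2) < (1/4)^k" for k :: nat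
    using C[of "(1/4)^k"] by simp
  then obtain N where N: "\<And>k m n. m \<ge> N k \<Longrightarrow> n \<ge> N k \<Longrightarrow> (LINT x|M. (s m x - s n x)\<^sup>2) < (1/4)^k"
    by metis
  define r where "r k = Max (N ` {..k}) + k" for k
  have rN: "r k \<ge> N k" "r (Suc k) \<ge> N k" "r k \<ge> k" for k
  proof -
    have "N k \<le> Max (N ` {..k})" "N k \<le> Max (N ` {..Suc k})" by (auto intro!: Max_ge)
    then show "r k \<ge> N k" "r (Suc k) \<ge> N k" "r k \<ge> k" unfolding r_def by linarith+
  qed
  define d where "d k x = s (r (Suc k)) x - s (r k) x" for k x
  have d_sq: "square_int M (d k)" for k
    unfolding d_def by (rule square_int_diff[OF s s])
  have [measurable]: "d k \<in> borel_measurable M" for k using d_sq by (auto simp: square_int_def)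
  have d_int: "(LINT x|M. (d k x)\<^sup>2) \<le> (1/4)^k" for k
    unfolding d_def using N[OF rN(2) rN(1)] by (rule less_imp_le)
  \<comment> \<open>The weight \<open>2^k\<close> is small enough to keep the integrals
    geometrically summable, since the squares are below 4^-k, and large enough to dominate
    \<open>\<bar>d k x\<bar>\<close> whenever that exceeds 2^-k.\<close>
  have nn: "(\<integral>\<^sup>+x. ennreal (2^k * (d k x)\<^sup>2) \<partial>M) \<le> ennreal ((1/2)^k)" for k
  proof -
    have "(\<integral>\<^sup>+x. ennreal (2^k * (d k x)\<^sup>2) \<partial>M) = ennreal (LINT x|M. 2^k * (d k x)\<^sup>2)"
      by (rule nn_integral_eq_integral) (use d_sq in \<open>auto simp: square_int_def\<close>)
    also have "(LINT x|M. 2^k * (d k x)\<^sup>2) \<le> 2^k * (1/4)^k"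
      using d_int[of k] by (simp add: mult_left_mono)
    also have "2^k * (1/4)^k = ((1/2)^k :: real)"
      by (simp flip: power_mult_distrib)
    finally show ?thesis by (simp add: ennreal_leI)
  qed
  have "(\<integral>\<^sup>+x. (\<Sum>k. ennreal (2^k * (d k x)\<^sup>2)) \<partial>M) = (\<Sum>k. \<integral>\<^sup>+x. ennreal (2^k * (d k x)\<^sup>2) \<partial>M)"
    by (rule nn_integral_suminf) auto
  also have "\<dots> \<le> (\<Sum>k. ennreal ((1/2)^k))" by (intro suminf_le nn) auto
  also have "\<dots> < \<infinity>" by (subst suminf_ennreal2) (auto intro!: summable_geometric)
  finally have "AE x in M. (\<Sum>k. ennreal (2^k * (d k x)\<^sup>2)) \<noteq> \<infinity>"
    by (intro nn_integral_PInf_AE) auto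
  then have conv: "AE x in M. convergent (\<lambda>k. s (r k) x)"
  proof eventually_elim
    case (elim x)
    then have sm: "summable (\<lambda>k. 2^k * (d k x)\<^sup>2)"
      by (intro summable_suminf_not_top) auto
    \<comment> \<open>both summands are summable almost everywhere\<close>
    have "\<bar>d k x\<bar> \<le> (1/2)^k + 2^k * (d k x)\<^sup>2" for k
    proof (cases "\<bar>d k x\<bar> \<le> (1/2)^k")
      case False
      then have "1 \<le> 2^k * \<bar>d k x\<bar>" by (simp add: power_one_over field_simps)
      then have "1 * \<bar>d k x\<bar> \<le> (2^k * \<bar>d k x\<bar>) * \<bar>d k x\<bar>" by (intro mult_right_mono) auto
      then have "\<bar>d k x\<bar> \<le> 2^k * (d k x)\<^sup>2" by (simp add: power2_eq_square mult.assoc)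
      then show ?thesis by (rule order_trans) simp
    next
      case True
      then show ?thesis by (intro order_trans[OF True]) simp
    qed
    then have "summable (\<lambda>k. \<bar>d k x\<bar>)"
      by (intro summable_comparison_test'[OF summable_add[OF summable_geometric[of "1/2::real"] sm]]) auto
    then have "summable (\<lambda>k. d k x)" by (rule summable_rabs_cancel)
    then have "convergent (\<lambda>n. \<Sum>k<n. d k x)" by (simp add: summable_iff_convergent)
    moreover have "(\<Sum>k<n. d k x) = s (r n) x - s (r 0) x" for n
      unfolding d_def by (rule sum_lessThan_telescope)
    ultimately have "convergent (\<lambda>n. s (r n) x - s (r 0) x)" by simp
    then show "convergent (\<lambda>k. s (r k) x)"
      using convergent_add[of "\<lambda>n. s (r n) x - s (r 0) x" "\<lambda>n. s (r 0) x"] by (simp add: convergent_const)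
  qed
  define f where "f x = lim (\<lambda>k. s (r k) x)" for x
  have f[measurable]: "f \<in> borel_measurable M" unfolding f_def by measurable
  have lim: "AE x in M. (\<lambda>k. s (r k) x) \<longlonglongrightarrow> f x"
    using conv by eventually_elim (simp add: f_def convergent_LIMSEQ_iff)
  \<comment> \<open>Fatou's lemma along \<open>n\<close> for \<open>s m - s (r n)\<close> with
    \<open>m\<close> fixed carries the Cauchy estimate over to \<open>s m - f\<close>, for every
    late \<open>m\<close> and not only those of the subsequence.\<close>
  have main: "\<exists>N. \<forall>m\<ge>N. square_int M (\<lambda>x. s m x - f x) \<and> (LINT x|M. (s m x - f x)\<^sup>2) \<le> e" if "e > 0" for e
  proof -
    obtain K where K: "\<And>m n. m \<ge> K \<Longrightarrow> n \<ge> K \<Longrightarrow> (LINT x|M. (s m x - s n x)\<^sup>2) < e"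
      using C[OF \<open>e > 0\<close>] by blast
    have "square_int M (\<lambda>x. s m x - f x) \<and> (LINT x|M. (s m x - f x)\<^sup>2) \<le> e" if m: "m \<ge> K" for m
    proof -
      have 1: "square_int M (\<lambda>x. s m x - s (r n) x)" for n by (rule square_int_diff[OF s s])
      have 2: "AE x in M. (\<lambda>n. s m x - s (r n) x) \<longlonglongrightarrow> s m x - f x"
        using lim by eventually_elim (intro tendsto_intros)
      have 3: "(LINT x|M. (s m x - s (r n) x)\<^sup>2) \<le> e" if "n \<ge> K" for n
        using K[OF m, of "r n"] rN(3)[of n] that by simp
      show ?thesis using square_int_Fatou[OF 1 _ 2 3] by simp
    qed
    then show ?thesis by blast
  qed
  obtain m where m: "square_int M (\<lambda>x. s m x - f x)" using main[of 1] by force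
  have "square_int M f" using square_int_diff[OF s[of m] m] by simp
  moreover have "(\<lambda>n. LINT x|M. (s n x - f x)\<^sup>2) \<longlonglongrightarrow> 0"
  proof (rule LIMSEQ_I)
    fix e :: real assume "e > 0"
    then obtain N where "\<forall>m\<ge>N. (LINT x|M. (s m x - f x)\<^sup>2) \<le> e/2"
      using main[of "e/2"] by auto
    then have "\<forall>n\<ge>N. norm ((LINT x|M. (s n x - f x)\<^sup>2) - 0) < e"
      using \<open>e > 0\<close> by (auto simp: abs_of_nonneg intro: le_less_trans)
    then show "\<exists>N. \<forall>n\<ge>N. norm ((LINT x|M. (s n x - f x)\<^sup>2) - 0) < e" by blast
  qed
  ultimately show ?thesis by (rule that)
qed

subsection \<open>Square-summable families\<close>

text \<open>Square summability is expressed through \<open>square_int\<close> for counting measure,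
  so that algebra and completeness are shared with the functions on the torus.\<close>

typedef 'i l2 = "{f :: 'i \<Rightarrow> real. square_int (count_space UNIV) f}" morphisms l2c Abs_l2
  by (rule exI[of _ "\<lambda>_. 0"]) simp

lemma l2c_square_int: "square_int (count_space UNIV) (l2c x)"
  using l2c by auto

lemma l2c_Abs: "square_int (count_space UNIV) f \<Longrightarrow> l2c (Abs_l2 f) = f"
  by (simp add: Abs_l2_inverse)

lemma l2_eqI: "(\<And>i. l2c x i = l2c y i) \<Longrightarrow> x = y"
  by (metis l2c_inject ext)

instantiation l2 :: (type) real_vector
begin
definition "0 = Abs_l2 (\<lambda>_. 0)"
definition "x + y = Abs_l2 (\<lambda>i. l2c x i + l2c y i)"
definition "x - y = Abs_l2 (\<lambda>i. l2c x i - l2c y i)"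
definition "- x = Abs_l2 (\<lambda>i. - l2c x i)"
definition "scaleR a x = Abs_l2 (\<lambda>i. a * l2c x i)"
lemma l2c_zero[simp]: "l2c 0 i = 0"
  by (simp add: zero_l2_def l2c_Abs)
lemma l2c_add[simp]: "l2c (x + y) i = l2c x i + l2c y i"
  by (simp add: plus_l2_def l2c_Abs square_int_add l2c_square_int)
lemma l2c_diff[simp]: "l2c (x - y) i = l2c x i - l2c y i"
  by (simp add: minus_l2_def l2c_Abs square_int_diff l2c_square_int)
lemma l2c_uminus[simp]: "l2c (- x) i = - l2c x i"
  by (simp add: uminus_l2_def l2c_Abs square_int_uminus l2c_square_int)
lemma l2c_scaleR[simp]: "l2c (a *\<^sub>R x) i = a * l2c x i"
  by (simp add: scaleR_l2_def l2c_Abs square_int_scale l2c_square_int)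
instance by standard (auto intro!: l2_eqI simp: algebra_simps)
end

instantiation l2 :: (type) real_inner
begin
definition "inner x y = (LINT i|count_space UNIV. l2c x i * l2c y i)"
definition "norm (x::'a l2) = sqrt (inner x x)"
definition "dist (x::'a l2) y = norm (x - y)"
definition "sgn (x::'a l2) = x /\<^sub>R norm x"
definition "(uniformity :: ('a l2 \<times> 'a l2) filter) = (INF e\<in>{0<..}. principal {(x, y). dist x y < e})"
definition "open (U :: 'a l2 set) \<longleftrightarrow> (\<forall>x\<in>U. eventually (\<lambda>(x', y). x' = x \<longrightarrow> y \<in> U) uniformity)"
instance
proof
  fix x y z :: "'a l2" and r :: real
  show "inner x y = inner y x" by (simp add: inner_l2_def mult.commute)
  show "inner (x + y) z = inner x z + inner y z"
    by (simp add: inner_l2_def distrib_right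
        Bochner_Integration.integral_add[OF square_int_mult_integrable[OF l2c_square_int l2c_square_int] square_int_mult_integrable[OF l2c_square_int l2c_square_int]])
  show "inner (r *\<^sub>R x) y = r * inner x y"
    by (simp add: inner_l2_def mult.assoc)
  show "0 \<le> inner x x" by (simp add: inner_l2_def)
  show "(inner x x = 0) = (x = 0)"
  proof
    assume "inner x x = 0"
    then have "AE i in count_space UNIV. l2c x i * l2c x i = 0"
      using square_int_mult_integrable[OF l2c_square_int l2c_square_int]
      by (subst (asm) inner_l2_def, subst (asm) integral_nonneg_eq_0_iff_AE) auto
    then show "x = 0" by (intro l2_eqI) (simp add: AE_count_space)
  qed (simp add: inner_l2_def)
qed (simp_all add: norm_l2_def dist_l2_def sgn_l2_def uniformity_l2_def open_l2_def)
end

lemma l2_norm_sq: "(norm x)\<^sup>2 = (LINT i|count_space UNIV. (l2c x i)\<^sup>2)"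
  by (simp add: norm_l2_def inner_l2_def power2_eq_square)

instance l2 :: (type) banach
proof
  fix X :: "nat \<Rightarrow> 'a l2" assume X: "Cauchy X"
  have "\<exists>N. \<forall>m\<ge>N. \<forall>n\<ge>N. (LINT i|count_space UNIV. (l2c (X m) i - l2c (X n) i)\<^sup>2) < e" if "e > 0" for e
  proof -
    obtain N where N: "\<forall>m\<ge>N. \<forall>n\<ge>N. norm (X m - X n) < sqrt e"
      using CauchyD[OF X real_sqrt_gt_zero[OF \<open>e > 0\<close>]] by blast
    have "(LINT i|count_space UNIV. (l2c (X m) i - l2c (X n) i)\<^sup>2) < e" if "m \<ge> N" "n \<ge> N" for m n
    proof -
      have "(norm (X m - X n))\<^sup>2 < (sqrt e)\<^sup>2" by (rule power_strict_mono) (use N that in auto)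
      then show ?thesis using \<open>e > 0\<close> by (simp add: l2_norm_sq)
    qed
    then show ?thesis by blast
  qed
  then obtain f where f: "square_int (count_space UNIV) f" "(\<lambda>n. LINT i|count_space UNIV. (l2c (X n) i - f i)\<^sup>2) \<longlonglongrightarrow> 0"
    using square_int_complete[of "count_space UNIV" "\<lambda>n. l2c (X n)"] l2c_square_int by blast
  have "(\<lambda>n. (norm (X n - Abs_l2 f))\<^sup>2) \<longlonglongrightarrow> 0"
    using f by (simp add: l2_norm_sq l2c_Abs)
  then have "(\<lambda>n. sqrt ((norm (X n - Abs_l2 f))\<^sup>2)) \<longlonglongrightarrow> sqrt 0" by (rule tendsto_real_sqrt)
  then have "(\<lambda>n. norm (X n - Abs_l2 f)) \<longlonglongrightarrow> 0" by simp
  then have "X \<longlonglongrightarrow> Abs_l2 f" by (simp add: tendsto_norm_zero_iff LIM_zero_iff)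
  then show "convergent X" by (auto simp: convergent_def)
qed

lemma l2_norm_mono:
  assumes "\<And>i. \<bar>l2c x i\<bar> \<le> C * \<bar>l2c y i\<bar>" "C \<ge> 0"
  shows "norm x \<le> C * norm y"
proof -
  have "(norm x)\<^sup>2 \<le> (LINT i|count_space UNIV. C\<^sup>2 * (l2c y i)\<^sup>2)"
    unfolding l2_norm_sq
  proof (rule integral_mono)
    fix i show "(l2c x i)\<^sup>2 \<le> C\<^sup>2 * (l2c y i)\<^sup>2"
      using assms(1)[of i] assms(2) by (metis abs_le_square_iff abs_mult abs_of_nonneg power_mult_distrib)
  qed (use l2c_square_int[of x] l2c_square_int[of y] in \<open>auto simp: square_int_def\<close>)
  also have "\<dots> = (C * norm y)\<^sup>2" by (simp only: power_mult_distrib l2_norm_sq integral_mult_right_zero)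
  finally show ?thesis by (rule power2_le_imp_le) (use assms(2) in simp)
qed

text \<open>Dominated convergence for counting measure. It yields the strong continuity of diagonal
  operators and the convergence of partial sums.\<close>

lemma l2_dominated:
  fixes y :: "'i l2"
  assumes lim: "\<And>i. (\<lambda>n. l2c (x n) i) \<longlonglongrightarrow> l2c y i"
    and dom: "\<And>n i. \<bar>l2c (x n) i - l2c y i\<bar> \<le> \<bar>l2c g i\<bar>"
  shows "x \<longlonglongrightarrow> y"
proof -
  have "(\<lambda>n. LINT i|count_space UNIV. (l2c (x n - y) i)\<^sup>2) \<longlonglongrightarrow> integral\<^sup>L (count_space (UNIV :: 'i set)) (\<lambda>i. 0)"
  proof (rule Bochner_Integration.integral_dominated_convergence
      [where w="\<lambda>i. (l2c g i)\<^sup>2" and s="\<lambda>n i. (l2c (x n - y) i)\<^sup>2" and f="\<lambda>i. 0"])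
    show "AE i in count_space UNIV. (\<lambda>n. (l2c (x n - y) i)\<^sup>2) \<longlonglongrightarrow> 0"
    proof (rule AE_I2)
      fix i
      have "(\<lambda>n. (l2c (x n) i - l2c y i)\<^sup>2) \<longlonglongrightarrow> (l2c y i - l2c y i)\<^sup>2"
        by (intro tendsto_intros lim)
      then show "(\<lambda>n. (l2c (x n - y) i)\<^sup>2) \<longlonglongrightarrow> 0" by simp
    qed
    show "AE i in count_space UNIV. norm ((l2c (x n - y) i)\<^sup>2) \<le> (l2c g i)\<^sup>2" for n
      using dom[of n] by (simp add: abs_le_square_iff)
  qed (use l2c_square_int[of g] in \<open>auto simp: square_int_def\<close>)
  then have "(\<lambda>n. sqrt ((norm (x n - y))\<^sup>2)) \<longlonglongrightarrow> sqrt 0"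
    by (intro tendsto_real_sqrt) (simp add: l2_norm_sq)
  then have "(\<lambda>n. norm (x n - y)) \<longlonglongrightarrow> 0" by simp
  then show ?thesis by (simp add: tendsto_norm_zero_iff LIM_zero_iff)
qed

subsection \<open>The trigonometric basis of the torus\<close>

definition kdot :: "('d::finite \<Rightarrow> int) \<Rightarrow> real^'d \<Rightarrow> real" where
  "kdot k x = (\<Sum>j\<in>UNIV. of_int (k j) * x $ j)"

definition torus_vol :: "'d::finite itself \<Rightarrow> real" where
  "torus_vol _ = (2 * pi) ^ CARD('d)"

text \<open>With \<open>cos + sin\<close> in place of the exponential, the orthonormal basis is real and still indexed by all
  of \<open>\<int>\<^sup>d\<close>; the partial derivative in \<open>x\<^sub>j\<close> sends the element of index \<open>k\<close> to \<open>k\<^sub>j\<close> times that of index \<open>-k\<close>.\<close>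

definition trig_basis :: "('d::finite \<Rightarrow> int) \<Rightarrow> real^'d \<Rightarrow> real" where
  "trig_basis k x = (cos (kdot k x) + sin (kdot k x)) / sqrt (torus_vol TYPE('d))"

lemma torus_vol_pos[simp]: "torus_vol TYPE('d::finite) > 0"
  by (simp add: torus_vol_def)

lemma torus_vol_simps[simp]:
  "torus_vol TYPE('d::finite) \<noteq> 0" "torus_vol TYPE('d) \<ge> 0" "\<bar>torus_vol TYPE('d)\<bar> = torus_vol TYPE('d)"
  using torus_vol_pos[where 'd='d] by linarith+

lemma kdot_add: "kdot (\<lambda>j. k j + l j) x = kdot k x + kdot l x"
  by (simp add: kdot_def sum.distrib distrib_right)

lemma kdot_diff: "kdot (\<lambda>j. k j - l j) x = kdot k x - kdot l x"
  by (simp add: kdot_def sum_subtractf left_diff_distrib)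

lemma kdot_uminus[simp]: "kdot (\<lambda>j. - k j) x = - kdot k x"
  by (simp add: kdot_def sum_negf)

lemma kdot_axis[simp]: "kdot k (axis j 1) = of_int (k j)"
proof -
  have "kdot k (axis j 1) = (\<Sum>i\<in>UNIV. if i = j then of_int (k i) else 0)"
    unfolding kdot_def by (intro sum.cong) (auto simp: axis_def)
  then show ?thesis by simp
qed

lemma kdot_unit: "kdot (\<lambda>i. if i = j then 1 else 0) x = x $ j"
proof -
  have "kdot (\<lambda>i. if i = j then 1 else 0) x = (\<Sum>i\<in>UNIV. if i = j then x $ i else 0)"
    unfolding kdot_def by (intro sum.cong) auto
  then show ?thesis by simp
qed

lemma kdot_bounded_linear: "bounded_linear (kdot k)"
proof -
  have "linear (kdot k)"
    by (rule linearI) (simp_all add: kdot_def algebra_simps sum.distrib sum_distrib_left)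
  then show ?thesis by (simp add: linear_conv_bounded_linear)
qed

lemma kdot_linear_simps:
  "kdot k (x + y) = kdot k x + kdot k y" "kdot k (a *\<^sub>R x) = a * kdot k x"
  using linear_simps[OF kdot_bounded_linear, of k] by auto

lemma kdot_has_derivative: "(kdot k has_derivative kdot k) (at x)"
  by (rule bounded_linear_imp_has_derivative[OF kdot_bounded_linear])

lemma pd_eqI:
  assumes "(f has_derivative D) (at x)"
  shows "pd j f x = D (axis j 1)"
  unfolding pd_def using frechet_derivative_at[OF assms] by simp

lemma trig_basis_has_derivative:
  "(trig_basis k has_derivative (\<lambda>h. kdot k h * trig_basis (\<lambda>j. - k j) x)) (at x)"
proof -
  have "((\<lambda>x. cos (kdot k x) + sin (kdot k x)) has_derivative
     (\<lambda>h. kdot k h * (cos (kdot k x) - sin (kdot k x)))) (at x)"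
    by (auto intro!: derivative_eq_intros kdot_has_derivative simp: algebra_simps)
  from has_derivative_mult_right[OF this, of "1 / sqrt (torus_vol TYPE('a))"]
  show ?thesis by (simp add: trig_basis_def[abs_def])
qed

lemma pd_trig_basis: "pd j (trig_basis k) = (\<lambda>x. of_int (k j) * trig_basis (\<lambda>j. - k j) x)"
  by (rule ext) (simp add: pd_eqI[OF trig_basis_has_derivative])

inductive_set trigpoly :: "((real^'d::finite) \<Rightarrow> real) set" where
  trig_basis: "trig_basis k \<in> trigpoly"
| add: "f \<in> trigpoly \<Longrightarrow> g \<in> trigpoly \<Longrightarrow> (\<lambda>x. f x + g x) \<in> trigpoly"
| scale: "f \<in> trigpoly \<Longrightarrow> (\<lambda>x. a * f x) \<in> trigpoly"

lemma trigpoly_pd: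
  assumes "f \<in> trigpoly"
  shows "(\<forall>x. f differentiable (at x)) \<and> pd j f \<in> trigpoly"
  using assms
proof induction
  case (trig_basis k)
  show ?case
    using trig_basis_has_derivative[of k] by (auto simp: pd_trig_basis differentiable_def intro!: trigpoly.intros)
next
  case (add f g)
  have "pd j (\<lambda>x. f x + g x) = (\<lambda>x. pd j f x + pd j g x)"
  proof
    fix x
    have "((\<lambda>x. f x + g x) has_derivative (\<lambda>h. frechet_derivative f (at x) h + frechet_derivative g (at x) h)) (at x)"
      using add by (intro has_derivative_add) (auto simp: frechet_derivative_works)
    from pd_eqI[OF this] show "pd j (\<lambda>x. f x + g x) x = pd j f x + pd j g x"
      by (simp add: pd_def)
  qed
  then show ?case using add by (auto intro!: trigpoly.intros differentiable_add)
next
  case (scale f a)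
  have "pd j (\<lambda>x. a * f x) = (\<lambda>x. a * pd j f x)"
  proof
    fix x
    have "((\<lambda>x. a * f x) has_derivative (\<lambda>h. a * frechet_derivative f (at x) h)) (at x)"
      using scale by (intro has_derivative_mult_right) (auto simp: frechet_derivative_works)
    from pd_eqI[OF this] show "pd j (\<lambda>x. a * f x) x = a * pd j f x"
      by (simp add: pd_def)
  qed
  then show ?case using scale by (auto intro!: trigpoly.intros differentiable_mult)
qed

text \<open>Being closed under partial derivatives, \<open>trigpoly\<close> is an invariant for the
  coinductive definition of \<open>smooth_fun\<close>.\<close>

lemma trigpoly_smooth:
  assumes "f \<in> trigpoly" shows "smooth_fun f"
  using assms
proof (coinduction arbitrary: f)
  case smooth_fun
  then show ?case using trigpoly_pd by blast
qed

lemma smooth_fun_D: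
  assumes "smooth_fun f"
  shows "f differentiable (at x)" "smooth_fun (pd j f)" "continuous_on UNIV f"
proof -
  from assms show *: "\<And>x. f differentiable (at x)" "smooth_fun (pd j f)"
    by (auto elim: smooth_fun.cases)
  show "continuous_on UNIV f"
    using * by (simp add: continuous_at_imp_continuous_on differentiable_imp_continuous_within)
qed

lemmas trigpoly_continuous = smooth_fun_D(3)[OF trigpoly_smooth]

lemma trig_basis_periodic: "trig_basis k (x + (2 * pi) *\<^sub>R axis j 1) = trig_basis k x"
proof -
  have "kdot k (x + (2 * pi) *\<^sub>R axis j 1) = kdot k x + 2 * pi * of_int (k j)"
    by (simp add: kdot_linear_simps)
  then show ?thesis
    unfolding trig_basis_def by (simp add: cos_add sin_add)
qed

lemma trigpoly_periodic: "f \<in> trigpoly \<Longrightarrow> periodic_fun f"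
  by (induction rule: trigpoly.induct) (auto simp: periodic_fun_def trig_basis_periodic)

lemma trigpoly_cos_sin:
  "(\<lambda>x. cos (kdot k x)) \<in> trigpoly" "(\<lambda>x. sin (kdot k x)) \<in> trigpoly"
proof -
  let ?c = "sqrt (torus_vol TYPE('a))"
  have c: "?c \<noteq> 0" using torus_vol_pos[where 'd='a] by simp
  have e1: "(\<lambda>x. cos (kdot k x)) = (\<lambda>x. ?c / 2 * trig_basis k x + ?c / 2 * trig_basis (\<lambda>j. - k j) x)"
    using c by (intro ext) (simp add: trig_basis_def field_simps)
  show "(\<lambda>x. cos (kdot k x)) \<in> trigpoly" unfolding e1 by (intro trigpoly.intros)
  have e2: "(\<lambda>x. sin (kdot k x)) = (\<lambda>x. ?c / 2 * trig_basis k x + (- ?c / 2) * trig_basis (\<lambda>j. - k j) x)"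
    using c by (intro ext) (simp add: trig_basis_def field_simps)
  show "(\<lambda>x. sin (kdot k x)) \<in> trigpoly" unfolding e2 by (intro trigpoly.intros)
qed

text \<open>From (cos a + sin a)(cos b + sin b) = cos (a - b) + sin (a + b). This gives both closure
  of \<open>trigpoly\<close> under products and, after integration, orthonormality.\<close>

lemma trig_basis_mult:
  "trig_basis k x * trig_basis l x = (cos (kdot (\<lambda>j. k j - l j) x) + sin (kdot (\<lambda>j. k j + l j) x)) / torus_vol TYPE('d)"
  for k :: "'d::finite \<Rightarrow> int"
proof -
  have "sqrt (torus_vol TYPE('d)) * sqrt (torus_vol TYPE('d)) = torus_vol TYPE('d)"
    using torus_vol_pos[where 'd='d] by simp
  then show ?thesis
    by (simp add: trig_basis_def kdot_add kdot_diff cos_diff sin_add algebra_simps)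
qed

lemma trigpoly_mult_trig_basis:
  assumes "g \<in> trigpoly" shows "(\<lambda>x. trig_basis k x * g x) \<in> trigpoly"
  using assms
proof induction
  case (trig_basis l)
  have "(\<lambda>x. 1 / torus_vol TYPE('a) * (cos (kdot (\<lambda>j. k j - l j) x) + sin (kdot (\<lambda>j. k j + l j) x))) \<in> trigpoly"
    by (intro trigpoly.scale trigpoly.add trigpoly_cos_sin)
  then show ?case by (simp add: trig_basis_mult)
next
  case (add f g)
  from trigpoly.add[OF add.IH] show ?case by (simp add: distrib_left)
next
  case (scale f a)
  from trigpoly.scale[OF scale.IH, of a] show ?case by (simp add: mult.left_commute)
qed

lemma trigpoly_mult:
  assumes "f \<in> trigpoly" "g \<in> trigpoly" shows "(\<lambda>x. f x * g x) \<in> trigpoly"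
  using assms(1)
proof induction
  case (trig_basis k) then show ?case by (rule trigpoly_mult_trig_basis[OF assms(2)])
next
  case (add f h)
  from trigpoly.add[OF add.IH] show ?case by (simp add: distrib_right)
next
  case (scale f a)
  from trigpoly.scale[OF scale.IH, of a] show ?case by (simp add: mult.assoc)
qed

lemma trigpoly_const: "(\<lambda>x. a) \<in> trigpoly"
  using trigpoly.scale[OF trigpoly_cos_sin(1)[of "\<lambda>j. 0"], of a] by (simp add: kdot_def)

lemma trigpoly_sum:
  assumes "\<And>i. i \<in> I \<Longrightarrow> f i \<in> trigpoly" shows "(\<lambda>x. \<Sum>i\<in>I. f i x) \<in> trigpoly"
  using assms by (induction I rule: infinite_finite_induct) (auto intro: trigpoly.add trigpoly_const)

subsection \<open>Integration over the fundamental cube\<close>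

lemma cube_continuous_integrable:
  fixes f :: "real^'d::finite \<Rightarrow> real"
  assumes "continuous_on UNIV f"
  shows "integrable tmeas f" "(LINT x|tmeas. f x) = integral Qcube f"
proof -
  show 1: "integrable tmeas f"
    unfolding Qcube_def using assms continuous_on_subset by (intro continuous_imp_integrable) blast
  show "(LINT x|tmeas. f x) = integral Qcube f"
    by (rule lebesgue_integral_eq_integral[OF 1]) (simp add: Qcube_def)
qed

lemma cube_continuous_measurable:
  fixes f :: "real^'d::finite \<Rightarrow> real"
  assumes "continuous_on UNIV f" shows "f \<in> borel_measurable tmeas"
  using cube_continuous_integrable(1)[OF assms] by auto

lemma cube_continuous_bounded:
  fixes f :: "real^'d::finite \<Rightarrow> real"
  assumes "continuous_on UNIV f"
  obtains B where "B > 0" "\<And>x. x \<in> Qcube \<Longrightarrow> \<bar>f x\<bar> \<le> B"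
proof -
  have "compact (f ` Qcube)"
    unfolding Qcube_def using assms by (intro compact_continuous_image) (auto intro: continuous_on_subset)
  then have "bounded (f ` Qcube)" by (rule compact_imp_bounded)
  then show ?thesis using that unfolding bounded_pos by auto
qed

lemma continuous_square_int:
  fixes f :: "real^'d::finite \<Rightarrow> real"
  assumes "continuous_on UNIV f" shows "square_int tmeas f"
  unfolding square_int_def
  using cube_continuous_measurable[OF assms] cube_continuous_integrable(1)[of "\<lambda>x. (f x)\<^sup>2"] assms
  by (auto intro!: continuous_intros)

text \<open>Only the side in direction \<open>j\<close> is variable: translations are made along one
  axis at a time, and a translated cube is cut and reassembled by slabs.\<close>

definition slab :: "'d::finite \<Rightarrow> real \<Rightarrow> real \<Rightarrow> (real^'d) set" where
  "slab j s t = cbox (\<chi> i. if i = j then s else 0) (\<chi> i. if i = j then t else 2 * pi)"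

lemma mem_slab: "x \<in> slab j s t \<longleftrightarrow> s \<le> x $ j \<and> x $ j \<le> t \<and> (\<forall>i. i \<noteq> j \<longrightarrow> 0 \<le> x $ i \<and> x $ i \<le> 2 * pi)"
  by (auto simp: slab_def mem_box_cart split: if_splits)

lemma integral_slab_split:
  fixes F :: "real^'d::finite \<Rightarrow> real"
  assumes "continuous_on UNIV F" "s \<le> t" "t \<le> u"
  shows "integral (slab j s u) F = integral (slab j s t) F + integral (slab j t u) F"
proof -
  have "integral (slab j s u) F = integral (slab j s u \<inter> {x. x \<bullet> axis j 1 \<le> t}) F
      + integral (slab j s u \<inter> {x. x \<bullet> axis j 1 \<ge> t}) F"
    unfolding slab_def using assms(1)
    by (intro integral_split integrable_continuous) (auto intro: continuous_on_subset)
  also have "slab j s u \<inter> {x. x \<bullet> axis j 1 \<le> t} = slab j s t"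
    using assms by (auto simp: mem_slab inner_axis)
  also have "slab j s u \<inter> {x. x \<bullet> axis j 1 \<ge> t} = slab j t u"
    using assms by (auto simp: mem_slab inner_axis)
  finally show ?thesis .
qed

lemma integral_slab_shift:
  fixes F :: "real^'d::finite \<Rightarrow> real"
  shows "integral (slab j s t) (\<lambda>x. F (x + h *\<^sub>R axis j 1)) = integral (slab j (s + h) (t + h)) F"
proof -
  have "(\<chi> i. if i = j then s else 0) = (\<chi> i. if i = j then s + h else 0) - h *\<^sub>R (axis j 1 :: real^'d)"
    "(\<chi> i. if i = j then t else 2 * pi) = (\<chi> i. if i = j then t + h else 2 * pi) - h *\<^sub>R (axis j 1 :: real^'d)"
    by (auto simp: vec_eq_iff axis_def)
  then show ?thesis unfolding slab_def by (simp add: integral_shift_cbox)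
qed

lemma Qcube_slab: "Qcube = slab j 0 (2 * pi)"
  by (auto simp: Qcube_def mem_slab mem_box_cart)

lemma integral_cube_shift:
  fixes F :: "real^'d::finite \<Rightarrow> real"
  assumes F: "continuous_on UNIV F" "periodic_fun F" and h: "0 \<le> h" "h \<le> 2 * pi"
  shows "integral Qcube (\<lambda>x. F (x + h *\<^sub>R axis j 1)) = integral Qcube F"
proof -
  have per: "F (x + (2 * pi) *\<^sub>R axis j 1) = F x" for x
    using F(2) by (simp add: periodic_fun_def)
  have "integral Qcube (\<lambda>x. F (x + h *\<^sub>R axis j 1)) = integral (slab j h (2 * pi + h)) F"
    unfolding Qcube_slab[of j] integral_slab_shift by simp
  also have "\<dots> = integral (slab j h (2 * pi)) F + integral (slab j (2 * pi) (2 * pi + h)) F"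
    using h by (intro integral_slab_split F) auto
  also have "integral (slab j (2 * pi) (2 * pi + h)) F = integral (slab j 0 h) F"
    using integral_slab_shift[of j 0 h F "2 * pi"] by (simp add: per add.commute)
  also have "integral (slab j h (2 * pi)) F + integral (slab j 0 h) F = integral (slab j 0 (2 * pi)) F"
    using h by (subst integral_slab_split[of F 0 h "2 * pi"]) (auto intro: F)
  finally show ?thesis by (simp add: Qcube_slab[of j])
qed

text \<open>The integral of a translate of a periodic function does not depend on the translation; differentiate it at \<open>0\<close>.\<close>

lemma integral_pd_zero:
  fixes F :: "real^'d::finite \<Rightarrow> real"
  assumes F: "\<And>x. F differentiable (at x)" "periodic_fun F" and c: "continuous_on UNIV (pd j F)"
  shows "(LINT x|tmeas. pd j F x) = 0"
proof -
  let ?e = "axis j 1 :: real^'d"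
  have cF: "continuous_on UNIV F"
    using F by (simp add: continuous_at_imp_continuous_on differentiable_imp_continuous_within)
  define I where "I h = integral Qcube (\<lambda>x. F (x + h *\<^sub>R ?e))" for h
  have der: "((\<lambda>h. F (x + h *\<^sub>R ?e)) has_vector_derivative pd j F (x + h *\<^sub>R ?e)) (at h within A)" for x h A
  proof -
    have 1: "((\<lambda>h. x + h *\<^sub>R ?e) has_derivative (\<lambda>t. t *\<^sub>R ?e)) (at h within A)"
      by (auto intro!: derivative_eq_intros)
    have 2: "(F has_derivative frechet_derivative F (at (x + h *\<^sub>R ?e))) (at (x + h *\<^sub>R ?e))"
      using F(1) by (simp add: frechet_derivative_works)
    have lin: "linear (frechet_derivative F (at (x + h *\<^sub>R ?e)))"
      using 2 by (rule has_derivative_linear)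
    from has_derivative_compose[OF 1 2] show ?thesis
      unfolding has_vector_derivative_def pd_def by (simp add: linear_scale[OF lin])
  qed
  have cs: "continuous_on UNIV (\<lambda>x. F (x + h *\<^sub>R ?e))" for h
    by (rule continuous_on_compose2[OF cF]) (auto intro!: continuous_intros)
  have "((\<lambda>h. integral (cbox 0 (\<chi> i. 2 * pi)) (\<lambda>x. F (x + h *\<^sub>R ?e))) has_vector_derivative
      integral (cbox 0 (\<chi> i. 2 * pi)) (\<lambda>x. pd j F (x + 0 *\<^sub>R ?e))) (at 0 within cbox 0 (2 * pi))"
  proof (rule leibniz_rule_vector_derivative)
    show "continuous_on (cbox 0 (2 * pi) \<times> cbox 0 (\<chi> i. 2 * pi)) (\<lambda>(h, x). pd j F (x + h *\<^sub>R ?e))"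
      unfolding split_beta by (rule continuous_on_compose2[OF c]) (auto intro!: continuous_intros)
  qed (auto intro!: der integrable_continuous intro: continuous_on_subset[OF cs])
  then have d1: "(I has_vector_derivative integral Qcube (pd j F)) (at 0 within cbox 0 (2 * pi))"
    by (simp add: I_def[abs_def] Qcube_def)
  \<comment> \<open>\<open>integral_cube_shift\<close> covers only shifts in [0, 2 pi], so the
    derivative at 0 is one-sided; on a nondegenerate interval it is still unique.\<close>
  have "(I has_vector_derivative 0) (at 0 within cbox 0 (2 * pi))"
    by (rule has_vector_derivative_transform[where f="\<lambda>_. I 0"])
      (auto simp: I_def integral_cube_shift[OF cF F(2)])
  from vector_derivative_unique_within_closed_interval[OF _ _ d1 this]
  have "integral Qcube (pd j F) = 0" by simp
  then show ?thesis by (simp add: cube_continuous_integrable(2)[OF c])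
qed

lemma pd_mult:
  fixes f g :: "real^'d::finite \<Rightarrow> real"
  assumes f: "smooth_fun f" and g: "smooth_fun g"
  shows "pd j (\<lambda>x. f x * g x) = (\<lambda>x. f x * pd j g x + pd j f x * g x)"
proof
  fix x
  have "((\<lambda>x. f x * g x) has_derivative (\<lambda>h. f x * frechet_derivative g (at x) h + frechet_derivative f (at x) h * g x)) (at x)"
    using smooth_fun_D(1)[OF f] smooth_fun_D(1)[OF g]
    by (intro has_derivative_mult) (auto simp: frechet_derivative_works)
  from pd_eqI[OF this] show "pd j (\<lambda>x. f x * g x) x = f x * pd j g x + pd j f x * g x"
    by (simp add: pd_def)
qed

lemma integral_by_parts:
  fixes f g :: "real^'d::finite \<Rightarrow> real"
  assumes f: "smooth_fun f" "periodic_fun f" and g: "smooth_fun g" "periodic_fun g"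
  shows "(LINT x|tmeas. f x * pd j g x) = - (LINT x|tmeas. pd j f x * g x)"
proof -
  note eq = pd_mult[OF f(1) g(1)]
  have c: "continuous_on UNIV (\<lambda>x. f x * pd j g x)" "continuous_on UNIV (\<lambda>x. pd j f x * g x)"
    by (intro continuous_on_mult smooth_fun_D(3)[OF f(1)] smooth_fun_D(3)[OF g(1)]
        smooth_fun_D(3)[OF smooth_fun_D(2)[OF f(1)]] smooth_fun_D(3)[OF smooth_fun_D(2)[OF g(1)]])+
  have "(LINT x|tmeas. pd j (\<lambda>x. f x * g x) x) = 0"
  proof (rule integral_pd_zero)
    show "(\<lambda>x. f x * g x) differentiable at x" for x
      using smooth_fun_D(1)[OF f(1)] smooth_fun_D(1)[OF g(1)] by (intro differentiable_mult) auto
    show "periodic_fun (\<lambda>x. f x * g x)" using f g by (simp add: periodic_fun_def)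
    show "continuous_on UNIV (pd j (\<lambda>x. f x * g x))"
      unfolding eq by (intro continuous_on_add c)
  qed
  then show ?thesis
    unfolding eq using cube_continuous_integrable(1)[OF c(1)] cube_continuous_integrable(1)[OF c(2)]
    by simp
qed

text \<open>If some \<open>m j\<close> is nonzero, each of the two functions is, up to that factor,
  a partial derivative of the other, and such derivatives integrate to zero by periodicity.\<close>

lemma integral_cos_sin:
  fixes m :: "'d::finite \<Rightarrow> int"
  shows "(LINT x|tmeas. cos (kdot m x)) = (if m = (\<lambda>_. 0) then torus_vol TYPE('d) else 0)"
    "(LINT x|tmeas. sin (kdot m x)) = 0"
proof -
  have z: "(LINT x|tmeas. cos (kdot m x)) = 0 \<and> (LINT x|tmeas. sin (kdot m x)) = 0" if "m \<noteq> (\<lambda>_. 0)"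
  proof -
    obtain j where j: "m j \<noteq> 0" using \<open>m \<noteq> (\<lambda>_. 0)\<close> by auto
    have d: "((\<lambda>x. sin (kdot m x)) has_derivative (\<lambda>h. kdot m h * cos (kdot m x))) (at x)"
      "((\<lambda>x. cos (kdot m x)) has_derivative (\<lambda>h. - kdot m h * sin (kdot m x))) (at x)" for x
      by (auto intro!: derivative_eq_intros kdot_has_derivative)
    have pds: "pd j (\<lambda>x. sin (kdot m x)) = (\<lambda>x. of_int (m j) * cos (kdot m x))"
      "pd j (\<lambda>x. cos (kdot m x)) = (\<lambda>x. - of_int (m j) * sin (kdot m x))"
      by (auto intro!: ext simp: pd_eqI[OF d(1)] pd_eqI[OF d(2)])
    have "(LINT x|tmeas. pd j f x) = 0" if "f \<in> trigpoly" for f :: "real^'d \<Rightarrow> real"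
      using trigpoly_pd[OF that] trigpoly_periodic[OF that] trigpoly_continuous
      by (intro integral_pd_zero) blast+
    from this[OF trigpoly_cos_sin(2), of m] this[OF trigpoly_cos_sin(1), of m] j
    show ?thesis unfolding pds by simp
  qed
  have one: "(LINT (x::real^'d)|tmeas. (1::real)) = torus_vol TYPE('d)"
  proof -
    have "(LINT (x::real^'d)|tmeas. (1::real)) = integral (Qcube :: (real^'d) set) (\<lambda>x. 1)"
      by (rule cube_continuous_integrable(2)) auto
    also have "\<dots> = measure lborel (Qcube :: (real^'d) set)" by (simp add: Qcube_def)
    also have "\<dots> = torus_vol TYPE('d)"
      unfolding Qcube_def by (subst content_cbox_cart) (auto simp: torus_vol_def interval_eq_empty_cart)
    finally show ?thesis .
  qed
  show "(LINT x|tmeas. cos (kdot m x)) = (if m = (\<lambda>_. 0) then torus_vol TYPE('d) else 0)"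
    using z one by (auto simp: kdot_def)
  show "(LINT x|tmeas. sin (kdot m x)) = 0"
    using z by (cases "m = (\<lambda>_. 0)") (auto simp: kdot_def)
qed

lemma trig_basis_orthonormal:
  fixes k l :: "'d::finite \<Rightarrow> int"
  shows "(LINT x|tmeas. trig_basis k x * trig_basis l x) = (if k = l then 1 else 0)"
proof -
  have c: "integrable tmeas (\<lambda>x. cos (kdot m x))" "integrable tmeas (\<lambda>x. sin (kdot m x))" for m :: "'d \<Rightarrow> int"
    by (intro cube_continuous_integrable trigpoly_continuous trigpoly_cos_sin)+
  have "(\<lambda>j. k j - l j) = (\<lambda>_. 0) \<longleftrightarrow> k = l" by (auto simp: fun_eq_iff)
  then show ?thesis
    using torus_vol_pos[where 'd='d] by (simp add: trig_basis_mult c integral_cos_sin)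
qed

lemma trig_basis_square_int: "square_int tmeas (trig_basis k)"
  by (intro continuous_square_int trigpoly_continuous trigpoly.trig_basis)

lemma trig_basis_bound: "\<bar>trig_basis k x\<bar> \<le> 2 / sqrt (torus_vol TYPE('d))" for k :: "'d::finite \<Rightarrow> int"
proof -
  have "\<bar>cos (kdot k x) + sin (kdot k x)\<bar> \<le> 2"
    using abs_cos_le_one[of "kdot k x"] abs_sin_le_one[of "kdot k x"] by linarith
  then show ?thesis by (simp add: trig_basis_def divide_right_mono)
qed

subsection \<open>Density of trigonometric polynomials\<close>

lemma trigpoly_coord: "(\<lambda>x. cos (x $ j)) \<in> trigpoly" "(\<lambda>x. sin (x $ j)) \<in> trigpoly"
proof -
  show "(\<lambda>x. cos (x $ j)) \<in> trigpoly" "(\<lambda>x. sin (x $ j)) \<in> trigpoly"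
    using trigpoly_cos_sin[of "\<lambda>i. if i = j then 1 else 0"] by (simp_all add: kdot_unit)
qed

text \<open>The embedding of the torus as a product of circles in R^{2d}. Polynomials pull back to
  trigonometric polynomials, which makes Stone-Weierstrass applicable.\<close>

definition torus_emb :: "real^'d::finite \<Rightarrow> (real^'d) \<times> (real^'d)" where
  "torus_emb x = (\<chi> j. cos (x $ j), \<chi> j. sin (x $ j))"

lemma trigpoly_polynomial:
  fixes p :: "(real^'d::finite) \<times> (real^'d) \<Rightarrow> real"
  assumes "real_polynomial_function p"
  shows "(\<lambda>x. p (torus_emb x)) \<in> trigpoly"
  using assms
proof induction
  case (linear h)
  have "h (torus_emb x) = (\<Sum>j\<in>UNIV. h (axis j 1, 0) * cos (x $ j)) + (\<Sum>j\<in>UNIV. h (0, axis j 1) * sin (x $ j))"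
    for x :: "real^'d"
  proof -
    have b: "(\<Sum>j\<in>UNIV. (v $ j) *\<^sub>R (axis j 1 :: real^'d)) = v" for v
      using basis_expansion[of v] by (simp add: scalar_mult_eq_scaleR)
    have e: "torus_emb x = (\<Sum>j\<in>UNIV. cos (x $ j) *\<^sub>R (axis j 1, 0)) + (\<Sum>j\<in>UNIV. sin (x $ j) *\<^sub>R (0, axis j 1))"
      using b[of "\<chi> j. cos (x $ j)"] b[of "\<chi> j. sin (x $ j)"]
      by (simp add: torus_emb_def prod_eq_iff fst_sum snd_sum)
    show ?thesis
      unfolding e linear_simps(1)[OF linear] linear_sum[OF bounded_linear.linear[OF linear]] linear_simps(5)[OF linear]
      by (simp add: mult.commute)
  qed
  then show ?case by (auto intro!: trigpoly.add trigpoly_sum trigpoly.scale trigpoly_coord)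
qed (auto intro: trigpoly_const trigpoly.add trigpoly_mult)

lemma continuous_on_torus_emb: "continuous_on S torus_emb"
  unfolding torus_emb_def
  by (auto intro!: continuous_intros continuous_on_vec_lambda)

text \<open>Points of the closed cube with the same image either coincide or both lie on the
  boundary. Vanishing there makes \<open>G\<close> constant on the fibres of
  \<open>torus_emb\<close>, so \<open>G\<close> descends to the compact image, where polynomials are
  dense.\<close>

lemma trigpoly_uniform_approx:
  fixes G :: "real^'d::finite \<Rightarrow> real"
  assumes G: "continuous_on UNIV G" and bd: "\<And>x. x \<notin> box 0 (\<chi> i. 2 * pi) \<Longrightarrow> G x = 0" and "\<delta> > 0"
  obtains p where "p \<in> trigpoly" "\<And>x. x \<in> Qcube \<Longrightarrow> \<bar>G x - p x\<bar> < \<delta>"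
proof -
  let ?Q = "Qcube :: (real^'d) set"
  have Gwd: "G x = G y" if "x \<in> ?Q" "y \<in> ?Q" "torus_emb x = torus_emb y" for x y
  proof -
    have cs: "cos (x $ j) = cos (y $ j)" "sin (x $ j) = sin (y $ j)" for j
      using that(3) by (simp_all add: torus_emb_def vec_eq_iff)
    have rng: "0 \<le> x $ j" "x $ j \<le> 2 * pi" "0 \<le> y $ j" "y $ j \<le> 2 * pi" for j
      using that by (auto simp: Qcube_def mem_box_cart)
    have dich: "x $ j = y $ j \<or> (x $ j \<in> {0, 2 * pi} \<and> y $ j \<in> {0, 2 * pi})" for j
    proof -
      obtain n where n: "x $ j = y $ j + 2 * pi * real_of_int n"
        using cs[of j] by (metis sin_cos_eq_iff)
      have "\<bar>2 * pi * real_of_int n\<bar> \<le> 2 * pi" using rng[of j] n by linarith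
      then have "\<bar>real_of_int n\<bar> \<le> 1" by (simp add: abs_mult)
      then have "n = 0 \<or> n = 1 \<or> n = -1" by linarith
      then show ?thesis using n rng[of j] by auto
    qed
    show ?thesis
    proof (cases "x = y")
      case False
      then obtain j where "x $ j \<noteq> y $ j" by (auto simp: vec_eq_iff)
      with dich[of j] have "x $ j \<in> {0, 2 * pi}" "y $ j \<in> {0, 2 * pi}" by auto
      then have "x \<notin> box 0 (\<chi> i. 2 * pi)" "y \<notin> box 0 (\<chi> i. 2 * pi)"
        unfolding mem_box_cart by (auto simp: not_less intro!: exI[of _ j])
      then show ?thesis by (simp add: bd)
    qed simp
  qed
  define g where "g y = G (SOME x. x \<in> ?Q \<and> torus_emb x = y)" for y
  have g: "g (torus_emb x) = G x" if "x \<in> ?Q" for x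
  proof -
    have "\<exists>x'. x' \<in> ?Q \<and> torus_emb x' = torus_emb x" using that by blast
    from someI_ex[OF this] show ?thesis unfolding g_def using Gwd that by blast
  qed
  have cQ: "compact ?Q" by (simp add: Qcube_def)
  have cT: "compact (torus_emb ` ?Q)"
    by (rule compact_continuous_image[OF continuous_on_torus_emb cQ])
  \<comment> \<open>A continuous map from a compact space to a Hausdorff space is closed: preimages
    under \<open>g\<close> are images of closed subsets of the cube.\<close>
  have "continuous_on (torus_emb ` ?Q) g"
  proof (subst continuous_on_closed_vimage[OF compact_imp_closed[OF cT]], intro allI impI)
    fix B :: "real set" assume B: "closed B"
    have "g -` B \<inter> torus_emb ` ?Q = torus_emb ` (G -` B \<inter> ?Q)" using g by auto
    moreover have "closed (G -` B \<inter> ?Q)"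
      using continuous_on_closed_vimage[OF compact_imp_closed[OF cQ], of G] B continuous_on_subset[OF G]
      by auto
    then have "compact (G -` B \<inter> ?Q)"
      using cQ by (metis compact_Int_closed inf.absorb_iff2 inf_le2 inf_commute)
    then have "closed (torus_emb ` (G -` B \<inter> ?Q))"
      by (intro compact_imp_closed compact_continuous_image continuous_on_torus_emb)
    ultimately show "closed (g -` B \<inter> torus_emb ` ?Q)" by simp
  qed
  then obtain q where q: "real_polynomial_function q" "\<And>y. y \<in> torus_emb ` ?Q \<Longrightarrow> \<bar>g y - q y\<bar> < \<delta>"
    using Stone_Weierstrass_real_polynomial_function[OF cT _ \<open>\<delta> > 0\<close>] by blast
  show ?thesis
  proof (rule that)
    show "(\<lambda>x. q (torus_emb x)) \<in> trigpoly" by (rule trigpoly_polynomial[OF q(1)])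
    show "\<bar>G x - q (torus_emb x)\<bar> < \<delta>" if "x \<in> ?Q" for x
      using q(2)[of "torus_emb x"] g[OF that] that by simp
  qed
qed

lemma cube_AE_open:
  assumes "negligible N"
  shows "AE x in (tmeas :: (real^'d::finite) measure). x \<notin> N \<and> x \<in> box 0 (\<chi> i. 2 * pi)"
proof -
  let ?b = "(\<chi> i. 2 * pi) :: real^'d"
  have "negligible (N \<union> (cbox 0 ?b - box 0 ?b))"
    using assms by (intro negligible_Un negligible_frontier_interval)
  then have "AE x in lebesgue. x \<notin> N \<union> (cbox 0 ?b - box 0 ?b)"
    by (intro AE_not_in) (simp add: negligible_iff_null_sets)
  then show ?thesis
    by (subst AE_restrict_space_iff) (auto simp: Qcube_def)
qed

text \<open>Multiplying by these functions forces continuous approximants to vanish on the faces of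
  the cube, as \<open>trigpoly_uniform_approx\<close> demands, without changing their limit in the
  interior.\<close>

lemma cutoff_exists:
  "\<exists>eta :: nat \<Rightarrow> real^'d::finite \<Rightarrow> real. (\<forall>n. continuous_on UNIV (eta n)) \<and> (\<forall>n x. 0 \<le> eta n x \<and> eta n x \<le> 1)
    \<and> (\<forall>n x. x \<notin> box 0 (\<chi> i. 2 * pi) \<longrightarrow> eta n x = 0)
    \<and> (\<forall>x. x \<in> box 0 (\<chi> i. 2 * pi) \<longrightarrow> (\<lambda>n. eta n x) \<longlonglongrightarrow> 1)"
proof -
  define C where "C = - box 0 ((\<chi> i. 2 * pi) :: real^'d)"
  have C: "closed C" "C \<noteq> {}"
  proof -
    show "closed C" unfolding C_def by (simp add: closed_def open_box)
    have "0 \<in> C" unfolding C_def by (simp add: mem_box_cart)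
    then show "C \<noteq> {}" by blast
  qed
  define \<psi> where "\<psi> n x = min 1 (real n * infdist x C)" for n x
  show ?thesis
  proof (intro exI[of _ \<psi>] conjI allI impI)
    show "continuous_on UNIV (\<psi> n)" for n
      unfolding \<psi>_def by (intro continuous_intros)
    show "0 \<le> \<psi> n x" "\<psi> n x \<le> 1" for n x
      by (simp_all add: \<psi>_def infdist_nonneg)
    show "\<psi> n x = 0" if "x \<notin> box 0 (\<chi> i. 2 * pi)" for n x
      using that by (simp add: \<psi>_def C_def)
    show "(\<lambda>n. \<psi> n x) \<longlonglongrightarrow> 1" if x: "x \<in> box 0 (\<chi> i. 2 * pi)" for x
    proof (rule tendsto_eventually)
      have pos: "infdist x C > 0"
        using in_closed_iff_infdist_zero[OF C] x infdist_nonneg[of x C]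
        by (metis C_def Compl_iff order_le_less)
      obtain n0 where n0: "1 / infdist x C < real n0" using reals_Archimedean2 by blast
      show "\<forall>\<^sub>F n in sequentially. \<psi> n x = 1"
      proof (rule eventually_sequentiallyI[of n0])
        fix n assume "n0 \<le> n"
        then have "1 / infdist x C \<le> real n" using n0 by linarith
        then have "1 \<le> real n * infdist x C" using pos by (simp add: field_simps)
        then show "\<psi> n x = 1" by (simp add: \<psi>_def)
      qed
    qed
  qed
qed

lemma integrable_bounded_times:
  fixes u h :: "'a \<Rightarrow> real"
  assumes "integrable M h" "u \<in> borel_measurable M" "\<And>x. x \<in> space M \<Longrightarrow> \<bar>u x\<bar> \<le> B"
  shows "integrable M (\<lambda>x. u x * h x)"
proof (rule Bochner_Integration.integrable_bound)
  show "integrable M (\<lambda>x. B * h x)" using assms by simp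
  show "(\<lambda>x. u x * h x) \<in> borel_measurable M" using assms by auto
  have "\<bar>u x * h x\<bar> \<le> \<bar>B * h x\<bar>" if "x \<in> space M" for x
    unfolding abs_mult using assms(3)[OF that] by (intro mult_right_mono) linarith+
  then show "AE x in M. norm (u x * h x) \<le> norm (B * h x)" by (intro AE_I2) auto
qed

text \<open>The weight serves two purposes: \<open>h = 1\<close> gives completeness of the basis,
  and \<open>h = (w0)\<^sup>2\<close> gives the final approximation of the velocity. The function is
  truncated, approximated by bounded continuous functions vanishing on the boundary, and these are
  approximated uniformly.\<close>

lemma trigpoly_dense:
  fixes f h :: "real^'d::finite \<Rightarrow> real"
  assumes h: "integrable tmeas h" "\<And>x. h x \<ge> 0"
    and f: "f \<in> borel_measurable tmeas" "integrable tmeas (\<lambda>x. (f x)\<^sup>2 * h x)" and e: "e > 0"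
  obtains p where "p \<in> trigpoly" "(LINT x|tmeas. (f x - p x)\<^sup>2 * h x) < e"
    "integrable tmeas (\<lambda>x. (f x - p x)\<^sup>2 * h x)"
proof -
  let ?M = "tmeas :: (real^'d) measure"
  have hm[measurable]: "h \<in> borel_measurable ?M" using h by auto
  note f(1)[measurable]
  define clip where "clip M t = max (- M) (min M t)" for M t :: real
  have clip_le: "\<bar>clip M t\<bar> \<le> M" if "M \<ge> 0" for M t using that by (auto simp: clip_def)
  have clip_diff: "\<bar>t - clip M t\<bar> \<le> \<bar>t\<bar>" if "M \<ge> 0" for M t using that by (auto simp: clip_def)
  have [measurable]: "(\<lambda>x. clip M (u x)) \<in> borel_measurable ?M" if "u \<in> borel_measurable ?M" for M u
    using that unfolding clip_def by measurable
  have lim1: "(\<lambda>n. LINT x|?M. (f x - clip (real n) (f x))\<^sup>2 * h x) \<longlonglongrightarrow> integral\<^sup>L ?M (\<lambda>x. 0)"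
  proof (rule Bochner_Integration.integral_dominated_convergence[where w="\<lambda>x. (f x)\<^sup>2 * h x"])
    show "AE x in ?M. (\<lambda>n. (f x - clip (real n) (f x))\<^sup>2 * h x) \<longlonglongrightarrow> 0"
    proof (intro AE_I2 tendsto_eventually)
      fix x
      obtain n0 where n0: "\<bar>f x\<bar> \<le> real n0" using real_arch_simple by blast
      show "\<forall>\<^sub>F n in sequentially. (f x - clip (real n) (f x))\<^sup>2 * h x = 0"
        by (rule eventually_sequentiallyI[of n0]) (use n0 in \<open>auto simp: clip_def\<close>)
    qed
    show "AE x in ?M. norm ((f x - clip (real n) (f x))\<^sup>2 * h x) \<le> (f x)\<^sup>2 * h x" for n
      using clip_diff[of "real n"] h(2) by (intro AE_I2) (simp add: abs_mult mult_right_mono abs_le_square_iff)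
  qed (use f in auto)
  then obtain n where n: "(LINT x|?M. (f x - clip (real n) (f x))\<^sup>2 * h x) < e / 8"
    using order_tendstoD(2)[of _ _ sequentially "e / 8"] e by (fastforce simp: eventually_sequentially)
  let ?c = "real n"
  define F where "F x = clip ?c (f x)" for x
  have Fm[measurable]: "F \<in> borel_measurable ?M" unfolding F_def by measurable
  have Fb: "\<bar>F x\<bar> \<le> ?c" for x unfolding F_def by (rule clip_le) simp
  have i1: "integrable ?M (\<lambda>x. (f x - F x)\<^sup>2 * h x)"
  proof (rule Bochner_Integration.integrable_bound[OF f(2)])
    show "AE x in ?M. norm ((f x - F x)\<^sup>2 * h x) \<le> norm ((f x)\<^sup>2 * h x)"
      unfolding F_def using clip_diff[of "real n"] h(2)
      by (intro AE_I2) (simp add: abs_mult mult_right_mono abs_le_square_iff)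
  qed measurable
  \<comment> \<open>By definition \<open>measurable_on\<close> provides continuous functions
    converging off a negligible set; these are the \<open>g\<close>.\<close>
  have "f measurable_on Qcube"
    using f(1) by (subst measurable_on_iff_borel_measurable) (auto simp: Qcube_def)
  then obtain N g where N: "negligible N" and g: "\<And>n. continuous_on UNIV (g n)"
    "\<And>x. x \<notin> N \<Longrightarrow> (\<lambda>n. g n x) \<longlonglongrightarrow> (if x \<in> Qcube then f x else 0)"
    unfolding measurable_on_def by blast
  obtain \<psi> :: "nat \<Rightarrow> real^'d \<Rightarrow> real" where \<psi>: "\<And>n. continuous_on UNIV (\<psi> n)" "\<And>n x. 0 \<le> \<psi> n x \<and> \<psi> n x \<le> 1"
    "\<And>n x. x \<notin> box 0 (\<chi> i. 2 * pi) \<Longrightarrow> \<psi> n x = 0"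
    "\<And>x. x \<in> box 0 (\<chi> i. 2 * pi) \<Longrightarrow> (\<lambda>n. \<psi> n x) \<longlonglongrightarrow> 1"
    using cutoff_exists by blast
  define G where "G m x = \<psi> m x * clip ?c (g m x)" for m x
  have cG: "continuous_on UNIV (G m)" for m
    unfolding G_def clip_def by (intro continuous_intros \<psi> g)
  have Gm[measurable]: "G m \<in> borel_measurable ?M" for m by (rule cube_continuous_measurable[OF cG])
  have Gb: "\<bar>G m x\<bar> \<le> ?c" for m x
  proof -
    have "\<bar>G m x\<bar> \<le> 1 * ?c"
      unfolding G_def abs_mult using \<psi>(2)[of m x] clip_le[of ?c "g m x"] by (intro mult_mono) auto
    then show ?thesis by simp
  qed
  have sqb: "(F x - G m x)\<^sup>2 \<le> 4 * ?c\<^sup>2" for m x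
  proof -
    have "\<bar>F x - G m x\<bar> \<le> \<bar>2 * ?c\<bar>" using Fb[of x] Gb[of m x] by linarith
    then have "(F x - G m x)\<^sup>2 \<le> (2 * ?c)\<^sup>2" by (simp only: abs_le_square_iff)
    then show ?thesis by (simp add: power_mult_distrib)
  qed
  have lim2: "(\<lambda>m. LINT x|?M. (F x - G m x)\<^sup>2 * h x) \<longlonglongrightarrow> integral\<^sup>L ?M (\<lambda>x. 0)"
  proof (rule Bochner_Integration.integral_dominated_convergence[where w="\<lambda>x. 4 * ?c\<^sup>2 * h x"])
    show "AE x in ?M. (\<lambda>m. (F x - G m x)\<^sup>2 * h x) \<longlonglongrightarrow> 0"
      using cube_AE_open[OF N]
    proof eventually_elim
      case (elim x)
      then have "x \<in> Qcube" using box_subset_cbox by (auto simp: Qcube_def)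
      with elim g(2)[of x] have "(\<lambda>n. g n x) \<longlonglongrightarrow> f x" by simp
      then have "(\<lambda>m. (F x - G m x)\<^sup>2 * h x) \<longlonglongrightarrow> (F x - 1 * clip ?c (f x))\<^sup>2 * h x"
        unfolding G_def clip_def using elim by (intro tendsto_intros \<psi>(4)) auto
      then show ?case by (simp add: F_def)
    qed
    show "AE x in ?M. norm ((F x - G m x)\<^sup>2 * h x) \<le> 4 * ?c\<^sup>2 * h x" for m
      using sqb[of _ m] h(2) by (intro AE_I2) (simp add: abs_mult mult_right_mono)
  qed (use h in auto)
  then obtain m where m: "(LINT x|?M. (F x - G m x)\<^sup>2 * h x) < e / 16"
    using order_tendstoD(2)[of _ _ sequentially "e / 16"] e by (fastforce simp: eventually_sequentially)
  have i2: "integrable ?M (\<lambda>x. (F x - G m x)\<^sup>2 * h x)"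
    using sqb[of _ m] by (intro integrable_bounded_times[OF h(1)]) auto
  define H where "H = (LINT x|?M. h x)"
  have H0: "H \<ge> 0" unfolding H_def using h(2) by simp
  \<comment> \<open>Chosen so that a uniform error below \<open>\<delta>\<close> costs at most
    \<open>e / 16\<close> in the weighted integral; the summand 1 covers
    \<open>H = 0\<close>.\<close>
  define \<delta> where "\<delta> = sqrt (e / (16 * (H + 1)))"
  have \<delta>: "\<delta> > 0" "\<delta>\<^sup>2 * H \<le> e / 16"
  proof -
    show "\<delta> > 0" using e H0 by (simp add: \<delta>_def)
    have "\<delta>\<^sup>2 = e / (16 * (H + 1))" using e H0 by (simp add: \<delta>_def)
    then have "\<delta>\<^sup>2 * H = e / 16 * (H / (H + 1))" by simp
    also have "\<dots> \<le> e / 16 * 1" using e H0 by (intro mult_left_mono) auto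
    finally show "\<delta>\<^sup>2 * H \<le> e / 16" by simp
  qed
  obtain p where p: "p \<in> trigpoly" "\<And>x. x \<in> Qcube \<Longrightarrow> \<bar>G m x - p x\<bar> < \<delta>"
  proof (rule trigpoly_uniform_approx[OF cG[of m] _ \<delta>(1)])
    show "G m x = 0" if "x \<notin> box 0 (\<chi> i. 2 * pi)" for x
      using \<psi>(3)[OF that] by (simp add: G_def)
  qed blast
  have pm[measurable]: "p \<in> borel_measurable ?M" 
    by (rule cube_continuous_measurable[OF trigpoly_continuous[OF p(1)]])
  have spQ: "space ?M = Qcube" by simp
  have pb: "(G m x - p x)\<^sup>2 \<le> \<delta>\<^sup>2" if "x \<in> space ?M" for x
  proof -
    have "\<bar>G m x - p x\<bar> \<le> \<bar>\<delta>\<bar>" using p(2)[of x] that by (simp add: spQ)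
    then show ?thesis by (simp only: abs_le_square_iff)
  qed
  have i3: "integrable ?M (\<lambda>x. (G m x - p x)\<^sup>2 * h x)"
    using pb by (intro integrable_bounded_times[OF h(1)]) auto
  have b3: "(LINT x|?M. (G m x - p x)\<^sup>2 * h x) \<le> e / 16"
  proof -
    have "(LINT x|?M. (G m x - p x)\<^sup>2 * h x) \<le> (LINT x|?M. \<delta>\<^sup>2 * h x)"
      using i3 h pb by (intro integral_mono) (auto intro!: mult_right_mono)
    also have "\<dots> = \<delta>\<^sup>2 * H" by (simp add: H_def)
    finally show ?thesis using \<delta>(2) by linarith
  qed
  \<comment> \<open>Applying \<open>sq_add_le\<close> twice produces the factors 2, 4, 4; with the
    tolerances e/8, e/16, e/16 the total is 3e/4.\<close>
  have tri: "(f x - p x)\<^sup>2 * h x \<le> 2 * ((f x - F x)\<^sup>2 * h x) + 4 * ((F x - G m x)\<^sup>2 * h x) + 4 * ((G m x - p x)\<^sup>2 * h x)" for x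
  proof -
    have "(f x - p x)\<^sup>2 \<le> 2 * (f x - F x)\<^sup>2 + 4 * (F x - G m x)\<^sup>2 + 4 * (G m x - p x)\<^sup>2"
      using sq_add_le[of "f x - F x" "F x - p x"] sq_add_le[of "F x - G m x" "G m x - p x"] by simp
    from mult_right_mono[OF this h(2)[of x]] show ?thesis by (simp add: algebra_simps)
  qed
  have i4: "integrable ?M (\<lambda>x. (f x - p x)\<^sup>2 * h x)"
  proof (rule Bochner_Integration.integrable_bound)
    show "integrable ?M (\<lambda>x. 2 * ((f x - F x)\<^sup>2 * h x) + 4 * ((F x - G m x)\<^sup>2 * h x) + 4 * ((G m x - p x)\<^sup>2 * h x))"
      by (intro Bochner_Integration.integrable_add integrable_mult_right i1 i2 i3)
    show "AE x in ?M. norm ((f x - p x)\<^sup>2 * h x) \<le> norm (2 * ((f x - F x)\<^sup>2 * h x) + 4 * ((F x - G m x)\<^sup>2 * h x) + 4 * ((G m x - p x)\<^sup>2 * h x))"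
    proof (rule AE_I2)
      fix x
      have "(f x - p x)\<^sup>2 * h x \<ge> 0" using h(2) by simp
      then show "norm ((f x - p x)\<^sup>2 * h x) \<le> norm (2 * ((f x - F x)\<^sup>2 * h x) + 4 * ((F x - G m x)\<^sup>2 * h x) + 4 * ((G m x - p x)\<^sup>2 * h x))"
        using tri[of x] unfolding real_norm_def by linarith
    qed
  qed measurable
  have "(LINT x|?M. (f x - p x)\<^sup>2 * h x) \<le>
    (LINT x|?M. 2 * ((f x - F x)\<^sup>2 * h x) + 4 * ((F x - G m x)\<^sup>2 * h x) + 4 * ((G m x - p x)\<^sup>2 * h x))"
    by (intro integral_mono i4 Bochner_Integration.integrable_add integrable_mult_right i1 i2 i3 tri)
  also have "\<dots> = 2 * (LINT x|?M. (f x - F x)\<^sup>2 * h x) + 4 * (LINT x|?M. (F x - G m x)\<^sup>2 * h x)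
      + 4 * (LINT x|?M. (G m x - p x)\<^sup>2 * h x)"
    using i1 i2 i3 by simp
  also have "\<dots> < e" using n m b3 e unfolding F_def by linarith
  finally show ?thesis using that[OF p(1)] i4 by blast
qed

subsection \<open>Fourier coefficients\<close>

definition fcoeff :: "(real^'d::finite \<Rightarrow> real) \<Rightarrow> ('d \<Rightarrow> int) \<Rightarrow> real" where
  "fcoeff f k = (LINT x|tmeas. f x * trig_basis k x)"

text \<open>Boxes exhaust the index lattice by finite sets and are products of intervals, so that
  sums of products over them factorise.\<close>

definition kbox :: "nat \<Rightarrow> ('d::finite \<Rightarrow> int) set" where
  "kbox n = {k. \<forall>j. \<bar>k j\<bar> \<le> int n}"

lemma kbox_PiE: "kbox n = PiE UNIV (\<lambda>_. {- int n..int n})"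
proof -
  have "\<bar>i\<bar> \<le> int n \<longleftrightarrow> i \<in> {- int n..int n}" for i by auto
  then show ?thesis by (simp add: kbox_def PiE_UNIV_domain Pi_def)
qed

lemma kbox_finite[simp]: "finite (kbox n)"
  unfolding kbox_PiE by (simp add: finite_PiE)

lemma kbox_mono: "m \<le> n \<Longrightarrow> kbox m \<subseteq> kbox n"
  by (auto simp: kbox_def intro: order_trans[of _ "int m"])

lemma kbox_ev: "\<exists>N. \<forall>n\<ge>N. (k :: 'd::finite \<Rightarrow> int) \<in> kbox n"
proof -
  define N where "N = nat (\<Sum>j\<in>UNIV. \<bar>k j\<bar>)"
  have "\<bar>k j\<bar> \<le> int N" for j
  proof -
    have "\<bar>k j\<bar> \<le> (\<Sum>j\<in>UNIV. \<bar>k j\<bar>)" by (rule member_le_sum) auto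
    then show ?thesis by (simp add: N_def sum_nonneg)
  qed
  then have "k \<in> kbox n" if "n \<ge> N" for n
    using that unfolding kbox_def by (auto intro: order_trans[of _ "int N"])
  then show ?thesis by blast
qed

lemma count_space_finite_support:
  fixes g :: "'i \<Rightarrow> real"
  assumes F: "finite F"
  shows "integrable (count_space UNIV) (\<lambda>k. if k \<in> F then g k else 0)"
    "(LINT k|count_space UNIV. (if k \<in> F then g k else 0)) = sum g F"
proof -
  have e: "(\<lambda>k. if k \<in> F then g k else 0) = (\<lambda>k. \<Sum>i\<in>F. g i * indicator {i} k)"
  proof
    fix k
    have "(\<Sum>i\<in>F. g i * indicator {i} k) = (\<Sum>i\<in>F. if i = k then g k else 0)"
      by (intro sum.cong) (auto simp: indicator_def)
    then show "(if k \<in> F then g k else 0) = (\<Sum>i\<in>F. g i * indicator {i} k)" using F by simp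
  qed
  have i: "integrable (count_space UNIV) (\<lambda>k. g i * indicator {i} k)" for i
    by (intro integrable_mult_right) (simp add: integrable_indicator_iff emeasure_count_space)
  show "integrable (count_space UNIV) (\<lambda>k. if k \<in> F then g k else 0)"
    unfolding e by (intro Bochner_Integration.integrable_sum i)
  show "(LINT k|count_space UNIV. (if k \<in> F then g k else 0)) = sum g F"
    unfolding e by (simp add: i Bochner_Integration.integral_sum measure_count_space)
qed

lemma square_int_finite_support:
  assumes "finite F" shows "square_int (count_space UNIV) (\<lambda>k. if k \<in> F then g k else 0)"
proof -
  have "(\<lambda>k. (if k \<in> F then g k else 0)\<^sup>2) = (\<lambda>k. if k \<in> F then (g k)\<^sup>2 else 0)" by auto
  then show ?thesis using count_space_finite_support(1)[OF assms, of "\<lambda>k. (g k)\<^sup>2"] by (simp add: square_int_def)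
qed

lemma trigpoly_expand:
  assumes "p \<in> trigpoly" shows "\<exists>n c. p = (\<lambda>x. \<Sum>k\<in>kbox n. c k * trig_basis k x)"
  using assms
proof induction
  case (trig_basis k)
  obtain n where n: "k \<in> kbox n" using kbox_ev by blast
  have "trig_basis k = (\<lambda>x. \<Sum>l\<in>kbox n. (if l = k then 1 else 0) * trig_basis l x)"
  proof
    fix x
    have "(\<Sum>l\<in>kbox n. (if l = k then 1 else 0) * trig_basis l x) = (\<Sum>l\<in>kbox n. if l = k then trig_basis k x else 0)"
      by (intro sum.cong) auto
    then show "trig_basis k x = (\<Sum>l\<in>kbox n. (if l = k then 1 else 0) * trig_basis l x)" using n by simp
  qed
  then show ?case by (intro exI[of _ n] exI[of _ "\<lambda>l. if l = k then 1 else 0"])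
next
  case (add f g)
  then obtain n c m d where f: "f = (\<lambda>x. \<Sum>k\<in>kbox n. c k * trig_basis k x)" and g: "g = (\<lambda>x. \<Sum>k\<in>kbox m. d k * trig_basis k x)"
    by blast
  have ext: "(\<Sum>k\<in>kbox n. c k * trig_basis k x) = (\<Sum>k\<in>kbox N. (if k \<in> kbox n then c k else 0) * trig_basis k x)"
    if "n \<le> N" for n N c and x :: "real^'a"
  proof -
    have "(\<Sum>k\<in>kbox n. c k * trig_basis k x) = (\<Sum>k\<in>kbox N \<inter> kbox n. c k * trig_basis k x)"
      by (simp add: Int_absorb1[OF kbox_mono[OF that]])
    also have "\<dots> = (\<Sum>k\<in>kbox N. if k \<in> kbox n then c k * trig_basis k x else 0)"
      by (simp add: sum.inter_restrict)
    also have "\<dots> = (\<Sum>k\<in>kbox N. (if k \<in> kbox n then c k else 0) * trig_basis k x)"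
      by (intro sum.cong) auto
    finally show ?thesis .
  qed
  have "(\<lambda>x. f x + g x) = (\<lambda>x. \<Sum>k\<in>kbox (max n m). ((if k \<in> kbox n then c k else 0) + (if k \<in> kbox m then d k else 0)) * trig_basis k x)"
    unfolding f g ext[OF max.cobounded1[of n m]] ext[OF max.cobounded2[of m n]]
    by (simp only: sum.distrib distrib_right)
  then show ?case by (intro exI)
next
  case (scale f a)
  then obtain n c where f: "f = (\<lambda>x. \<Sum>k\<in>kbox n. c k * trig_basis k x)" by blast
  have "(\<lambda>x. a * f x) = (\<lambda>x. \<Sum>k\<in>kbox n. (a * c k) * trig_basis k x)"
    by (simp add: f sum_distrib_left mult.assoc)
  then show ?case by (intro exI[of _ n] exI[of _ "\<lambda>k. a * c k"])
qed

lemma fcoeff_add: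
  assumes "square_int tmeas f" "square_int tmeas g"
  shows "fcoeff (\<lambda>x. f x + g x) k = fcoeff f k + fcoeff g k"
  using square_int_mult_integrable[OF assms(1) trig_basis_square_int] square_int_mult_integrable[OF assms(2) trig_basis_square_int]
  by (simp add: fcoeff_def distrib_right)

lemma fcoeff_diff:
  assumes "square_int tmeas f" "square_int tmeas g"
  shows "fcoeff (\<lambda>x. f x - g x) k = fcoeff f k - fcoeff g k"
  using square_int_mult_integrable[OF assms(1) trig_basis_square_int] square_int_mult_integrable[OF assms(2) trig_basis_square_int]
  by (simp add: fcoeff_def left_diff_distrib)

lemma fcoeff_scale: "fcoeff (\<lambda>x. a * f x) k = a * fcoeff f k"
  by (simp add: fcoeff_def mult.assoc)

lemma fcoeff_zero[simp]: "fcoeff (\<lambda>x. 0) k = 0"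
  by (simp add: fcoeff_def)

lemma fcoeff_trig_basis: "fcoeff (trig_basis l) k = (if l = k then 1 else 0)"
  by (simp add: fcoeff_def trig_basis_orthonormal)

lemma fcoeff_sum_trig_basis:
  assumes "finite F" shows "fcoeff (\<lambda>x. \<Sum>l\<in>F. c l * trig_basis l x) k = (if k \<in> F then c k else 0)"
proof -
  have "fcoeff (\<lambda>x. \<Sum>l\<in>F. c l * trig_basis l x) k = (\<Sum>l\<in>F. c l * (if l = k then 1 else 0))"
    using assms
  proof (induction F rule: finite_induct)
    case (insert l F)
    have "fcoeff (\<lambda>x. c l * trig_basis l x + (\<Sum>l\<in>F. c l * trig_basis l x)) k = fcoeff (\<lambda>x. c l * trig_basis l x) k + fcoeff (\<lambda>x. \<Sum>l\<in>F. c l * trig_basis l x) k"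
      by (intro fcoeff_add square_int_sum square_int_scale trig_basis_square_int)
    then show ?case using insert by (simp add: fcoeff_scale fcoeff_trig_basis)
  qed simp
  also have "\<dots> = (\<Sum>l\<in>F. if l = k then c k else 0)" by (intro sum.cong) auto
  finally show ?thesis using assms by simp
qed

lemma sum_trig_basis_square_int: "square_int tmeas (\<lambda>x. \<Sum>l\<in>F. c l * trig_basis l x)"
  by (intro square_int_sum square_int_scale trig_basis_square_int)

lemma sum_trig_basis_inner:
  assumes f: "square_int tmeas f"
  shows "(LINT x|tmeas. f x * (\<Sum>l\<in>F. c l * trig_basis l x)) = (\<Sum>l\<in>F. c l * fcoeff f l)"
proof -
  have "(LINT x|tmeas. f x * (\<Sum>l\<in>F. c l * trig_basis l x)) = (LINT x|tmeas. (\<Sum>l\<in>F. c l * (f x * trig_basis l x)))"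
    by (simp add: sum_distrib_left mult.left_commute)
  also have "\<dots> = (\<Sum>l\<in>F. (LINT x|tmeas. c l * (f x * trig_basis l x)))"
    by (intro Bochner_Integration.integral_sum integrable_mult_right square_int_mult_integrable f trig_basis_square_int)
  also have "\<dots> = (\<Sum>l\<in>F. c l * fcoeff f l)"
    by (simp add: fcoeff_def)
  finally show ?thesis .
qed

text \<open>Pythagoras with arbitrary coefficients. Taking \<open>c\<close> to be the Fourier
  coefficients gives Bessel's inequality; general \<open>c\<close> allows comparison with any
  trigonometric polynomial.\<close>

lemma projection_error:
  assumes f: "square_int tmeas f" and F: "finite F"
  shows "(LINT x|tmeas. (f x - (\<Sum>l\<in>F. c l * trig_basis l x))\<^sup>2) = (LINT x|tmeas. (f x)\<^sup>2) - (\<Sum>l\<in>F. (fcoeff f l)\<^sup>2) + (\<Sum>l\<in>F. (c l - fcoeff f l)\<^sup>2)"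
proof -
  let ?p = "\<lambda>x. \<Sum>l\<in>F. c l * trig_basis l x"
  have p: "square_int tmeas ?p" by (rule sum_trig_basis_square_int)
  have sq: "(c l - fcoeff f l)\<^sup>2 = c l * c l - 2 * (c l * fcoeff f l) + (fcoeff f l)\<^sup>2" for l
    by (simp add: power2_eq_square algebra_simps)
  have "(LINT x|tmeas. (f x - ?p x)\<^sup>2) = (LINT x|tmeas. (f x)\<^sup>2 - 2 * (f x * ?p x) + ?p x * ?p x)"
    by (intro Bochner_Integration.integral_cong) (auto simp: power2_eq_square algebra_simps)
  also have "\<dots> = (LINT x|tmeas. (f x)\<^sup>2) - 2 * (LINT x|tmeas. f x * ?p x) + (LINT x|tmeas. ?p x * ?p x)"
    using square_int_integrable[OF f] square_int_mult_integrable[OF f p] square_int_mult_integrable[OF p p] by simp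
  also have "(LINT x|tmeas. f x * ?p x) = (\<Sum>l\<in>F. c l * fcoeff f l)" by (rule sum_trig_basis_inner[OF f])
  also have "(LINT x|tmeas. ?p x * ?p x) = (\<Sum>l\<in>F. c l * c l)"
    unfolding sum_trig_basis_inner[OF p] by (intro sum.cong) (simp_all add: fcoeff_sum_trig_basis[OF F])
  also have "(LINT x|tmeas. (f x)\<^sup>2) - 2 * (\<Sum>l\<in>F. c l * fcoeff f l) + (\<Sum>l\<in>F. c l * c l)
     = (LINT x|tmeas. (f x)\<^sup>2) - (\<Sum>l\<in>F. (fcoeff f l)\<^sup>2) + (\<Sum>l\<in>F. (c l - fcoeff f l)\<^sup>2)"
    by (simp add: sq sum.distrib sum_subtractf sum_distrib_left)
  finally show ?thesis .
qed

lemma Bessel: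
  assumes f: "square_int tmeas f" and F: "finite F"
  shows "(\<Sum>l\<in>F. (fcoeff f l)\<^sup>2) \<le> (LINT x|tmeas. (f x)\<^sup>2)"
proof -
  have "0 \<le> (LINT x|tmeas. (f x - (\<Sum>l\<in>F. fcoeff f l * trig_basis l x))\<^sup>2)" by simp
  then show ?thesis unfolding projection_error[OF f F] by simp
qed

text \<open>Fatou's lemma along the exhaustion by boxes, so that bounds on finite sums suffice for
  square summability.\<close>

lemma square_int_count_bounded:
  fixes g :: "('d::finite \<Rightarrow> int) \<Rightarrow> real"
  assumes "\<And>n. (\<Sum>k\<in>kbox n. (g k)\<^sup>2) \<le> B"
  shows "square_int (count_space UNIV) g" "(LINT k|count_space UNIV. (g k)\<^sup>2) \<le> B"
proof -
  let ?s = "\<lambda>n k. if k \<in> kbox n then g k else 0"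
  have 1: "square_int (count_space UNIV) (?s n)" for n by (simp add: square_int_finite_support)
  have 2: "AE k in count_space UNIV. (\<lambda>n. ?s n k) \<longlonglongrightarrow> g k"
  proof (rule AE_I2)
    fix k
    show "(\<lambda>n. ?s n k) \<longlonglongrightarrow> g k"
      using kbox_ev[of k] by (intro tendsto_eventually) (auto simp: eventually_sequentially)
  qed
  have 3: "(LINT k|count_space UNIV. (?s n k)\<^sup>2) \<le> B" for n
  proof -
    have "(\<lambda>k. (?s n k)\<^sup>2) = (\<lambda>k. if k \<in> kbox n then (g k)\<^sup>2 else 0)" by auto
    then show ?thesis using assms[of n] count_space_finite_support(2)[of "kbox n" "\<lambda>k. (g k)\<^sup>2"] by simp
  qed
  show "square_int (count_space UNIV) g" "(LINT k|count_space UNIV. (g k)\<^sup>2) \<le> B"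
    using square_int_Fatou[OF 1 _ 2 3] by auto
qed

definition fcoeffs :: "(real^'d::finite \<Rightarrow> real) \<Rightarrow> ('d \<Rightarrow> int) l2" where
  "fcoeffs f = Abs_l2 (fcoeff f)"

lemma fcoeff_square_int: "square_int tmeas f \<Longrightarrow> square_int (count_space UNIV) (fcoeff f)"
  by (rule square_int_count_bounded(1)[OF Bessel]) auto

lemma l2c_fcoeffs: "square_int tmeas f \<Longrightarrow> l2c (fcoeffs f) k = fcoeff f k"
  by (simp add: fcoeffs_def l2c_Abs fcoeff_square_int)

lemma fcoeffs_add: "square_int tmeas f \<Longrightarrow> square_int tmeas g \<Longrightarrow> fcoeffs (\<lambda>x. f x + g x) = fcoeffs f + fcoeffs g"
  by (intro l2_eqI) (simp add: l2c_fcoeffs square_int_add fcoeff_add)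

lemma fcoeffs_diff: "square_int tmeas f \<Longrightarrow> square_int tmeas g \<Longrightarrow> fcoeffs (\<lambda>x. f x - g x) = fcoeffs f - fcoeffs g"
  by (intro l2_eqI) (simp add: l2c_fcoeffs square_int_diff fcoeff_diff)

lemma fcoeffs_scale: "square_int tmeas f \<Longrightarrow> fcoeffs (\<lambda>x. a * f x) = a *\<^sub>R fcoeffs f"
  by (intro l2_eqI) (simp add: l2c_fcoeffs square_int_scale fcoeff_scale)

lemma l2_norm_ge_sum: "finite F \<Longrightarrow> (\<Sum>k\<in>F. (l2c x k)\<^sup>2) \<le> (norm x)\<^sup>2"
proof -
  assume F: "finite F"
  have "(\<Sum>k\<in>F. (l2c x k)\<^sup>2) = (LINT k|count_space UNIV. (if k \<in> F then (l2c x k)\<^sup>2 else 0))"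
    by (simp add: count_space_finite_support(2)[OF F])
  also have "\<dots> \<le> (norm x)\<^sup>2"
    unfolding l2_norm_sq using l2c_square_int[of x]
    by (intro integral_mono) (auto simp: count_space_finite_support[OF F] square_int_def)
  finally show ?thesis .
qed

text \<open>Bessel gives one inequality. For the other, a trigonometric polynomial close to
  \<open>f\<close> exists by density, and by \<open>projection_error\<close> its distance to
  \<open>f\<close> is at least that of the Fourier partial sum.\<close>

lemma Parseval_norm:
  assumes f: "square_int tmeas f"
  shows "(norm (fcoeffs f))\<^sup>2 = (LINT x|tmeas. (f x)\<^sup>2)"
proof (rule antisym)
  show "(norm (fcoeffs f))\<^sup>2 \<le> (LINT x|tmeas. (f x)\<^sup>2)"
    unfolding l2_norm_sq l2c_fcoeffs[OF f] by (rule square_int_count_bounded(2)[OF Bessel[OF f]]) auto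
  show "(LINT x|tmeas. (f x)\<^sup>2) \<le> (norm (fcoeffs f))\<^sup>2"
  proof (rule field_le_epsilon)
    fix e :: real assume "e > 0"
    obtain p where p: "p \<in> trigpoly" "(LINT x|tmeas. (f x - p x)\<^sup>2 * 1) < e"
      using trigpoly_dense[of "\<lambda>_. 1" f e] cube_continuous_integrable(1)[of "\<lambda>_. 1"] f \<open>e > 0\<close>
      by (auto simp: square_int_def)
    obtain n c where c: "p = (\<lambda>x. \<Sum>k\<in>kbox n. c k * trig_basis k x)" using trigpoly_expand[OF p(1)] by blast
    have "(LINT x|tmeas. (f x)\<^sup>2) - (\<Sum>l\<in>kbox n. (fcoeff f l)\<^sup>2) + (\<Sum>l\<in>kbox n. (c l - fcoeff f l)\<^sup>2) < e"
      using p(2) projection_error[OF f kbox_finite[of n], of c] by (simp add: c)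
    moreover have "(\<Sum>l\<in>kbox n. (c l - fcoeff f l)\<^sup>2) \<ge> 0" by (simp add: sum_nonneg)
    moreover have "(\<Sum>l\<in>kbox n. (fcoeff f l)\<^sup>2) \<le> (norm (fcoeffs f))\<^sup>2"
      using l2_norm_ge_sum[OF kbox_finite[of n], of "fcoeffs f"] by (simp add: l2c_fcoeffs[OF f])
    ultimately show "(LINT x|tmeas. (f x)\<^sup>2) \<le> (norm (fcoeffs f))\<^sup>2 + e" by linarith
  qed
qed

lemma Parseval:
  assumes f: "square_int tmeas f" and g: "square_int tmeas g"
  shows "inner (fcoeffs f) (fcoeffs g) = (LINT x|tmeas. f x * g x)"
proof -
  have "(norm (fcoeffs f + fcoeffs g))\<^sup>2 = (LINT x|tmeas. (f x + g x)\<^sup>2)"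
    using Parseval_norm[OF square_int_add[OF f g]] by (simp add: fcoeffs_add f g)
  also have "\<dots> = (LINT x|tmeas. (f x)\<^sup>2 + 2 * (f x * g x) + (g x)\<^sup>2)"
    by (intro Bochner_Integration.integral_cong) (auto simp: power2_sum)
  also have "\<dots> = (LINT x|tmeas. (f x)\<^sup>2) + 2 * (LINT x|tmeas. f x * g x) + (LINT x|tmeas. (g x)\<^sup>2)"
    using square_int_integrable[OF f] square_int_integrable[OF g] square_int_mult_integrable[OF f g] by simp
  finally show ?thesis
    unfolding dot_norm by (simp add: Parseval_norm f g)
qed

lemma Parseval_count:
  assumes f: "square_int tmeas f" and g: "square_int tmeas g"
  shows "(LINT x|tmeas. f x * g x) = (LINT k|count_space UNIV. fcoeff f k * fcoeff g k)"
  using Parseval[OF f g] by (simp add: inner_l2_def l2c_fcoeffs f g)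

lemma fcoeffs_eq_iff:
  assumes f: "square_int tmeas f" and g: "square_int tmeas g"
  shows "fcoeffs f = fcoeffs g \<longleftrightarrow> (AE x in tmeas. f x = g x)"
proof -
  have "fcoeffs f = fcoeffs g \<longleftrightarrow> (norm (fcoeffs f - fcoeffs g))\<^sup>2 = 0" by simp
  also have "\<dots> \<longleftrightarrow> (LINT x|tmeas. (f x - g x)\<^sup>2) = 0"
    using Parseval_norm[OF square_int_diff[OF f g]] by (simp add: fcoeffs_diff f g)
  also have "\<dots> \<longleftrightarrow> (AE x in tmeas. (f x - g x)\<^sup>2 = 0)"
    using square_int_integrable[OF square_int_diff[OF f g]] by (intro integral_nonneg_eq_0_iff_AE) auto
  finally show ?thesis by simp
qed

text \<open>Parseval turns convergence of the truncated families into the Cauchy property of the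
  partial sums, and completeness of L^2 supplies the function.\<close>

lemma fcoeffs_surj: "\<exists>f. square_int tmeas f \<and> fcoeffs f = c"
proof -
  define s where "s n x = (\<Sum>k\<in>kbox n. l2c c k * trig_basis k x)" for n x
  have s: "square_int tmeas (s n)" for n unfolding s_def by (rule sum_trig_basis_square_int)
  have sc: "l2c (fcoeffs (s n)) k = (if k \<in> kbox n then l2c c k else 0)" for n k
  proof -
    have "s n = (\<lambda>x. \<Sum>k\<in>kbox n. l2c c k * trig_basis k x)" by (simp add: s_def fun_eq_iff)
    then show ?thesis unfolding l2c_fcoeffs[OF s] by (simp add: fcoeff_sum_trig_basis)
  qed
  have lim: "(\<lambda>n. fcoeffs (s n)) \<longlonglongrightarrow> c"
  proof (rule l2_dominated[where g=c])
    show "(\<lambda>n. l2c (fcoeffs (s n)) k) \<longlonglongrightarrow> l2c c k" for k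
      using kbox_ev[of k] by (intro tendsto_eventually) (auto simp: eventually_sequentially sc)
  qed (auto simp: sc)
  have sd: "(LINT x|tmeas. (s m x - s n x)\<^sup>2) = (norm (fcoeffs (s m) - fcoeffs (s n)))\<^sup>2" for m n
    using Parseval_norm[OF square_int_diff[OF s s]] by (simp add: fcoeffs_diff s)
  obtain f where f: "square_int tmeas f" "(\<lambda>n. LINT x|tmeas. (s n x - f x)\<^sup>2) \<longlonglongrightarrow> 0"
  proof (rule square_int_complete[OF s])
    fix e :: real assume "e > 0"
    then have "sqrt e > 0" by simp
    from CauchyD[OF LIMSEQ_imp_Cauchy[OF lim] this] obtain N where
      N: "\<forall>m\<ge>N. \<forall>n\<ge>N. norm (fcoeffs (s m) - fcoeffs (s n)) < sqrt e" by blast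
    have "(norm (fcoeffs (s m) - fcoeffs (s n)))\<^sup>2 < e" if "m \<ge> N" "n \<ge> N" for m n
      using N that \<open>e > 0\<close> power_strict_mono[of "norm (fcoeffs (s m) - fcoeffs (s n))" "sqrt e" 2] by simp
    then show "\<exists>N. \<forall>m\<ge>N. \<forall>n\<ge>N. (LINT x|tmeas. (s m x - s n x)\<^sup>2) < e"
      unfolding sd by blast
  qed
  have "(\<lambda>n. (norm (fcoeffs (s n) - fcoeffs f))\<^sup>2) \<longlonglongrightarrow> 0"
    using f(2) Parseval_norm[OF square_int_diff[OF s f(1)]] by (simp add: fcoeffs_diff s f(1))
  then have "(\<lambda>n. sqrt ((norm (fcoeffs (s n) - fcoeffs f))\<^sup>2)) \<longlonglongrightarrow> sqrt 0" by (rule tendsto_real_sqrt)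
  then have "(\<lambda>n. fcoeffs (s n)) \<longlonglongrightarrow> fcoeffs f" by (simp add: tendsto_norm_zero_iff LIM_zero_iff)
  then have "fcoeffs f = c" using lim LIMSEQ_unique by blast
  then show ?thesis using f by blast
qed

text \<open>A chosen representative; the coefficients determine the function only up to null
  sets.\<close>

definition fsynth :: "('d::finite \<Rightarrow> int) l2 \<Rightarrow> real^'d \<Rightarrow> real" where
  "fsynth c = (SOME f. square_int tmeas f \<and> fcoeffs f = c)"

lemma fsynth: "square_int tmeas (fsynth c)" "fcoeffs (fsynth c) = c"
  using someI_ex[OF fcoeffs_surj[of c]] by (auto simp: fsynth_def)

lemma fcoeff_fsynth: "fcoeff (fsynth c) k = l2c c k"
  using l2c_fcoeffs[OF fsynth(1), of c k] by (simp add: fsynth(2))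

subsection \<open>Weak derivatives and Sobolev spaces on the Fourier side\<close>

lemma count_reflect:
  fixes g :: "('d::finite \<Rightarrow> int) \<Rightarrow> real"
  shows "(LINT k|count_space UNIV. g (\<lambda>j. - k j)) = (LINT k|count_space UNIV. g k)"
    "integrable (count_space UNIV) (\<lambda>k. g (\<lambda>j. - k j)) \<longleftrightarrow> integrable (count_space UNIV) g"
proof -
  have b: "bij_betw (\<lambda>k. (\<lambda>j. - k j) :: 'd \<Rightarrow> int) UNIV UNIV"
    by (rule bij_betw_byWitness[where f'="\<lambda>k j. - k j"]) auto
  show "(LINT k|count_space UNIV. g (\<lambda>j. - k j)) = (LINT k|count_space UNIV. g k)"
    by (rule integral_bij_count_space[OF b])
  show "integrable (count_space UNIV) (\<lambda>k. g (\<lambda>j. - k j)) \<longleftrightarrow> integrable (count_space UNIV) g"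
    by (rule integrable_bij_count_space[OF b])
qed

lemma square_int_reflect:
  fixes g :: "('d::finite \<Rightarrow> int) \<Rightarrow> real"
  shows "square_int (count_space UNIV) (\<lambda>k. g (\<lambda>j. - k j)) \<longleftrightarrow> square_int (count_space UNIV) g"
  using count_reflect(2)[of "\<lambda>k. (g k)\<^sup>2"] by (simp add: square_int_def)

lemma integral_mult_middle:
  fixes f g :: "'a \<Rightarrow> real"
  shows "(LINT x|M. f x * (a * g x)) = a * (LINT x|M. f x * g x)"
  by (simp add: mult.left_commute flip: integral_mult_right_zero)

text \<open>Testing against the basis reads off the coefficients, with the index reflected because
  differentiation sends the element \<open>k\<close> to a multiple of the element \<open>-k\<close>.
  Conversely, Parseval reduces an arbitrary test function to its coefficients, whose derivatives
  follow the same rule by classical integration by parts.\<close>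

lemma weak_pd_iff:
  assumes f: "square_int tmeas f" and g: "square_int tmeas g"
  shows "weak_pd j f g \<longleftrightarrow> (\<forall>k. fcoeff g k = - of_int (k j) * fcoeff f (\<lambda>i. - k i))"
proof
  assume w: "weak_pd j f g"
  show "\<forall>k. fcoeff g k = - of_int (k j) * fcoeff f (\<lambda>i. - k i)"
  proof
    fix k
    have "(LINT x|tmeas. f x * pd j (trig_basis k) x) = - (LINT x|tmeas. g x * trig_basis k x)"
      using w trigpoly_smooth[OF trigpoly.trig_basis[of k]] trigpoly_periodic[OF trigpoly.trig_basis[of k]]
      unfolding weak_pd_def by blast
    then show "fcoeff g k = - of_int (k j) * fcoeff f (\<lambda>i. - k i)"
      unfolding pd_trig_basis integral_mult_middle by (simp add: fcoeff_def)
  qed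
next
  assume w: "\<forall>k. fcoeff g k = - of_int (k j) * fcoeff f (\<lambda>i. - k i)"
  show "weak_pd j f g"
    unfolding weak_pd_def
  proof (intro allI impI, elim conjE)
    fix \<phi> :: "real^'a \<Rightarrow> real" assume \<phi>: "smooth_fun \<phi>" "periodic_fun \<phi>"
    have c: "square_int tmeas \<phi>" "square_int tmeas (pd j \<phi>)"
      using smooth_fun_D(2,3)[OF \<phi>(1)] smooth_fun_D(3) by (blast intro: continuous_square_int)+
    have p: "fcoeff (pd j \<phi>) k = - of_int (k j) * fcoeff \<phi> (\<lambda>i. - k i)" for k
      using integral_by_parts[OF \<phi> trigpoly_smooth[OF trigpoly.trig_basis] trigpoly_periodic[OF trigpoly.trig_basis], of j k]
      unfolding pd_trig_basis integral_mult_middle by (simp add: fcoeff_def)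
    have "(LINT x|tmeas. f x * pd j \<phi> x) = (LINT k|count_space UNIV. fcoeff f k * fcoeff (pd j \<phi>) k)"
      by (rule Parseval_count[OF f c(2)])
    also have "\<dots> = (LINT k|count_space UNIV. fcoeff f (\<lambda>i. - k i) * fcoeff (pd j \<phi>) (\<lambda>i. - k i))"
      by (rule count_reflect(1)[symmetric])
    also have "\<dots> = (LINT k|count_space UNIV. - (fcoeff g k * fcoeff \<phi> k))"
      using w by (intro Bochner_Integration.integral_cong) (auto simp: p)
    also have "\<dots> = - (LINT x|tmeas. g x * \<phi> x)"
      by (simp add: Parseval_count[OF g c(1)])
    finally show "(LINT x|tmeas. f x * pd j \<phi> x) = - (LINT x|tmeas. g x * \<phi> x)" .
  qed
qed

text \<open>The symbol of (1 - Laplacian)^{1/2}: the weight of H^1 and at the same time the angular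
  velocity of mode \<open>k\<close>.\<close>

definition freq :: "('d::finite \<Rightarrow> int) \<Rightarrow> real" where
  "freq k = sqrt (1 + (\<Sum>j\<in>UNIV. (of_int (k j))\<^sup>2))"

lemma freq_sq: "(freq k)\<^sup>2 = 1 + (\<Sum>j\<in>UNIV. (of_int (k j))\<^sup>2)"
  by (simp add: freq_def sum_nonneg)

lemma freq_ge1: "freq k \<ge> 1"
  by (simp add: freq_def sum_nonneg)

lemma freq_pos[simp]: "freq k > 0" "freq k \<noteq> 0" "freq k \<ge> 0" "\<bar>freq k\<bar> = freq k"
  using freq_ge1[of k] by linarith+

lemma freq_uminus[simp]: "freq (\<lambda>j. - k j) = freq k"
  by (simp add: freq_def)

lemma abs_le_freq: "\<bar>of_int (k j)\<bar> \<le> freq k"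
proof (rule power2_le_imp_le)
  have "(of_int (k j) :: real)\<^sup>2 \<le> (\<Sum>j\<in>UNIV. (of_int (k j))\<^sup>2)" by (rule member_le_sum) auto
  then show "\<bar>of_int (k j) :: real\<bar>\<^sup>2 \<le> (freq k)\<^sup>2" by (simp add: freq_sq)
qed simp

lemma square_int_count_meas: "square_int (count_space UNIV) g \<longleftrightarrow> integrable (count_space UNIV) (\<lambda>k. (g k)\<^sup>2)"
  by (simp add: square_int_def)

text \<open>The coefficients of \<open>f\<close> and of its weak derivatives add up to the weighted
  sum because \<open>(freq k)\<^sup>2\<close> is one plus the sum of the squares of the
  \<open>k j\<close>. Conversely each \<open>k j\<close> is dominated by \<open>freq k\<close>, and
  the derivative is synthesised from its coefficients.\<close>

lemma H1_fun_iff: "H1_fun f \<longleftrightarrow> square_int tmeas f \<and> square_int (count_space UNIV) (\<lambda>k. freq k * fcoeff f k)"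
proof
  assume H: "H1_fun f"
  then have f: "square_int tmeas f" by (simp add: H1_fun_def L2_fun_square_int)
  have "\<forall>j. \<exists>g. square_int tmeas g \<and> (\<forall>k. fcoeff g k = - of_int (k j) * fcoeff f (\<lambda>i. - k i))"
  proof
    fix j
    obtain g where "square_int tmeas g" "weak_pd j f g" using H by (auto simp: H1_fun_def L2_fun_square_int)
    then show "\<exists>g. square_int tmeas g \<and> (\<forall>k. fcoeff g k = - of_int (k j) * fcoeff f (\<lambda>i. - k i))"
      using weak_pd_iff[OF f] by blast
  qed
  then obtain g where g: "\<And>j. square_int tmeas (g j)" "\<And>j k. fcoeff (g j) k = - of_int (k j) * fcoeff f (\<lambda>i. - k i)"
    by metis
  have "square_int (count_space UNIV) (\<lambda>k. of_int (k j) * fcoeff f k)" for j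
  proof -
    have "square_int (count_space UNIV) (\<lambda>k. fcoeff (g j) (\<lambda>i. - k i))"
      using fcoeff_square_int[OF g(1)] by (simp add: square_int_reflect)
    then show ?thesis by (simp add: g(2))
  qed
  then have "integrable (count_space UNIV) (\<lambda>k. (fcoeff f k)\<^sup>2 + (\<Sum>j\<in>UNIV. (of_int (k j) * fcoeff f k)\<^sup>2))"
    using fcoeff_square_int[OF f] by (intro Bochner_Integration.integrable_add Bochner_Integration.integrable_sum)
      (auto simp: square_int_count_meas)
  also have "(\<lambda>k. (fcoeff f k)\<^sup>2 + (\<Sum>j\<in>UNIV. (of_int (k j) * fcoeff f k)\<^sup>2)) = (\<lambda>k. (freq k * fcoeff f k)\<^sup>2)"
    by (auto simp: power_mult_distrib freq_sq distrib_right sum_distrib_right)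
  finally show "square_int tmeas f \<and> square_int (count_space UNIV) (\<lambda>k. freq k * fcoeff f k)"
    using f by (simp add: square_int_count_meas)
next
  assume a: "square_int tmeas f \<and> square_int (count_space UNIV) (\<lambda>k. freq k * fcoeff f k)"
  have "\<exists>g. square_int tmeas g \<and> weak_pd j f g" for j
  proof -
    have s: "square_int (count_space UNIV) (\<lambda>k. - of_int (k j) * fcoeff f (\<lambda>i. - k i))"
    proof (rule square_int_bound)
      show "square_int (count_space UNIV) (\<lambda>k. freq k * fcoeff f (\<lambda>i. - k i))"
        using a square_int_reflect[of "\<lambda>k. freq k * fcoeff f k"] by simp
      show "AE k in count_space UNIV. \<bar>- of_int (k j) * fcoeff f (\<lambda>i. - k i)\<bar> \<le> \<bar>freq k * fcoeff f (\<lambda>i. - k i)\<bar>"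
        by (intro AE_I2) (auto simp: abs_mult intro!: mult_right_mono abs_le_freq)
    qed simp
    have "weak_pd j f (fsynth (Abs_l2 (\<lambda>k. - of_int (k j) * fcoeff f (\<lambda>i. - k i))))"
      using a by (subst weak_pd_iff) (auto simp: fsynth fcoeff_fsynth l2c_Abs[OF s[simplified]])
    then show ?thesis using fsynth by blast
  qed
  then show "H1_fun f" using a by (simp add: H1_fun_def L2_fun_square_int)
qed

lemma wd_fcoeff:
  assumes "H1_fun f"
  shows "square_int tmeas (wd j f)" "fcoeff (wd j f) k = - of_int (k j) * fcoeff f (\<lambda>i. - k i)"
proof -
  have "\<exists>g. L2_fun g \<and> weak_pd j f g" using assms by (simp add: H1_fun_def)
  from someI_ex[OF this] have *: "square_int tmeas (wd j f)" "weak_pd j f (wd j f)"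
    by (auto simp: wd_def L2_fun_square_int)
  then show "square_int tmeas (wd j f)" by simp
  show "fcoeff (wd j f) k = - of_int (k j) * fcoeff f (\<lambda>i. - k i)"
    using * assms weak_pd_iff[of f "wd j f" j] by (auto simp: H1_fun_iff)
qed

subsection \<open>The energy space as a Hilbert space of coefficients\<close>

type_synonym 'd energy = "('d \<Rightarrow> int) l2 \<times> ('d \<Rightarrow> int) l2"

text \<open>The weight turns the energy norm into the norm of \<open>\<ell>\<^sup>2 \<times> \<ell>\<^sup>2\<close>.\<close>

definition coords :: "'d::finite st \<Rightarrow> 'd energy" where
  "coords W = (Abs_l2 (\<lambda>k. freq k * fcoeff (fst W) k), fcoeffs (snd W))"

text \<open>Junk unless the weighted family is square summable; it is for bounded \<open>m\<close>.\<close>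

definition diag_op :: "(('d::finite \<Rightarrow> int) \<Rightarrow> real) \<Rightarrow> ('d \<Rightarrow> int) l2 \<Rightarrow> ('d \<Rightarrow> int) l2" where
  "diag_op m x = Abs_l2 (\<lambda>k. m k * l2c x k)"

text \<open>A right inverse of \<open>coords\<close>. In the other order the original state is
  recovered only almost everywhere.\<close>

definition uncoords :: "'d::finite energy \<Rightarrow> 'd st" where
  "uncoords U = (fsynth (diag_op (\<lambda>k. 1 / freq k) (fst U)), fsynth (snd U))"

lemma square_int_diag_op:
  assumes "\<And>k. \<bar>m k\<bar> \<le> C"
  shows "square_int (count_space UNIV) (\<lambda>k. m k * l2c x k)"
  using assms by (intro square_int_bounded_mult l2c_square_int) (auto simp: AE_count_space)

lemma l2c_diag_op: "(\<And>k. \<bar>m k\<bar> \<le> C) \<Longrightarrow> l2c (diag_op m x) k = m k * l2c x k"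
  unfolding diag_op_def by (subst l2c_Abs[OF square_int_diag_op]) auto

lemma freq_inv_le: "\<bar>1 / freq k\<bar> \<le> 1"
  using freq_ge1[of k] by simp

lemma Xsp_iff: "Xsp W \<longleftrightarrow> square_int tmeas (fst W) \<and> square_int (count_space UNIV) (\<lambda>k. freq k * fcoeff (fst W) k) \<and> square_int tmeas (snd W)"
  by (auto simp: Xsp_def H1_fun_iff L2_fun_square_int)

lemma l2c_coords:
  assumes "Xsp W"
  shows "l2c (fst (coords W)) k = freq k * fcoeff (fst W) k" "l2c (snd (coords W)) k = fcoeff (snd W) k"
  using assms by (auto simp: coords_def Xsp_iff l2c_Abs l2c_fcoeffs)

lemma Xsp_uncoords: "Xsp (uncoords U)"
proof -
  have "(\<lambda>k. freq k * fcoeff (fst (uncoords U)) k) = l2c (fst U)"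
    by (auto simp: uncoords_def fcoeff_fsynth l2c_diag_op[OF freq_inv_le])
  then show ?thesis unfolding Xsp_iff by (simp add: l2c_square_int) (simp add: uncoords_def fsynth)
qed

lemma coords_uncoords[simp]: "coords (uncoords U) = U"
proof (rule prod_eqI; rule l2_eqI)
  fix k
  show "l2c (fst (coords (uncoords U))) k = l2c (fst U) k" "l2c (snd (coords (uncoords U))) k = l2c (snd U) k"
    unfolding l2c_coords[OF Xsp_uncoords] by (simp_all add: uncoords_def fcoeff_fsynth l2c_diag_op[OF freq_inv_le])
qed

lemma coords_eqI:
  assumes "Xsp W" "\<And>k. freq k * fcoeff (fst W) k = l2c (fst U) k" "\<And>k. fcoeff (snd W) k = l2c (snd U) k"
  shows "coords W = U"
  by (rule prod_eqI; rule l2_eqI) (simp_all add: l2c_coords[OF assms(1)] assms(2,3))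

lemma coords_eq_fcoeff:
  assumes "Xsp W" "Xsp U"
  shows "coords W = coords U \<longleftrightarrow> (AE x in tmeas. fst W x = fst U x) \<and> (AE x in tmeas. snd W x = snd U x)"
proof -
  have "fst (coords W) = fst (coords U) \<longleftrightarrow> fcoeffs (fst W) = fcoeffs (fst U)"
  proof -
    have "fst (coords W) = fst (coords U) \<longleftrightarrow> (\<forall>k. l2c (fst (coords W)) k = l2c (fst (coords U)) k)" by (auto intro: l2_eqI)
    also have "\<dots> \<longleftrightarrow> (\<forall>k. l2c (fcoeffs (fst W)) k = l2c (fcoeffs (fst U)) k)"
      using assms by (simp add: l2c_coords l2c_fcoeffs Xsp_iff)
    also have "\<dots> \<longleftrightarrow> fcoeffs (fst W) = fcoeffs (fst U)" by (auto intro: l2_eqI)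
    finally show ?thesis .
  qed
  then show ?thesis
    using assms by (simp add: prod_eq_iff fcoeffs_eq_iff Xsp_iff) (simp add: coords_def fcoeffs_eq_iff)
qed

lemma Xsp_sadd: "Xsp W \<Longrightarrow> Xsp U \<Longrightarrow> Xsp (sadd W U) \<and> coords (sadd W U) = coords W + coords U"
proof -
  assume a: "Xsp W" "Xsp U"
  then have "square_int (count_space UNIV) (\<lambda>k. freq k * fcoeff (fst W) k + freq k * fcoeff (fst U) k)"
    by (intro square_int_add) (auto simp: Xsp_iff)
  then have x: "Xsp (sadd W U)"
    using a by (simp add: Xsp_iff sadd_def square_int_add fcoeff_add distrib_left)
  moreover have "coords (sadd W U) = coords W + coords U"
    using a by (intro coords_eqI[OF x]) (auto simp: sadd_def fcoeff_add l2c_coords Xsp_iff distrib_left)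
  ultimately show ?thesis by blast
qed

lemma Xsp_sscale: "Xsp W \<Longrightarrow> Xsp (sscale a W) \<and> coords (sscale a W) = a *\<^sub>R coords W"
proof -
  assume a: "Xsp W"
  then have "square_int (count_space UNIV) (\<lambda>k. a * (freq k * fcoeff (fst W) k))"
    by (intro square_int_scale) (auto simp: Xsp_iff)
  then have x: "Xsp (sscale a W)"
    using a by (simp add: Xsp_iff sscale_def square_int_scale fcoeff_scale mult.left_commute)
  moreover have "coords (sscale a W) = a *\<^sub>R coords W"
    using a by (intro coords_eqI[OF x]) (auto simp: sscale_def fcoeff_scale l2c_coords Xsp_iff)
  ultimately show ?thesis by blast
qed

lemma Xsp_sdiff: "Xsp W \<Longrightarrow> Xsp U \<Longrightarrow> Xsp (sdiff W U) \<and> coords (sdiff W U) = coords W - coords U"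
proof -
  assume a: "Xsp W" "Xsp U"
  have e: "sdiff W U = sadd W (sscale (-1) U)" by (simp add: sdiff_def sadd_def sscale_def)
  show ?thesis
    using Xsp_sadd[OF a(1)] Xsp_sscale[OF a(2), of "-1"] by (simp add: e)
qed

text \<open>Parseval for each derivative, followed by the reflection of the index, leaves factors of
  the squares of the \<open>k j\<close>; summing over \<open>j\<close> and adding the
  undifferentiated term produces the squared weight.\<close>

lemma sinner_coords:
  assumes W: "Xsp W" and U: "Xsp U"
  shows "sinner W U = inner (coords W) (coords U)"
proof -
  let ?f = "fst W" and ?g = "fst U" and ?C = "count_space UNIV"
  have H: "H1_fun ?f" "H1_fun ?g" using W U by (auto simp: Xsp_def)
  have s: "square_int tmeas (snd W)" "square_int tmeas (snd U)" "square_int tmeas ?f" "square_int tmeas ?g"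
    using W U by (auto simp: Xsp_iff)
  have d: "(LINT x|tmeas. wd j ?f x * wd j ?g x) = (LINT k|?C. (of_int (k j))\<^sup>2 * (fcoeff ?f k * fcoeff ?g k))" for j
  proof -
    have "(LINT x|tmeas. wd j ?f x * wd j ?g x) = (LINT k|?C. fcoeff (wd j ?f) k * fcoeff (wd j ?g) k)"
      by (intro Parseval_count wd_fcoeff H)
    also have "\<dots> = (LINT k|?C. fcoeff (wd j ?f) (\<lambda>i. - k i) * fcoeff (wd j ?g) (\<lambda>i. - k i))"
      by (rule count_reflect(1)[symmetric])
    also have "\<dots> = (LINT k|?C. (of_int (k j))\<^sup>2 * (fcoeff ?f k * fcoeff ?g k))"
      by (intro Bochner_Integration.integral_cong) (auto simp: wd_fcoeff(2)[OF H(1)] wd_fcoeff(2)[OF H(2)] power2_eq_square)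
    finally show ?thesis .
  qed
  have di: "integrable ?C (\<lambda>k. (of_int (k j))\<^sup>2 * (fcoeff ?f k * fcoeff ?g k))" for j
  proof -
    have "integrable ?C (\<lambda>k. fcoeff (wd j ?f) k * fcoeff (wd j ?g) k)"
      by (intro square_int_mult_integrable fcoeff_square_int wd_fcoeff H)
    then have "integrable ?C (\<lambda>k. fcoeff (wd j ?f) (\<lambda>i. - k i) * fcoeff (wd j ?g) (\<lambda>i. - k i))"
      by (subst count_reflect(2))
    then show ?thesis by (simp add: wd_fcoeff(2)[OF H(1)] wd_fcoeff(2)[OF H(2)] power2_eq_square ac_simps)
  qed
  have "sinner W U = (\<Sum>j\<in>UNIV. LINT x|tmeas. wd j ?f x * wd j ?g x) + (LINT x|tmeas. ?f x * ?g x) + (LINT x|tmeas. snd W x * snd U x)"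
    unfolding sinner_def using H s
    by (simp add: Bochner_Integration.integral_add Bochner_Integration.integral_sum
        square_int_mult_integrable wd_fcoeff(1) Bochner_Integration.integrable_add Bochner_Integration.integrable_sum)
  also have "(\<Sum>j\<in>UNIV. LINT x|tmeas. wd j ?f x * wd j ?g x) + (LINT x|tmeas. ?f x * ?g x)
    = (LINT k|?C. (\<Sum>j\<in>UNIV. (of_int (k j))\<^sup>2 * (fcoeff ?f k * fcoeff ?g k)) + fcoeff ?f k * fcoeff ?g k)"
    unfolding d Parseval_count[OF s(3,4)] using di square_int_mult_integrable[OF fcoeff_square_int[OF s(3)] fcoeff_square_int[OF s(4)]]
    by (simp add: Bochner_Integration.integral_add Bochner_Integration.integral_sum Bochner_Integration.integrable_sum)
  also have "\<dots> = (LINT k|?C. l2c (fst (coords W)) k * l2c (fst (coords U)) k)"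
  proof (intro Bochner_Integration.integral_cong refl)
    fix k
    have "(\<Sum>j\<in>UNIV. (of_int (k j))\<^sup>2 * (fcoeff ?f k * fcoeff ?g k)) + fcoeff ?f k * fcoeff ?g k = (freq k)\<^sup>2 * (fcoeff ?f k * fcoeff ?g k)"
      by (simp add: freq_sq sum_distrib_right distrib_right)
    then show "(\<Sum>j\<in>UNIV. (of_int (k j))\<^sup>2 * (fcoeff ?f k * fcoeff ?g k)) + fcoeff ?f k * fcoeff ?g k = l2c (fst (coords W)) k * l2c (fst (coords U)) k"
      by (simp add: l2c_coords W U power2_eq_square)
  qed
  also have "(LINT x|tmeas. snd W x * snd U x) = inner (snd (coords W)) (snd (coords U))"
    using Parseval[OF s(1,2)] by (simp add: coords_def)
  finally show ?thesis by (simp add: inner_prod_def inner_l2_def)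
qed

lemma snorm_coords: "Xsp W \<Longrightarrow> snorm W = norm (coords W)"
  by (simp add: snorm_def sinner_coords norm_eq_sqrt_inner)

lemma snorm_sdiff: "Xsp W \<Longrightarrow> Xsp U \<Longrightarrow> snorm (sdiff W U) = norm (coords W - coords U)"
  using Xsp_sdiff[of W U] by (simp add: snorm_coords)

subsection \<open>Sobolev multipliers\<close>

lemma powr_diff_ge:
  fixes a m :: real
  assumes "0 < a" "a < 1" "m \<ge> 1"
  shows "a * m powr (a - 1) \<le> m powr a - (m - 1) powr a"
proof (cases "m = 1")
  case False
  then have m: "m > 1" using assms by simp
  \<comment> \<open>The weighted arithmetic-geometric mean inequality for (m-1)/m and 1 replaces an
    integral comparison: it makes the sums of \<open>m powr (a - 1)\<close> telescope.\<close>
  have "((m - 1) / m) powr a * 1 powr (1 - a) \<le> a * ((m - 1) / m) + (1 - a) * 1"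
    using assms m by (intro Youngs_inequality_0) auto
  then have "((m - 1) / m) powr a \<le> 1 - a / m" using m by (simp add: field_simps)
  then have "m powr a * ((m - 1) / m) powr a \<le> m powr a * (1 - a / m)"
    by (intro mult_left_mono) auto
  also have "m powr a * ((m - 1) / m) powr a = (m - 1) powr a"
    using m by (simp add: powr_divide)
  also have "m powr a * (1 - a / m) = m powr a - a * m powr (a - 1)"
    using m by (simp add: powr_diff algebra_simps)
  finally show ?thesis by simp
qed (use assms in simp)

text \<open>One coordinate's factor in a product majorant for the sum of
  \<open>1 / (freq k)\<^sup>2\<close> over a box. The maximum gives the index 0 the weight
  1.\<close>

definition lsum :: "real \<Rightarrow> nat \<Rightarrow> real" where
  "lsum \<beta> M = (\<Sum>m\<in>{- int M..int M}. max 1 \<bar>real_of_int m\<bar> powr (- \<beta>))"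

lemma lsum_Suc: "lsum \<beta> (Suc M) = lsum \<beta> M + 2 * real (Suc M) powr (- \<beta>)"
proof -
  have "{- int (Suc M)..int (Suc M)} = insert (- int (Suc M)) (insert (int (Suc M)) {- int M..int M})"
    by auto
  then show ?thesis unfolding lsum_def by (simp add: max_def add.commute)
qed

lemma lsum_0: "lsum \<beta> 0 = 1"
  by (simp add: lsum_def)

lemma lsum_le:
  assumes "0 < \<beta>" "\<beta> < 1"
  shows "lsum \<beta> M \<le> 1 + 2 / (1 - \<beta>) * real M powr (1 - \<beta>)"
proof (induction M)
  case (Suc M)
  have "(1 - \<beta>) * real (Suc M) powr (1 - \<beta> - 1) \<le> real (Suc M) powr (1 - \<beta>) - (real (Suc M) - 1) powr (1 - \<beta>)"
    using assms by (intro powr_diff_ge) auto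
  then have "real (Suc M) powr (- \<beta>) \<le> (real (Suc M) powr (1 - \<beta>) - real M powr (1 - \<beta>)) / (1 - \<beta>)"
    using assms by (simp add: pos_le_divide_eq mult.commute)
  then show ?case using Suc unfolding lsum_Suc by (simp add: diff_divide_distrib)
qed (simp add: lsum_0)

text \<open>The squares are compared with the telescoping terms 1/(M(M+1)). The constant 5 makes the
  bound sharp at \<open>M = 1\<close>; at \<open>M = 0\<close> the quotient is 0 by convention and
  the bound is still true.\<close>

lemma lsum_2_le: "lsum 2 M \<le> 5 - 2 / real M"
proof (induction M)
  case (Suc M)
  have e: "real (Suc M) powr (- 2) = 1 / (real (Suc M))\<^sup>2"
    by (simp add: powr_minus_divide powr_realpow)
  show ?case
  proof (cases "M = 0")
    case True then show ?thesis using lsum_Suc[of 2 0] by (simp add: lsum_0)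
  next
    case False
    then have "1 / real M - 1 / real (Suc M) = 1 / (real M * real (Suc M))"
      by (simp add: field_simps)
    moreover have "1 / (real (Suc M))\<^sup>2 \<le> 1 / (real M * real (Suc M))"
      unfolding power2_eq_square using False by (intro divide_left_mono mult_right_mono) auto
    ultimately have "1 / (real (Suc M))\<^sup>2 \<le> 1 / real M - 1 / real (Suc M)" by linarith
    then show ?thesis using Suc unfolding lsum_Suc e by simp
  qed
qed (simp add: lsum_0)

text \<open>With d the dimension, d\<beta> \<le> 2 lets freq^-2 be bounded by freq^(-d\<beta>), a
  product of d equal factors. Each is bounded through one coordinate of \<open>k\<close>, and the
  sum over the box factorises.\<close>

lemma sum_kbox_le:
  fixes \<beta> :: real
  assumes "0 \<le> \<beta>" "\<beta> * CARD('d::finite) \<le> 2"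
  shows "(\<Sum>k\<in>(kbox M :: ('d \<Rightarrow> int) set). 1 / (freq k)\<^sup>2) \<le> lsum \<beta> M ^ CARD('d)"
proof -
  have "1 / (freq k)\<^sup>2 \<le> (\<Prod>j\<in>UNIV. max 1 \<bar>real_of_int (k j)\<bar> powr (- \<beta>))" for k :: "'d \<Rightarrow> int"
  proof -
    have "1 / (freq k)\<^sup>2 = freq k powr (- 2)" by (simp add: powr_minus_divide powr_realpow)
    also have "\<dots> \<le> freq k powr (- (\<beta> * CARD('d)))"
      using assms freq_ge1[of k] by (intro powr_mono) auto
    also have "\<dots> = (freq k powr (- \<beta>)) ^ CARD('d)"
      by (simp add: powr_powr flip: powr_realpow)
    also have "\<dots> = (\<Prod>j\<in>(UNIV::'d set). freq k powr (- \<beta>))" by simp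
    also have "\<dots> \<le> (\<Prod>j\<in>UNIV. max 1 \<bar>real_of_int (k j)\<bar> powr (- \<beta>))"
      using assms freq_ge1[of k] abs_le_freq[of k] by (intro prod_mono) (auto intro!: powr_mono2')
    finally show ?thesis .
  qed
  then have "(\<Sum>k\<in>(kbox M :: ('d \<Rightarrow> int) set). 1 / (freq k)\<^sup>2)
     \<le> (\<Sum>k\<in>(kbox M :: ('d \<Rightarrow> int) set). \<Prod>j\<in>UNIV. max 1 \<bar>real_of_int (k j)\<bar> powr (- \<beta>))"
    by (intro sum_mono) auto
  also have "\<dots> = (\<Prod>j\<in>(UNIV::'d set). lsum \<beta> M)"
    unfolding kbox_PiE lsum_def by (subst prod_sum_PiE) auto
  finally show ?thesis by simp
qed

definition lowset :: "real \<Rightarrow> ('d::finite \<Rightarrow> int) set" where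
  "lowset A = {k. freq k \<le> A}"

lemma lowset_kbox: "lowset A \<subseteq> kbox (nat \<lfloor>A\<rfloor>)"
proof
  fix k :: "'a \<Rightarrow> int" assume "k \<in> lowset A"
  then have k: "freq k \<le> A" by (simp add: lowset_def)
  then have "A \<ge> 1" using freq_ge1[of k] by simp
  have "\<bar>k j\<bar> \<le> \<lfloor>A\<rfloor>" for j
    using abs_le_freq[of k j] k by (simp add: le_floor_iff)
  then show "k \<in> kbox (nat \<lfloor>A\<rfloor>)" using \<open>A \<ge> 1\<close> by (simp add: kbox_def)
qed

lemma lowset_finite[simp]: "finite (lowset A)"
  by (rule finite_subset[OF lowset_kbox kbox_finite])

text \<open>For \<beta> = 2/d the exponent is d - 2, the true growth of the sum of |k|^-2 over a
  ball of radius \<open>A\<close> when d \<ge> 3. Other values of \<beta> serve the case d =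
  2.\<close>

lemma lowset_sum_le:
  fixes \<beta> A :: real
  assumes "0 < \<beta>" "\<beta> < 1" "\<beta> * CARD('d::finite) \<le> 2" "A > 0"
  shows "(\<Sum>k\<in>(lowset A :: ('d \<Rightarrow> int) set). 1 / (freq k)\<^sup>2) \<le> (1 + 2 / (1 - \<beta>)) ^ CARD('d) * A powr (CARD('d) * (1 - \<beta>))"
proof (cases "A \<ge> 1")
  case True
  let ?M = "nat \<lfloor>A\<rfloor>"
  have M: "real ?M \<le> A" using True by simp
  have "(\<Sum>k\<in>(lowset A :: ('d \<Rightarrow> int) set). 1 / (freq k)\<^sup>2) \<le> (\<Sum>k\<in>(kbox ?M :: ('d \<Rightarrow> int) set). 1 / (freq k)\<^sup>2)"
    by (intro sum_mono2 lowset_kbox) auto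
  also have "\<dots> \<le> lsum \<beta> ?M ^ CARD('d)" using assms by (intro sum_kbox_le) auto
  also have "\<dots> \<le> ((1 + 2 / (1 - \<beta>)) * A powr (1 - \<beta>)) ^ CARD('d)"
  proof (rule power_mono)
    have "lsum \<beta> ?M \<le> 1 + 2 / (1 - \<beta>) * real ?M powr (1 - \<beta>)" using assms by (intro lsum_le) auto
    also have "\<dots> \<le> A powr (1 - \<beta>) + 2 / (1 - \<beta>) * A powr (1 - \<beta>)"
      using assms True M by (intro add_mono mult_left_mono powr_mono2 ge_one_powr_ge_zero) auto
    finally show "lsum \<beta> ?M \<le> (1 + 2 / (1 - \<beta>)) * A powr (1 - \<beta>)" by (simp add: distrib_right)
    show "0 \<le> lsum \<beta> ?M" unfolding lsum_def by (intro sum_nonneg) auto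
  qed
  also have "\<dots> = (1 + 2 / (1 - \<beta>)) ^ CARD('d) * A powr (CARD('d) * (1 - \<beta>))"
    using True by (simp add: power_mult_distrib powr_powr mult.commute flip: powr_realpow)
  finally show ?thesis .
next
  case False
  have "\<not> freq k \<le> A" for k :: "'d \<Rightarrow> int" using freq_ge1[of k] False by linarith
  then have "lowset A = ({} :: ('d \<Rightarrow> int) set)" by (simp add: lowset_def)
  then show ?thesis using assms by simp
qed

section \<open>Frequency splitting and the Sobolev embedding\<close>

definition h1_norm_sq :: "(real^'d::finite \<Rightarrow> real) \<Rightarrow> real" where
  "h1_norm_sq w = (LINT k|count_space UNIV. (freq k * fcoeff w k)\<^sup>2)"

lemma h1_norm_sq_finite:
  assumes "H1_fun w" "finite F"
  shows "(\<Sum>k\<in>F. (freq k * fcoeff w k)\<^sup>2) \<le> h1_norm_sq w"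
proof -
  have s: "square_int (count_space UNIV) (\<lambda>k. freq k * fcoeff w k)" using assms by (simp add: H1_fun_iff)
  show ?thesis
    using l2_norm_ge_sum[OF assms(2), of "Abs_l2 (\<lambda>k. freq k * fcoeff w k)"]
    by (simp add: l2c_Abs[OF s] l2_norm_sq h1_norm_sq_def)
qed

text \<open>Cauchy-Schwarz after writing each coefficient as \<open>freq k * fcoeff w k\<close>
  times \<open>1 / freq k\<close>, together with the uniform bound on the basis.\<close>

lemma low_bound:
  fixes w :: "real^'d::finite \<Rightarrow> real"
  assumes "H1_fun w" "h1_norm_sq w \<le> 1" "finite F" "(\<Sum>k\<in>F. 1 / (freq k)\<^sup>2) \<le> S"
  shows "\<bar>\<Sum>k\<in>F. fcoeff w k * trig_basis k x\<bar> \<le> 2 / sqrt (torus_vol TYPE('d)) * sqrt S"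
proof -
  have S0: "S \<ge> 0" by (rule order_trans[OF _ assms(4)]) (auto intro!: sum_nonneg)
  have e: "(\<Sum>k\<in>F. \<bar>fcoeff w k\<bar>) = (\<Sum>k\<in>F. \<bar>freq k * fcoeff w k\<bar> * (1 / freq k))"
    by (intro sum.cong) (auto simp: abs_mult)
  have "(\<Sum>k\<in>F. \<bar>freq k * fcoeff w k\<bar> * (1 / freq k))\<^sup>2 \<le> (\<Sum>k\<in>F. \<bar>freq k * fcoeff w k\<bar>\<^sup>2) * (\<Sum>k\<in>F. (1 / freq k)\<^sup>2)"
    by (rule Cauchy_Schwarz_ineq_sum)
  moreover have "\<dots> \<le> 1 * S"
  proof (rule mult_mono)
    show "(\<Sum>k\<in>F. \<bar>freq k * fcoeff w k\<bar>\<^sup>2) \<le> 1"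
      using h1_norm_sq_finite[OF assms(1,3)] assms(2) by simp
  qed (use assms(4) in \<open>auto simp: power_divide intro!: sum_nonneg\<close>)
  ultimately have "(\<Sum>k\<in>F. \<bar>fcoeff w k\<bar>)\<^sup>2 \<le> S" unfolding e by linarith
  then have 1: "(\<Sum>k\<in>F. \<bar>fcoeff w k\<bar>) \<le> sqrt S" by (rule real_le_rsqrt)
  have "\<bar>\<Sum>k\<in>F. fcoeff w k * trig_basis k x\<bar> \<le> (\<Sum>k\<in>F. \<bar>fcoeff w k\<bar> * (2 / sqrt (torus_vol TYPE('d))))"
    by (intro order_trans[OF sum_abs] sum_mono, unfold abs_mult) (intro mult_left_mono trig_basis_bound abs_ge_zero)
  also have "\<dots> = 2 / sqrt (torus_vol TYPE('d)) * (\<Sum>k\<in>F. \<bar>fcoeff w k\<bar>)"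
    unfolding sum_distrib_right[symmetric] by (rule mult.commute)
  also have "\<dots> \<le> 2 / sqrt (torus_vol TYPE('d)) * sqrt S" using 1 by (intro mult_left_mono) auto
  finally show ?thesis .
qed

lemma high_norm:
  fixes w :: "real^'d::finite \<Rightarrow> real"
  assumes w: "square_int tmeas w" and F: "finite F"
  shows "(LINT x|tmeas. (w x - (\<Sum>k\<in>F. fcoeff w k * trig_basis k x))\<^sup>2) = (LINT k|count_space UNIV. (if k \<in> F then 0 else (fcoeff w k)\<^sup>2))"
proof -
  let ?p = "\<lambda>x. \<Sum>k\<in>F. fcoeff w k * trig_basis k x"
  have d: "square_int tmeas (\<lambda>x. w x - ?p x)" by (intro square_int_diff w sum_trig_basis_square_int)
  have "fcoeff (\<lambda>x. w x - ?p x) k = (if k \<in> F then 0 else fcoeff w k)" for k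
    by (subst fcoeff_diff[OF w sum_trig_basis_square_int]) (simp add: fcoeff_sum_trig_basis[OF F])
  then show ?thesis
    using Parseval_norm[OF d] by (simp add: l2_norm_sq l2c_fcoeffs[OF d] if_distrib[of "\<lambda>t. t\<^sup>2"] cong: if_cong)
qed

lemma geometric_truncated_sum:
  fixes r Y :: real
  assumes "r > 1" "Y \<ge> 0"
  shows "(\<Sum>n<N. if r ^ n < Y then r ^ n else 0) \<le> r * Y / (r - 1)"
proof -
  \<comment> \<open>The induction needs a bound that sees both the number of terms and the
    truncation level, hence the minimum.\<close>
  have "(\<Sum>n<N. if r ^ n < Y then r ^ n else 0) \<le> min (r ^ N) (r * Y) / (r - 1)"
  proof (induction N)
    case 0 then show ?case using assms by simp
  next
    case (Suc N)
    show ?case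
    proof (cases "r ^ N < Y")
      case True
      have "(\<Sum>n<Suc N. if r ^ n < Y then r ^ n else 0) \<le> r ^ N / (r - 1) + r ^ N"
      proof -
        have "min (r ^ N) (r * Y) / (r - 1) \<le> r ^ N / (r - 1)"
          using assms by (intro divide_right_mono) auto
        then show ?thesis using Suc True by simp
      qed
      also have "\<dots> = r ^ Suc N / (r - 1)" using assms by (simp add: field_simps)
      also have "r ^ Suc N = min (r ^ Suc N) (r * Y)" using True assms by simp
      finally show ?thesis .
    next
      case False
      have "min (r ^ N) (r * Y) \<le> min (r ^ Suc N) (r * Y)"
        using assms by (intro min.mono) auto
      then have "min (r ^ N) (r * Y) / (r - 1) \<le> min (r ^ Suc N) (r * Y) / (r - 1)"
        using assms by (intro divide_right_mono) auto
      moreover have "(\<Sum>n<Suc N. if r ^ n < Y then r ^ n else 0) = (\<Sum>n<N. if r ^ n < Y then r ^ n else 0)"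
        using False by simp
      ultimately show ?thesis using Suc by linarith
    qed
  qed
  also have "\<dots> \<le> r * Y / (r - 1)" using assms by (intro divide_right_mono) auto
  finally show ?thesis .
qed

text \<open>A dyadic layer-cake bound: for |t| > 1 the single term with 2^n < |t| \<le> 2^(n+1)
  already suffices, and the summand 1 covers |t| \<le> 1.\<close>

lemma powr_dyadic_bound:
  fixes t p :: real
  assumes "p > 0"
  shows "ennreal (\<bar>t\<bar> powr p) \<le> 1 + (\<Sum>n. ennreal (if 2 ^ n < \<bar>t\<bar> then (2 * 2 ^ n) powr p else 0))"
proof (cases "\<bar>t\<bar> \<le> 1")
  case True
  then have "\<bar>t\<bar> powr p \<le> 1" using assms by (intro powr_le1) auto
  then have "ennreal (\<bar>t\<bar> powr p) \<le> 1" by (metis ennreal_1 ennreal_leI)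
  also have "1 \<le> 1 + (\<Sum>n. ennreal (if 2 ^ n < \<bar>t\<bar> then (2 * 2 ^ n) powr p else 0))" by simp
  finally show ?thesis .
next
  case False
  define P where "P n \<longleftrightarrow> \<bar>t\<bar> \<le> 2 ^ n" for n :: nat
  have "\<exists>n. P n" unfolding P_def
    using real_arch_pow[of 2 "\<bar>t\<bar>"] by (auto intro: less_imp_le)
  then have l: "P (LEAST n. P n)" by (rule LeastI_ex)
  have "(LEAST n. P n) \<noteq> 0" using l False by (intro notI) (simp add: P_def)
  then obtain m where m: "(LEAST n. P n) = Suc m" using not0_implies_Suc by blast
  have "\<not> P m" using not_less_Least[of m P] m by simp
  then have lt: "2 ^ m < \<bar>t\<bar>" by (simp add: P_def)
  have le: "\<bar>t\<bar> \<le> 2 * 2 ^ m" using l unfolding m by (simp add: P_def)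
  define a where "a n = ennreal (if 2 ^ n < \<bar>t\<bar> then (2 * 2 ^ n) powr p else 0)" for n :: nat
  have "ennreal (\<bar>t\<bar> powr p) \<le> a m"
    unfolding a_def if_P[OF lt] using le assms by (intro ennreal_leI powr_mono2) auto
  also have "a m = sum a {m}" by simp
  also have "\<dots> \<le> suminf a" by (intro sum_le_suminf summableI) auto
  also have "suminf a \<le> 1 + suminf a" by (rule add_increasing) auto
  finally show ?thesis unfolding a_def[abs_def] .
qed

lemma tmeas_space_finite: "(\<integral>\<^sup>+x. 1 \<partial>(tmeas :: (real^'d::finite) measure)) = ennreal (torus_vol TYPE('d))"
proof -
  have "(\<integral>\<^sup>+x. ennreal 1 \<partial>(tmeas :: (real^'d) measure)) = ennreal (LINT (x::real^'d)|tmeas. 1)"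
    by (rule nn_integral_eq_integral) (auto intro!: cube_continuous_integrable)
  also have "(LINT (x::real^'d)|tmeas. (1::real)) = torus_vol TYPE('d)"
    using integral_cos_sin(1)[of "\<lambda>_::'d. 0"] by (simp add: kdot_def)
  finally show ?thesis by simp
qed

text \<open>Chemin--Xu argument: the frequency cutoff depends on the level, so that the low frequencies
  stay below half of the level and only the high ones contribute to the distribution function.\<close>

lemma Sobolev_embedding:
  fixes \<beta> p :: real
  assumes \<beta>: "0 < \<beta>" "\<beta> < 1" "\<beta> * CARD('d::finite) \<le> 2"
    and p: "p > 2" "CARD('d) * (1 - \<beta>) / 2 * (p - 2) \<le> 2"
  obtains K where "K \<ge> 0"
    "\<And>w :: real^'d \<Rightarrow> real. H1_fun w \<Longrightarrow> h1_norm_sq w \<le> 1 \<Longrightarrow> (\<integral>\<^sup>+x. ennreal (\<bar>w x\<bar> powr p) \<partial>tmeas) \<le> ennreal K"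
proof -
  define \<alpha> where "\<alpha> = CARD('d) * (1 - \<beta>) / 2"
  define c1 where "c1 = (1 + 2 / (1 - \<beta>)) ^ CARD('d)"
  define c2 where "c2 = 2 / sqrt (torus_vol TYPE('d)) * sqrt c1"
  have c1: "c1 > 0" using \<beta> by (simp add: c1_def add_pos_pos)
  have c2: "c2 > 0" using c1 by (simp add: c2_def)
  have \<alpha>: "\<alpha> > 0" "\<alpha> * (p - 2) \<le> 2" using \<beta> p by (auto simp: \<alpha>_def)
  \<comment> \<open>The growth factor of \<open>(2 ^ n) powr p / (2 ^ n)\<^sup>2\<close>, which is
    what remains of level^p after Chebyshev's inequality in L^2.\<close>
  define r where "r = 2 powr (p - 2)"
  have r: "r > 1" using p by (simp add: r_def)
  define K1 where "K1 = 4 * 2 powr p * (r * (2 * c2) powr (p - 2) / (r - 1))"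
  have K1: "K1 \<ge> 0" using r by (simp add: K1_def)
  define K where "K = torus_vol TYPE('d) + K1"
  \<comment> \<open>Frequencies up to \<open>A\<close> contribute at most
    \<open>c2 * A powr \<alpha>\<close> pointwise; this cutoff makes that bound half of the level
    \<open>2 ^ n\<close>.\<close>
  define A where "A n = (2 ^ n / (2 * c2)) powr (1 / \<alpha>)" for n :: nat
  have A: "A n > 0" "c2 * A n powr \<alpha> = 2 ^ n / 2" for n
    using c2 \<alpha> by (auto simp: A_def powr_powr)
  have "(\<integral>\<^sup>+x. ennreal (\<bar>w x\<bar> powr p) \<partial>tmeas) \<le> ennreal K" if w: "H1_fun w" "h1_norm_sq w \<le> 1" for w :: "real^'d \<Rightarrow> real"
  proof -
    let ?C = "count_space UNIV :: ('d \<Rightarrow> int) measure"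
    have ws: "square_int tmeas w" using w(1) by (simp add: H1_fun_iff)
    then have [measurable]: "w \<in> borel_measurable tmeas" by (simp add: square_int_def)
    define lo where "lo n x = (\<Sum>k\<in>lowset (A n). fcoeff w k * trig_basis k x)" for n x
    have lo_b: "\<bar>lo n x\<bar> \<le> 2 ^ n / 2" for n x
    proof -
      have "(\<Sum>k\<in>(lowset (A n) :: ('d \<Rightarrow> int) set). 1 / (freq k)\<^sup>2) \<le> c1 * A n powr (CARD('d) * (1 - \<beta>))"
        unfolding c1_def by (rule lowset_sum_le[OF \<beta> A(1)])
      from low_bound[OF w lowset_finite this, of x]
      have "\<bar>lo n x\<bar> \<le> 2 / sqrt (torus_vol TYPE('d)) * sqrt (c1 * A n powr (CARD('d) * (1 - \<beta>)))"
        by (simp add: lo_def)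
      also have "\<dots> = c2 * A n powr \<alpha>"
        using powr_half_sqrt[of "A n powr (CARD('d) * (1 - \<beta>))"]
        by (simp add: c2_def real_sqrt_mult \<alpha>_def powr_powr)
      finally show ?thesis by (simp add: A)
    qed
    have hs: "square_int tmeas (\<lambda>x. w x - lo n x)" for n
      unfolding lo_def by (intro square_int_diff ws sum_trig_basis_square_int)
    \<comment> \<open>Where |w| exceeds the level, the high-frequency part exceeds half of it, so
      Chebyshev's inequality and Parseval bound the contribution of the level by high frequencies
      alone.\<close>
    have lev: "(\<integral>\<^sup>+x. ennreal (if 2 ^ n < \<bar>w x\<bar> then (2 * 2 ^ n) powr p else 0) \<partial>tmeas)
       \<le> (\<integral>\<^sup>+k. ennreal (4 * 2 powr p * (if A n < freq k then r ^ n * (fcoeff w k)\<^sup>2 else 0)) \<partial>?C)" for n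
    proof -
      let ?q = "4 * (2 * 2 ^ n) powr p / (2 ^ n)\<^sup>2 :: real"
      have "(\<integral>\<^sup>+x. ennreal (if 2 ^ n < \<bar>w x\<bar> then (2 * 2 ^ n) powr p else 0) \<partial>tmeas)
         \<le> (\<integral>\<^sup>+x. ennreal (?q * (w x - lo n x)\<^sup>2) \<partial>tmeas)"
      proof (rule nn_integral_mono, rule ennreal_leI)
        fix x
        show "(if 2 ^ n < \<bar>w x\<bar> then (2 * 2 ^ n) powr p else 0) \<le> ?q * (w x - lo n x)\<^sup>2"
        proof (cases "2 ^ n < \<bar>w x\<bar>")
          case True
          then have "\<bar>2 ^ n / 2\<bar> \<le> \<bar>w x - lo n x\<bar>" using lo_b[of n x] by linarith
          then have "(2 ^ n / 2)\<^sup>2 \<le> (w x - lo n x)\<^sup>2" by (simp only: abs_le_square_iff)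
          then have "?q * (2 ^ n / 2)\<^sup>2 \<le> ?q * (w x - lo n x)\<^sup>2" by (intro mult_left_mono) auto
          then show ?thesis using True by (simp add: power_divide)
        qed simp
      qed
      also have "\<dots> = ennreal (LINT x|tmeas. ?q * (w x - lo n x)\<^sup>2)"
        by (rule nn_integral_eq_integral) (use square_int_integrable[OF hs] in auto)
      also have "(LINT x|tmeas. ?q * (w x - lo n x)\<^sup>2) = ?q * (LINT k|?C. (if k \<in> lowset (A n) then 0 else (fcoeff w k)\<^sup>2))"
        using high_norm[OF ws lowset_finite[of "A n"]] by (simp add: lo_def)
      also have "\<dots> = (LINT k|?C. 4 * 2 powr p * (if A n < freq k then r ^ n * (fcoeff w k)\<^sup>2 else 0))"
      proof -
        have "?q = 4 * 2 powr p * r ^ n"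
        proof -
          have "(2 * 2 ^ n) powr p = 2 powr p * (2 ^ n) powr p" by (simp add: powr_mult)
          moreover have "(2 ^ n :: real) powr p = r ^ n * (2 ^ n)\<^sup>2"
          proof -
            have "(2 ^ n :: real) powr p = 2 powr (real n * p)" by (simp add: powr_powr flip: powr_realpow)
            also have "\<dots> = 2 powr ((p - 2) * real n) * 2 powr (real n * 2)"
              by (simp add: algebra_simps flip: powr_add)
            also have "\<dots> = r ^ n * (2 ^ n)\<^sup>2"
              by (simp add: r_def powr_powr flip: powr_realpow)
            finally show ?thesis .
          qed
          ultimately show ?thesis by simp
        qed
        moreover have "(\<lambda>k. 4 * 2 powr p * (if A n < freq k then r ^ n * (fcoeff w k)\<^sup>2 else 0))
          = (\<lambda>k. 4 * 2 powr p * r ^ n * (if k \<in> lowset (A n) then 0 else (fcoeff w k)\<^sup>2))"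
          by (auto simp: lowset_def not_le fun_eq_iff)
        ultimately show ?thesis by (simp only: integral_mult_right_zero)
      qed
      also have "ennreal \<dots> = (\<integral>\<^sup>+k. ennreal (4 * 2 powr p * (if A n < freq k then r ^ n * (fcoeff w k)\<^sup>2 else 0)) \<partial>?C)"
      proof (rule nn_integral_eq_integral[symmetric])
        have "integrable ?C (\<lambda>k. 4 * 2 powr p * r ^ n * (fcoeff w k)\<^sup>2)"
          using fcoeff_square_int[OF ws] by (simp add: square_int_def)
        then show "integrable ?C (\<lambda>k. 4 * 2 powr p * (if A n < freq k then r ^ n * (fcoeff w k)\<^sup>2 else 0))"
          by (rule Bochner_Integration.integrable_bound) (use r in \<open>auto simp: abs_mult\<close>)
      qed (use r in auto)
      finally show ?thesis .
    qed
    \<comment> \<open>After exchanging the sums, a fixed \<open>k\<close> is charged only by the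
      levels with \<open>A n < freq k\<close>. This geometric sum is comparable to its largest term,
      of order freq^(\<alpha>(p-2)), which the hypothesis on p bounds by freq^2.\<close>
    have perk: "(\<Sum>n. ennreal (4 * 2 powr p * (if A n < freq k then r ^ n * (fcoeff w k)\<^sup>2 else 0))) \<le> ennreal (K1 * (freq k * fcoeff w k)\<^sup>2)" for k
    proof (rule suminf_le_const[OF summableI])
      fix N
      let ?Y = "(2 * c2 * freq k powr \<alpha>) powr (p - 2)"
      have Y: "?Y \<le> (2 * c2) powr (p - 2) * (freq k)\<^sup>2"
      proof -
        have "?Y = (2 * c2) powr (p - 2) * freq k powr (\<alpha> * (p - 2))"
          using c2 by (simp add: powr_mult powr_powr)
        also have "freq k powr (\<alpha> * (p - 2)) \<le> freq k powr 2"
          using \<alpha> freq_ge1 by (intro powr_mono) auto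
        also have "freq k powr 2 = (freq k)\<^sup>2" by (simp add: powr_numeral)
        finally show ?thesis using c2 by (simp add: mult_left_mono)
      qed
      have imp: "r ^ n < ?Y" if "A n < freq k" for n
      proof -
        have "A n powr \<alpha> < freq k powr \<alpha>" using that A(1)[of n] \<alpha> by (intro powr_less_mono2) auto
        then have "c2 * A n powr \<alpha> < c2 * freq k powr \<alpha>" using c2 by (rule mult_strict_left_mono)
        then have "2 ^ n < 2 * c2 * freq k powr \<alpha>" unfolding A(2) by simp
        then have "(2 ^ n) powr (p - 2) < ?Y" using p by (intro powr_less_mono2) auto
        moreover have "(2 ^ n :: real) powr (p - 2) = r ^ n"
          by (simp add: r_def powr_powr mult.commute flip: powr_realpow)
        ultimately show ?thesis by simp
      qed
      have "(\<Sum>n<N. ennreal (4 * 2 powr p * (if A n < freq k then r ^ n * (fcoeff w k)\<^sup>2 else 0)))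
        = ennreal (\<Sum>n<N. 4 * 2 powr p * (if A n < freq k then r ^ n * (fcoeff w k)\<^sup>2 else 0))"
        using r by (intro sum_ennreal) auto
      also have "\<dots> \<le> ennreal (\<Sum>n<N. 4 * 2 powr p * (fcoeff w k)\<^sup>2 * (if r ^ n < ?Y then r ^ n else 0))"
        using imp r by (intro ennreal_leI sum_mono) auto
      also have "\<dots> = ennreal (4 * 2 powr p * (fcoeff w k)\<^sup>2 * (\<Sum>n<N. if r ^ n < ?Y then r ^ n else 0))"
        by (simp add: sum_distrib_left)
      also have "\<dots> \<le> ennreal (4 * 2 powr p * (fcoeff w k)\<^sup>2 * (r * ?Y / (r - 1)))"
        by (intro ennreal_leI mult_left_mono geometric_truncated_sum r) auto
      also have "\<dots> \<le> ennreal (4 * 2 powr p * (fcoeff w k)\<^sup>2 * (r * ((2 * c2) powr (p - 2) * (freq k)\<^sup>2) / (r - 1)))"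
        using r by (intro ennreal_leI mult_left_mono divide_right_mono Y) auto
      also have "\<dots> = ennreal (K1 * (freq k * fcoeff w k)\<^sup>2)"
        by (simp add: K1_def power_mult_distrib ac_simps)
      finally show "(\<Sum>n<N. ennreal (4 * 2 powr p * (if A n < freq k then r ^ n * (fcoeff w k)\<^sup>2 else 0))) \<le> ennreal (K1 * (freq k * fcoeff w k)\<^sup>2)" .
    qed
    have "(\<integral>\<^sup>+x. ennreal (\<bar>w x\<bar> powr p) \<partial>tmeas)
      \<le> (\<integral>\<^sup>+x. 1 + (\<Sum>n. ennreal (if 2 ^ n < \<bar>w x\<bar> then (2 * 2 ^ n) powr p else 0)) \<partial>tmeas)"
      using p by (intro nn_integral_mono powr_dyadic_bound) auto
    also have "\<dots> = (\<integral>\<^sup>+x. 1 \<partial>(tmeas :: (real^'d) measure)) + (\<integral>\<^sup>+x. (\<Sum>n. ennreal (if 2 ^ n < \<bar>w x\<bar> then (2 * 2 ^ n) powr p else 0)) \<partial>tmeas)"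
      by (rule nn_integral_add) measurable
    also have "(\<integral>\<^sup>+x. (\<Sum>n. ennreal (if 2 ^ n < \<bar>w x\<bar> then (2 * 2 ^ n) powr p else 0)) \<partial>tmeas)
      = (\<Sum>n. \<integral>\<^sup>+x. ennreal (if 2 ^ n < \<bar>w x\<bar> then (2 * 2 ^ n) powr p else 0) \<partial>tmeas)"
      by (rule nn_integral_suminf) measurable
    also have "\<dots> \<le> (\<Sum>n. \<integral>\<^sup>+k. ennreal (4 * 2 powr p * (if A n < freq k then r ^ n * (fcoeff w k)\<^sup>2 else 0)) \<partial>?C)"
      by (intro suminf_le lev summableI)
    also have "\<dots> = (\<integral>\<^sup>+k. (\<Sum>n. ennreal (4 * 2 powr p * (if A n < freq k then r ^ n * (fcoeff w k)\<^sup>2 else 0))) \<partial>?C)"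
      by (rule nn_integral_suminf[symmetric]) simp
    also have "\<dots> \<le> (\<integral>\<^sup>+k. ennreal (K1 * (freq k * fcoeff w k)\<^sup>2) \<partial>?C)"
      by (intro nn_integral_mono perk)
    also have "\<dots> = ennreal (LINT k|?C. K1 * (freq k * fcoeff w k)\<^sup>2)"
      by (rule nn_integral_eq_integral) (use w(1) K1 in \<open>auto simp: H1_fun_iff square_int_def\<close>)
    also have "\<dots> \<le> ennreal (K1 * 1)"
      using w(2) K1 unfolding h1_norm_sq_def by (intro ennreal_leI) (simp add: mult_left_le)
    finally show ?thesis using K1 unfolding tmeas_space_finite by (simp add: K_def ennreal_plus)
  qed
  moreover have "K \<ge> 0" using K1 by (simp add: K_def)
  ultimately show ?thesis using that by blast
qed

section \<open>Bounded multiplication operators from H^1 to L^2\<close>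

definition multiplier :: "(real^'d::finite \<Rightarrow> real) \<Rightarrow> bool" where
  "multiplier c \<longleftrightarrow> c \<in> borel_measurable tmeas \<and>
     (\<exists>C. \<forall>w. H1_fun w \<longrightarrow> square_int tmeas (\<lambda>x. c x * w x) \<and> (LINT x|tmeas. (c x * w x)\<^sup>2) \<le> C * h1_norm_sq w)"

lemma H1_fun_scale:
  assumes "H1_fun w" shows "H1_fun (\<lambda>x. a * w x)" "h1_norm_sq (\<lambda>x. a * w x) = a\<^sup>2 * h1_norm_sq w"
proof -
  have e: "(\<lambda>k. freq k * (a * fcoeff w k)) = (\<lambda>k. a * (freq k * fcoeff w k))" by (simp add: mult.left_commute)
  show "H1_fun (\<lambda>x. a * w x)"
    using assms square_int_scale[of "count_space UNIV" "\<lambda>k. freq k * fcoeff w k" a]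
    by (simp add: H1_fun_iff fcoeff_scale square_int_scale e)
  show "h1_norm_sq (\<lambda>x. a * w x) = a\<^sup>2 * h1_norm_sq w"
  proof -
    have "(freq k * (a * fcoeff w k))\<^sup>2 = a\<^sup>2 * (freq k * fcoeff w k)\<^sup>2" for k
      by (simp add: power_mult_distrib)
    then show ?thesis by (simp add: h1_norm_sq_def fcoeff_scale)
  qed
qed

text \<open>Homogeneity reduces the claim to the unit ball; a function of norm zero cannot be
  normalised, but it vanishes almost everywhere.\<close>

lemma multiplierI:
  fixes c :: "real^'d::finite \<Rightarrow> real"
  assumes c: "c \<in> borel_measurable tmeas"
    and b: "\<And>w. H1_fun w \<Longrightarrow> h1_norm_sq w \<le> 1 \<Longrightarrow> square_int tmeas (\<lambda>x. c x * w x) \<and> (LINT x|tmeas. (c x * w x)\<^sup>2) \<le> C"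
  shows "multiplier c"
proof -
  have "square_int tmeas (\<lambda>x. c x * w x) \<and> (LINT x|tmeas. (c x * w x)\<^sup>2) \<le> C * h1_norm_sq w" if w: "H1_fun w" for w
  proof (cases "h1_norm_sq w = 0")
    case True
    have ws: "square_int tmeas w" using w by (simp add: H1_fun_iff)
    have "fcoeff w k = 0" for k
      using h1_norm_sq_finite[OF w, of "{k}"] True by simp
    then have "fcoeff w = fcoeff (\<lambda>x. 0)" by (intro ext) simp
    then have "fcoeffs w = fcoeffs (\<lambda>x. 0)" by (simp add: fcoeffs_def)
    then have z: "AE x in tmeas. w x = 0" using fcoeffs_eq_iff[OF ws, of "\<lambda>x. 0"] by simp
    have "square_int tmeas (\<lambda>x. c x * w x)"
    proof (rule square_int_bound[OF square_int_zero])
      show "(\<lambda>x. c x * w x) \<in> borel_measurable tmeas" using c ws by (auto simp: square_int_def)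
      show "AE x in tmeas. \<bar>c x * w x\<bar> \<le> \<bar>0\<bar>" using z by eventually_elim simp
    qed
    moreover have "(LINT x|tmeas. (c x * w x)\<^sup>2) = 0"
      by (rule integral_eq_zero_AE) (use z in \<open>eventually_elim, simp\<close>)
    ultimately show ?thesis using True by simp
  next
    case False
    have "h1_norm_sq w \<ge> 0" by (simp add: h1_norm_sq_def)
    then have h: "h1_norm_sq w > 0" using False by simp
    define a where "a = 1 / sqrt (h1_norm_sq w)"
    have a: "a \<noteq> 0" "a\<^sup>2 * h1_norm_sq w = 1" using h by (simp_all add: a_def power_divide)
    have B: "square_int tmeas (\<lambda>x. c x * (a * w x))" "(LINT x|tmeas. (c x * (a * w x))\<^sup>2) \<le> C"
      using b[OF H1_fun_scale(1)[OF w]] a by (auto simp: H1_fun_scale(2)[OF w])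
    have "square_int tmeas (\<lambda>x. (1 / a) * (c x * (a * w x)))" by (rule square_int_scale[OF B(1)])
    then have 1: "square_int tmeas (\<lambda>x. c x * w x)" using a by (simp add: mult.left_commute)
    have "(LINT x|tmeas. (c x * (a * w x))\<^sup>2) = a\<^sup>2 * (LINT x|tmeas. (c x * w x)\<^sup>2)"
      by (simp add: power_mult_distrib mult.left_commute flip: integral_mult_right_zero)
    then have "a\<^sup>2 * (LINT x|tmeas. (c x * w x)\<^sup>2) \<le> C" using B by simp
    then have "h1_norm_sq w * (a\<^sup>2 * (LINT x|tmeas. (c x * w x)\<^sup>2)) \<le> h1_norm_sq w * C"
      using h by (intro mult_left_mono) auto
    also have "h1_norm_sq w * (a\<^sup>2 * (LINT x|tmeas. (c x * w x)\<^sup>2)) = (a\<^sup>2 * h1_norm_sq w) * (LINT x|tmeas. (c x * w x)\<^sup>2)"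
      by (simp add: mult_ac)
    finally show ?thesis using 1 a by (simp add: mult.commute)
  qed
  then show ?thesis using c unfolding multiplier_def by blast
qed

lemma multiplier_bounded:
  fixes c :: "real^'d::finite \<Rightarrow> real"
  assumes c: "c \<in> borel_measurable tmeas" "\<And>x. x \<in> Qcube \<Longrightarrow> \<bar>c x\<bar> \<le> B"
  shows "multiplier c"
proof (rule multiplierI[OF c(1)])
  fix w :: "real^'d \<Rightarrow> real" assume w: "H1_fun w" "h1_norm_sq w \<le> 1"
  have ws: "square_int tmeas w" using w by (simp add: H1_fun_iff)
  have sp: "space tmeas = (Qcube :: (real^'d) set)" by simp
  have 1: "square_int tmeas (\<lambda>x. c x * w x)"
    using c(2) by (intro square_int_bounded_mult[OF ws c(1)] AE_I2) simp
  have "(LINT x|tmeas. (c x * w x)\<^sup>2) \<le> (LINT x|tmeas. B\<^sup>2 * (w x)\<^sup>2)"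
  proof (rule integral_mono)
    fix x :: "real^'d" assume "x \<in> space tmeas"
    then have "\<bar>c x\<bar> \<le> \<bar>B\<bar>" using c(2)[of x] by simp
    then have "(c x)\<^sup>2 \<le> B\<^sup>2" by (simp only: abs_le_square_iff)
    then show "(c x * w x)\<^sup>2 \<le> B\<^sup>2 * (w x)\<^sup>2" by (simp add: power_mult_distrib mult_right_mono)
  qed (use 1 ws in \<open>auto simp: square_int_def\<close>)
  also have "\<dots> = B\<^sup>2 * (norm (fcoeffs w))\<^sup>2" by (simp add: Parseval_norm[OF ws])
  also have "\<dots> \<le> B\<^sup>2 * 1"
  proof (rule mult_left_mono)
    have "(norm (fcoeffs w))\<^sup>2 \<le> h1_norm_sq w"
      unfolding h1_norm_sq_def l2_norm_sq l2c_fcoeffs[OF ws]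
    proof (rule integral_mono)
      show "(fcoeff w k)\<^sup>2 \<le> (freq k * fcoeff w k)\<^sup>2" for k
        using freq_ge1[of k] by (simp add: power_mult_distrib mult_le_cancel_right1 one_le_power)
    qed (use w fcoeff_square_int[OF ws] in \<open>auto simp: H1_fun_iff square_int_def\<close>)
    then show "(norm (fcoeffs w))\<^sup>2 \<le> 1" using w by simp
  qed simp
  finally show "square_int tmeas (\<lambda>x. c x * w x) \<and> (LINT x|tmeas. (c x * w x)\<^sup>2) \<le> B\<^sup>2"
    using 1 by simp
qed

lemma multiplier_add:
  assumes "multiplier c" "multiplier c'"
  shows "multiplier (\<lambda>x. c x + c' x)"
proof -
  obtain C where C: "\<And>w. H1_fun w \<Longrightarrow> square_int tmeas (\<lambda>x. c x * w x) \<and> (LINT x|tmeas. (c x * w x)\<^sup>2) \<le> C * h1_norm_sq w"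
    using assms(1) by (auto simp: multiplier_def)
  obtain C' where C': "\<And>w. H1_fun w \<Longrightarrow> square_int tmeas (\<lambda>x. c' x * w x) \<and> (LINT x|tmeas. (c' x * w x)\<^sup>2) \<le> C' * h1_norm_sq w"
    using assms(2) by (auto simp: multiplier_def)
  have "square_int tmeas (\<lambda>x. (c x + c' x) * w x) \<and> (LINT x|tmeas. ((c x + c' x) * w x)\<^sup>2) \<le> (2 * C + 2 * C') * h1_norm_sq w"
    if "H1_fun w" for w
    using C[OF that] C'[OF that] square_int_add[of tmeas "\<lambda>x. c x * w x" "\<lambda>x. c' x * w x"]
      square_int_triangle[of tmeas "\<lambda>x. c x * w x" "\<lambda>x. c' x * w x"]
    by (simp add: distrib_right)
  then show ?thesis
    using assms by (auto simp: multiplier_def)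
qed

lemma multiplier_scale:
  assumes "multiplier c" shows "multiplier (\<lambda>x. a * c x)"
proof -
  obtain C where C: "\<And>w. H1_fun w \<Longrightarrow> square_int tmeas (\<lambda>x. c x * w x) \<and> (LINT x|tmeas. (c x * w x)\<^sup>2) \<le> C * h1_norm_sq w"
    using assms by (auto simp: multiplier_def)
  have "square_int tmeas (\<lambda>x. a * c x * w x) \<and> (LINT x|tmeas. (a * c x * w x)\<^sup>2) \<le> a\<^sup>2 * C * h1_norm_sq w" if "H1_fun w" for w
  proof -
    have "square_int tmeas (\<lambda>x. a * (c x * w x))" using C[OF that] by (intro square_int_scale) auto
    moreover have "(LINT x|tmeas. (a * (c x * w x))\<^sup>2) = a\<^sup>2 * (LINT x|tmeas. (c x * w x)\<^sup>2)"
      unfolding power_mult_distrib[of a] by (rule integral_mult_right_zero)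
    moreover have "a\<^sup>2 * (LINT x|tmeas. (c x * w x)\<^sup>2) \<le> a\<^sup>2 * (C * h1_norm_sq w)"
      using C[OF that] by (intro mult_left_mono) auto
    ultimately show ?thesis by (simp only: mult.assoc)
  qed
  moreover have "(\<lambda>x. a * c x) \<in> borel_measurable tmeas" using assms by (auto simp: multiplier_def)
  ultimately show ?thesis unfolding multiplier_def by blast
qed

lemma powr_abs_two: "\<bar>t\<bar> powr 2 = t\<^sup>2" for t :: real
  by (cases "t = 0") (simp_all add: powr_numeral)

text \<open>Young's inequality with exponents \<rho>/2 and \<rho>/(\<rho>-2) splits the squared
  product into |V|^\<rho> and |w|^p with p = 2\<rho>/(\<rho>-2). For \<rho> = d this p is the
  critical Sobolev exponent.\<close>

lemma multiplier_Lp: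
  fixes V :: "real^'d::finite \<Rightarrow> real" and \<rho> \<beta> :: real
  assumes V: "Lp_fun \<rho> V" and \<rho>: "CARD('d) \<ge> 2" "\<rho> > 2"
    and \<beta>: "0 < \<beta>" "\<beta> < 1" "\<beta> * CARD('d) \<le> 2" "CARD('d) * (1 - \<beta>) \<le> \<rho> - 2"
  shows "multiplier V"
proof -
  define p where "p = 2 * \<rho> / (\<rho> - 2)"
  have p: "p > 2" "p - 2 = 4 / (\<rho> - 2)" using \<rho> by (simp_all add: p_def field_simps)
  have "CARD('d) * (1 - \<beta>) / 2 * (p - 2) = 2 * (CARD('d) * (1 - \<beta>) / (\<rho> - 2))" by (simp add: p)
  also have "\<dots> \<le> 2 * 1" using \<beta>(4) \<rho> by (intro mult_left_mono) (auto simp: divide_le_eq)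
  finally obtain K where K: "K \<ge> 0"
    "\<And>w :: real^'d \<Rightarrow> real. H1_fun w \<Longrightarrow> h1_norm_sq w \<le> 1 \<Longrightarrow> (\<integral>\<^sup>+x. ennreal (\<bar>w x\<bar> powr p) \<partial>tmeas) \<le> ennreal K"
    using Sobolev_embedding[OF \<beta>(1-3) p(1)] by auto
  have Vm[measurable]: "V \<in> borel_measurable tmeas" and Vi: "integrable tmeas (\<lambda>x. \<bar>V x\<bar> powr \<rho>)"
    using V by (auto simp: Lp_fun_def)
  let ?I = "LINT x|tmeas. \<bar>V x\<bar> powr \<rho>"
  have I0: "?I \<ge> 0" by simp
  show ?thesis
  proof (rule multiplierI[OF Vm])
    fix w :: "real^'d \<Rightarrow> real" assume w: "H1_fun w" "h1_norm_sq w \<le> 1"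
    then have [measurable]: "w \<in> borel_measurable tmeas" by (simp add: H1_fun_iff square_int_def)
    have Y: "(V x * w x)\<^sup>2 \<le> \<bar>V x\<bar> powr \<rho> + \<bar>w x\<bar> powr p" for x
    proof -
      note sq = powr_abs_two[symmetric]
      have "(V x)\<^sup>2 * (w x)\<^sup>2 \<le> ((V x)\<^sup>2) powr (\<rho> / 2) / (\<rho> / 2) + ((w x)\<^sup>2) powr (\<rho> / (\<rho> - 2)) / (\<rho> / (\<rho> - 2))"
        using \<rho> by (intro Youngs_inequality) (auto simp: field_simps)
      also have "((V x)\<^sup>2) powr (\<rho> / 2) = \<bar>V x\<bar> powr \<rho>" unfolding sq powr_powr by simp
      also have "((w x)\<^sup>2) powr (\<rho> / (\<rho> - 2)) = \<bar>w x\<bar> powr p" unfolding sq powr_powr p_def by simp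
      also have "\<bar>V x\<bar> powr \<rho> / (\<rho> / 2) + \<bar>w x\<bar> powr p / (\<rho> / (\<rho> - 2)) \<le> \<bar>V x\<bar> powr \<rho> / 1 + \<bar>w x\<bar> powr p / 1"
        using \<rho> by (intro add_mono divide_left_mono) auto
      finally show ?thesis by (simp add: power_mult_distrib)
    qed
    have "(\<integral>\<^sup>+x. ennreal ((V x * w x)\<^sup>2) \<partial>tmeas) \<le> (\<integral>\<^sup>+x. ennreal (\<bar>V x\<bar> powr \<rho>) + ennreal (\<bar>w x\<bar> powr p) \<partial>tmeas)"
      using Y by (intro nn_integral_mono) (simp add: ennreal_leI flip: ennreal_plus)
    also have "\<dots> = (\<integral>\<^sup>+x. ennreal (\<bar>V x\<bar> powr \<rho>) \<partial>tmeas) + (\<integral>\<^sup>+x. ennreal (\<bar>w x\<bar> powr p) \<partial>tmeas)"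
      by (rule nn_integral_add) measurable
    also have "(\<integral>\<^sup>+x. ennreal (\<bar>V x\<bar> powr \<rho>) \<partial>tmeas) = ennreal ?I"
      by (rule nn_integral_eq_integral[OF Vi]) simp
    also have "ennreal ?I + (\<integral>\<^sup>+x. ennreal (\<bar>w x\<bar> powr p) \<partial>tmeas) \<le> ennreal ?I + ennreal K"
      by (intro add_left_mono K w)
    also have "\<dots> = ennreal (?I + K)" using I0 K by (simp add: ennreal_plus)
    finally have le: "(\<integral>\<^sup>+x. ennreal ((V x * w x)\<^sup>2) \<partial>tmeas) \<le> ennreal (?I + K)" .
    have int: "integrable tmeas (\<lambda>x. (V x * w x)\<^sup>2)"
      by (intro integrableI_nonneg) (auto intro: le_less_trans[OF le])
    moreover have "ennreal (LINT x|tmeas. (V x * w x)\<^sup>2) \<le> ennreal (?I + K)"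
      using nn_integral_eq_integral[OF int] le by simp
    then have "(LINT x|tmeas. (V x * w x)\<^sup>2) \<le> ?I + K"
      by (subst (asm) ennreal_le_iff) (use I0 K in auto)
    ultimately show "square_int tmeas (\<lambda>x. V x * w x) \<and> (LINT x|tmeas. (V x * w x)\<^sup>2) \<le> ?I + K"
      by (simp add: square_int_def)
  qed
qed

text \<open>In dimension one the sum of freq^-2 converges, so the Fourier partial sums are bounded
  uniformly. The bound passes to \<open>w\<close> through L^2 convergence.\<close>

lemma Sobolev_bounded_1D:
  fixes w :: "real^'d::finite \<Rightarrow> real"
  assumes d: "CARD('d) = 1" and w: "H1_fun w" "h1_norm_sq w \<le> 1"
  shows "AE x in tmeas. \<bar>w x\<bar> \<le> 2 / sqrt (torus_vol TYPE('d)) * sqrt 5"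
proof -
  let ?c = "2 / sqrt (torus_vol TYPE('d)) * sqrt 5"
  have c0: "?c \<ge> 0" by simp
  have ws: "square_int tmeas w" using w by (simp add: H1_fun_iff)
  then have [measurable]: "w \<in> borel_measurable tmeas" by (simp add: square_int_def)
  define lo where "lo n x = (\<Sum>k\<in>kbox n. fcoeff w k * trig_basis k x)" for n x
  have lo_b: "\<bar>lo n x\<bar> \<le> ?c" for n x
    unfolding lo_def
  proof (rule low_bound[OF w kbox_finite])
    have "(\<Sum>k\<in>(kbox n :: ('d \<Rightarrow> int) set). 1 / (freq k)\<^sup>2) \<le> lsum 2 n ^ CARD('d)"
      by (rule sum_kbox_le) (auto simp: d)
    also have "\<dots> \<le> 5" using lsum_2_le[of n] by (simp add: d) (smt (verit) divide_nonneg_nonneg of_nat_0_le_iff)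
    finally show "(\<Sum>k\<in>(kbox n :: ('d \<Rightarrow> int) set). 1 / (freq k)\<^sup>2) \<le> 5" .
  qed
  have hs: "square_int tmeas (\<lambda>x. w x - lo n x)" for n
    unfolding lo_def by (intro square_int_diff ws sum_trig_basis_square_int)
  \<comment> \<open>The squared excess of |w| over the bound. It is dominated by the squared
    distance to every partial sum, so its integral is zero.\<close>
  define g where "g x = (max 0 (\<bar>w x\<bar> - ?c))\<^sup>2" for x
  have gle: "g x \<le> (w x - lo n x)\<^sup>2" for n x
  proof -
    have "\<bar>max 0 (\<bar>w x\<bar> - ?c)\<bar> \<le> \<bar>w x - lo n x\<bar>" using lo_b[of n x] by linarith
    then show ?thesis unfolding g_def by (simp only: abs_le_square_iff)
  qed
  have gm[measurable]: "g \<in> borel_measurable tmeas" unfolding g_def[abs_def] by measurable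
  have g0: "g x \<ge> 0" for x by (simp add: g_def)
  have gi: "integrable tmeas g"
    by (rule Bochner_Integration.integrable_bound[OF square_int_integrable[OF hs[of 0]]])
      (use gle[of _ 0] g0 in auto)
  have "(LINT x|tmeas. g x) \<le> (LINT k|count_space UNIV. (if k \<in> kbox n then 0 else (fcoeff w k)\<^sup>2))" for n
  proof -
    have "(LINT x|tmeas. g x) \<le> (LINT x|tmeas. (w x - lo n x)\<^sup>2)"
      using gi square_int_integrable[OF hs] gle by (intro integral_mono) auto
    then show ?thesis using high_norm[OF ws kbox_finite[of n]] by (simp add: lo_def)
  qed
  moreover have "(\<lambda>n. LINT k|count_space UNIV. (if k \<in> kbox n then 0 else (fcoeff w k)\<^sup>2)) \<longlonglongrightarrow> integral\<^sup>L (count_space (UNIV :: ('d \<Rightarrow> int) set)) (\<lambda>k. 0)"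
  proof (rule Bochner_Integration.integral_dominated_convergence[where w="\<lambda>k. (fcoeff w k)\<^sup>2"])
    show "AE k in count_space UNIV. (\<lambda>n. if k \<in> kbox n then 0 else (fcoeff w k)\<^sup>2) \<longlonglongrightarrow> 0"
    proof (rule AE_I2)
      fix k
      show "(\<lambda>n. if k \<in> kbox n then 0 else (fcoeff w k)\<^sup>2) \<longlonglongrightarrow> 0"
        using kbox_ev[of k] by (intro tendsto_eventually) (auto simp: eventually_sequentially)
    qed
  qed (use fcoeff_square_int[OF ws] in \<open>auto simp: square_int_def\<close>)
  ultimately have "(LINT x|tmeas. g x) \<le> 0"
    by (intro LIMSEQ_le_const) auto
  moreover have "(LINT x|tmeas. g x) \<ge> 0" using g0 by simp
  ultimately have "(LINT x|tmeas. g x) = 0" by simp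
  then have "AE x in tmeas. g x = 0" using gi g0 by (subst (asm) integral_nonneg_eq_0_iff_AE) auto
  then show ?thesis by eventually_elim (auto simp: g_def max_def split: if_splits)
qed

text \<open>The only place where the integrability of \<open>V\<close> enters; afterwards
  \<open>V\<close> is used as a bounded multiplier.\<close>

lemma multiplier_potential:
  fixes V :: "real^'d::finite \<Rightarrow> real" and \<rho> :: real
  assumes rho: "(CARD('d) = 1 \<longrightarrow> \<rho> = 2) \<and> (CARD('d) = 2 \<longrightarrow> \<rho> > 2) \<and> (CARD('d) \<ge> 3 \<longrightarrow> \<rho> = real CARD('d))"
    and V: "Lp_fun \<rho> V"
  shows "multiplier V"
proof -
  have "CARD('d) > 0" by simp
  then consider "CARD('d) = 1" | "CARD('d) = 2" | "CARD('d) \<ge> 3" by linarith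
  then show ?thesis
  proof cases
    case 1
    have Vm: "V \<in> borel_measurable tmeas" and Vi: "integrable tmeas (\<lambda>x. (V x)\<^sup>2)"
    proof -
      show "V \<in> borel_measurable tmeas" "integrable tmeas (\<lambda>x. (V x)\<^sup>2)"
        using V rho 1 by (auto simp: Lp_fun_def powr_abs_two)
    qed
    let ?c = "2 / sqrt (torus_vol TYPE('d)) * sqrt 5"
    show ?thesis
    proof (rule multiplierI[OF Vm])
      fix w :: "real^'d \<Rightarrow> real" assume w: "H1_fun w" "h1_norm_sq w \<le> 1"
      have wm: "w \<in> borel_measurable tmeas" using w by (simp add: H1_fun_iff square_int_def)
      have b: "AE x in tmeas. \<bar>w x\<bar> \<le> ?c" by (rule Sobolev_bounded_1D[OF 1 w])
      have Vs: "square_int tmeas V" using Vm Vi by (simp add: square_int_def)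
      have s: "square_int tmeas (\<lambda>x. V x * w x)"
        using square_int_bounded_mult[OF Vs wm b] by (simp add: mult.commute)
      have "(LINT x|tmeas. (V x * w x)\<^sup>2) \<le> (LINT x|tmeas. ?c\<^sup>2 * (V x)\<^sup>2)"
      proof (rule integral_mono_AE)
        show "AE x in tmeas. (V x * w x)\<^sup>2 \<le> ?c\<^sup>2 * (V x)\<^sup>2"
          using b
        proof eventually_elim
          case (elim x)
          then have "\<bar>w x\<bar> \<le> \<bar>?c\<bar>" by linarith
          then have "(w x)\<^sup>2 \<le> ?c\<^sup>2" by (simp only: abs_le_square_iff)
          then have "(w x)\<^sup>2 * (V x)\<^sup>2 \<le> ?c\<^sup>2 * (V x)\<^sup>2" by (rule mult_right_mono) simp
          then show ?case by (simp add: power_mult_distrib mult.commute)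
        qed
      qed (use s Vi in \<open>auto simp: square_int_def\<close>)
      then show "square_int tmeas (\<lambda>x. V x * w x) \<and> (LINT x|tmeas. (V x * w x)\<^sup>2) \<le> (LINT x|tmeas. ?c\<^sup>2 * (V x)\<^sup>2)"
        using s by simp
    qed
  next
    case 2
    \<comment> \<open>In dimension two the condition is 2(1-\<beta>) \<le> \<rho>-2, which pushes
      \<beta> towards 1 as \<rho> approaches 2; the value 1/2 keeps \<beta> positive for large
      \<rho>.\<close>
    define \<beta> where "\<beta> = max (1/2) (1 - (\<rho> - 2) / 2)"
    have "0 < \<beta>" "\<beta> < 1" "\<beta> * CARD('d) \<le> 2" "CARD('d) * (1 - \<beta>) \<le> \<rho> - 2"
      using rho 2 by (auto simp: \<beta>_def max_def field_simps)
    then show ?thesis using rho 2 by (intro multiplier_Lp[OF V]) auto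
  next
    case 3
    \<comment> \<open>The two constraints d\<beta> \<le> 2 and d(1-\<beta>) \<le> d-2 leave exactly
      this value.\<close>
    define \<beta> where "\<beta> = 2 / CARD('d)"
    have "0 < \<beta>" "\<beta> < 1" "\<beta> * CARD('d) \<le> 2" "CARD('d) * (1 - \<beta>) \<le> \<rho> - 2"
      using rho 3 by (auto simp: \<beta>_def field_simps)
    then show ?thesis using rho 3 by (intro multiplier_Lp[OF V]) auto
  qed
qed

subsection \<open>The wave group in coefficients\<close>

lemma norm_diag_op_le:
  assumes "\<And>k. \<bar>m k\<bar> \<le> C" "C \<ge> 0" shows "norm (diag_op m x) \<le> C * norm x"
  using assms(2) by (intro l2_norm_mono) (auto simp: l2c_diag_op[OF assms(1)] abs_mult intro!: mult_right_mono assms(1))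

lemma diag_op_tendsto:
  assumes "\<And>n k. \<bar>m n k\<bar> \<le> 1" "\<And>k. \<bar>m' k\<bar> \<le> 1" "\<And>k. (\<lambda>n. m n k) \<longlonglongrightarrow> m' k"
  shows "(\<lambda>n. diag_op (m n) x) \<longlonglongrightarrow> diag_op m' x"
proof (rule l2_dominated[where g="2 *\<^sub>R x"])
  show "(\<lambda>n. l2c (diag_op (m n) x) k) \<longlonglongrightarrow> l2c (diag_op m' x) k" for k
    by (simp add: l2c_diag_op[OF assms(1)] l2c_diag_op[OF assms(2)]) (intro tendsto_intros assms)
  show "\<bar>l2c (diag_op (m n) x) k - l2c (diag_op m' x) k\<bar> \<le> \<bar>l2c (2 *\<^sub>R x) k\<bar>" for n k
  proof -
    have "\<bar>m n k - m' k\<bar> \<le> 2" using assms(1)[of n k] assms(2)[of k] by linarith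
    then have "\<bar>m n k - m' k\<bar> * \<bar>l2c x k\<bar> \<le> 2 * \<bar>l2c x k\<bar>" by (intro mult_right_mono) auto
    then show ?thesis
      by (simp add: l2c_diag_op[OF assms(1)] l2c_diag_op[OF assms(2)] abs_mult flip: left_diff_distrib)
  qed
qed

text \<open>With the first coordinate weighted by \<open>freq\<close>, the equation of mode
  \<open>k\<close> becomes a' = freq b, b' = -freq a, a rotation with angular velocity
  \<open>freq k\<close>.\<close>

definition wave_rot :: "real \<Rightarrow> 'd::finite energy \<Rightarrow> 'd energy" where
  "wave_rot t U = (diag_op (\<lambda>k. cos (freq k * t)) (fst U) + diag_op (\<lambda>k. sin (freq k * t)) (snd U),
             diag_op (\<lambda>k. cos (freq k * t)) (snd U) - diag_op (\<lambda>k. sin (freq k * t)) (fst U))"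

lemmas l2c_diag_op_cos = l2c_diag_op[where m="\<lambda>k. cos (freq k * t)" for t, OF abs_cos_le_one]
lemmas l2c_diag_op_sin = l2c_diag_op[where m="\<lambda>k. sin (freq k * t)" for t, OF abs_sin_le_one]

lemma l2c_wave_rot:
  "l2c (fst (wave_rot t U)) k = cos (freq k * t) * l2c (fst U) k + sin (freq k * t) * l2c (snd U) k"
  "l2c (snd (wave_rot t U)) k = cos (freq k * t) * l2c (snd U) k - sin (freq k * t) * l2c (fst U) k"
  by (simp_all add: wave_rot_def l2c_diag_op_cos l2c_diag_op_sin)

lemma energy_eqI:
  assumes "\<And>k. l2c (fst U) k = l2c (fst V) k" "\<And>k. l2c (snd U) k = l2c (snd V) k"
  shows "U = (V :: 'd::finite energy)"
  using assms by (intro prod_eqI l2_eqI) auto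

lemma wave_rot_0[simp]: "wave_rot 0 U = U"
  by (rule energy_eqI) (simp_all add: l2c_wave_rot)

lemma wave_rot_add: "wave_rot (s + t) U = wave_rot s (wave_rot t U)"
  by (rule energy_eqI) (simp_all add: l2c_wave_rot distrib_left cos_add sin_add algebra_simps)

lemma wave_rot_linear: "linear (wave_rot t)"
  by (rule linearI; rule energy_eqI) (simp_all add: l2c_wave_rot algebra_simps)

lemma norm_energy_sq:
  "(norm (U :: 'd::finite energy))\<^sup>2 = (LINT k|count_space UNIV. (l2c (fst U) k)\<^sup>2 + (l2c (snd U) k)\<^sup>2)"
proof -
  have "(norm U)\<^sup>2 = (norm (fst U))\<^sup>2 + (norm (snd U))\<^sup>2" by (simp add: norm_prod_def)
  then show ?thesis
    using square_int_integrable[OF l2c_square_int[of "fst U"]] square_int_integrable[OF l2c_square_int[of "snd U"]]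
    by (simp add: l2_norm_sq)
qed

lemma norm_wave_rot[simp]: "norm (wave_rot t U) = norm U"
proof -
  have "(cos x * a + sin x * b)\<^sup>2 + (cos x * b - sin x * a)\<^sup>2 = a\<^sup>2 + b\<^sup>2" for x a b :: real
  proof -
    have "(cos x * a + sin x * b)\<^sup>2 + (cos x * b - sin x * a)\<^sup>2 = ((cos x)\<^sup>2 + (sin x)\<^sup>2) * (a\<^sup>2 + b\<^sup>2)"
      by algebra
    then show ?thesis unfolding sin_cos_squared_add2 by simp
  qed
  then have "(norm (wave_rot t U))\<^sup>2 = (norm U)\<^sup>2"
    unfolding norm_energy_sq l2c_wave_rot by simp
  then show ?thesis by (metis norm_ge_zero power2_eq_imp_eq)
qed

lemma wave_rot_bounded_linear: "bounded_linear (wave_rot t)"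
  by (rule bounded_linear_intro[where K=1])
    (simp_all only: linear_add[OF wave_rot_linear] linear_scale[OF wave_rot_linear] norm_wave_rot mult_1_right order_refl)

lemmas wave_rot_simps = linear_simps[OF wave_rot_bounded_linear]

lemma wave_rot_isCont: "isCont (\<lambda>t. wave_rot t U) t0"
  unfolding continuous_at_sequentially o_def
proof (intro allI impI)
  fix X assume X: "X \<longlonglongrightarrow> t0"
  have c: "(\<lambda>n. diag_op (\<lambda>k. cos (freq k * X n)) x) \<longlonglongrightarrow> diag_op (\<lambda>k. cos (freq k * t0)) x" for x :: "('a \<Rightarrow> int) l2"
    by (rule diag_op_tendsto) (auto intro!: tendsto_intros X)
  have s: "(\<lambda>n. diag_op (\<lambda>k. sin (freq k * X n)) x) \<longlonglongrightarrow> diag_op (\<lambda>k. sin (freq k * t0)) x" for x :: "('a \<Rightarrow> int) l2"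
    by (rule diag_op_tendsto) (auto intro!: tendsto_intros X)
  show "(\<lambda>n. wave_rot (X n) U) \<longlonglongrightarrow> wave_rot t0 U"
    unfolding wave_rot_def by (intro tendsto_intros c s)
qed

text \<open>Strong continuity handles the varying time at a fixed state, and the isometry property
  handles the varying state uniformly in time.\<close>

lemma continuous_on_wave_rot:
  fixes f :: "'x::metric_space \<Rightarrow> real" and g :: "'x \<Rightarrow> 'd::finite energy"
  assumes f: "continuous_on S f" and g: "continuous_on S g"
  shows "continuous_on S (\<lambda>s. wave_rot (f s) (g s))"
  unfolding continuous_on_def
proof
  fix x assume x: "x \<in> S"
  have "((\<lambda>s. wave_rot (f s) (g x)) \<longlongrightarrow> wave_rot (f x) (g x)) (at x within S)"
    by (rule isCont_tendsto_compose[OF wave_rot_isCont]) (use f x in \<open>auto simp: continuous_on_def\<close>)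
  moreover have "((\<lambda>s. wave_rot (f s) (g s) - wave_rot (f s) (g x)) \<longlongrightarrow> 0) (at x within S)"
  proof (rule tendsto_norm_zero_cancel)
    have "((\<lambda>s. norm (g s - g x)) \<longlongrightarrow> norm (g x - g x)) (at x within S)"
      using g x by (intro tendsto_intros) (auto simp: continuous_on_def)
    then show "((\<lambda>s. norm (wave_rot (f s) (g s) - wave_rot (f s) (g x))) \<longlongrightarrow> 0) (at x within S)"
      by (simp flip: wave_rot_simps(2))
  qed
  ultimately have "((\<lambda>s. (wave_rot (f s) (g s) - wave_rot (f s) (g x)) + wave_rot (f s) (g x)) \<longlongrightarrow> 0 + wave_rot (f x) (g x)) (at x within S)"
    by (intro tendsto_add)
  then show "((\<lambda>s. wave_rot (f s) (g s)) \<longlongrightarrow> wave_rot (f x) (g x)) (at x within S)" by simp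
qed

text \<open>The coordinate form of H^2 x H^1: the first coordinate already carries one factor
  \<open>freq\<close>.\<close>

definition energy_dom :: "'d::finite energy \<Rightarrow> bool" where
  "energy_dom U \<longleftrightarrow> square_int (count_space UNIV) (\<lambda>k. freq k * l2c (fst U) k) \<and> square_int (count_space UNIV) (\<lambda>k. freq k * l2c (snd U) k)"

definition energy_gen :: "'d::finite energy \<Rightarrow> 'd energy" where
  "energy_gen U = (Abs_l2 (\<lambda>k. freq k * l2c (snd U) k), Abs_l2 (\<lambda>k. - (freq k * l2c (fst U) k)))"

lemma l2c_energy_gen:
  assumes "energy_dom U"
  shows "l2c (fst (energy_gen U)) k = freq k * l2c (snd U) k" "l2c (snd (energy_gen U)) k = - (freq k * l2c (fst U) k)"
  using assms by (auto simp: energy_gen_def energy_dom_def l2c_Abs square_int_uminus)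

lemma abs_cos_diff_le: "\<bar>cos x - 1\<bar> \<le> \<bar>x\<bar>" for x :: real
proof -
  have "\<bar>cos x - cos 0\<bar> \<le> 1 * \<bar>x - 0\<bar>"
  proof (rule field_differentiable_bound[where S=UNIV and f'="\<lambda>x. - sin x" and 'a=real, unfolded real_norm_def])
    show "(cos has_field_derivative - sin z) (at z within UNIV)" for z :: real
      by (auto intro!: derivative_eq_intros)
    show "\<bar>- sin z\<bar> \<le> 1" for z :: real by simp
  qed auto
  then show ?thesis by simp
qed

text \<open>Expressed through the generator, the difference quotient has the factors (cos x - 1)/x
  and (sin x)/x with x = freq h. They are bounded by 1 for all frequencies and converge for each, so
  dominated convergence applies.\<close>

lemma wave_rot_derivative:
  assumes U: "energy_dom U"
  shows "((\<lambda>h. (1 / h) *\<^sub>R (wave_rot h U - U)) \<longlongrightarrow> energy_gen U) (at 0)"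
  unfolding tendsto_at_iff_sequentially o_def
proof (intro allI impI)
  fix h :: "nat \<Rightarrow> real" assume h: "\<forall>i. h i \<in> UNIV - {0}" "h \<longlonglongrightarrow> 0"
  then have h0: "h n \<noteq> 0" for n by simp
  let ?B = "fst (energy_gen U)" and ?A = "snd (energy_gen U)"
  define cm where "cm n k = (cos (freq k * h n) - 1) / (freq k * h n)" for n and k :: "'a \<Rightarrow> int"
  define sm where "sm n k = sin (freq k * h n) / (freq k * h n)" for n and k :: "'a \<Rightarrow> int"
  have cb: "\<bar>cm n k\<bar> \<le> 1" and sb: "\<bar>sm n k\<bar> \<le> 1" for n k
  proof -
    have "\<bar>freq k * h n\<bar> > 0" using h0 by simp
    then show "\<bar>cm n k\<bar> \<le> 1" "\<bar>sm n k\<bar> \<le> 1"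
      using abs_cos_diff_le[of "freq k * h n"] abs_sin_x_le_abs_x[of "freq k * h n"]
      unfolding cm_def sm_def abs_divide by (simp_all add: divide_le_eq_1)
  qed
  have hk: "filterlim (\<lambda>n. freq k * h n) (at 0) sequentially" for k :: "'a \<Rightarrow> int"
  proof (rule filterlim_atI)
    show "(\<lambda>n. freq k * h n) \<longlonglongrightarrow> 0" using tendsto_mult_right_zero[OF h(2)] by simp
    show "\<forall>\<^sub>F n in sequentially. freq k * h n \<noteq> 0" using h0 by simp
  qed
  have cl: "(\<lambda>n. cm n k) \<longlonglongrightarrow> 0" for k
  proof -
    have "((\<lambda>x. (cos x - 1) / x) \<longlongrightarrow> 0) (at (0::real))"
      using DERIV_cos[of "0::real"] by (simp add: DERIV_def)
    from filterlim_compose[OF this hk] show ?thesis by (simp add: cm_def)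
  qed
  have sl: "(\<lambda>n. sm n k) \<longlonglongrightarrow> 1" for k
  proof -
    have "((\<lambda>x. sin x / x) \<longlongrightarrow> 1) (at (0::real))"
      using DERIV_sin[of "0::real"] by (simp add: DERIV_def)
    from filterlim_compose[OF this hk] show ?thesis by (simp add: sm_def)
  qed
  have c: "(\<lambda>n. diag_op (cm n) x) \<longlonglongrightarrow> 0" for x :: "('a \<Rightarrow> int) l2"
  proof -
    have "diag_op (\<lambda>k. 0) x = 0" by (rule l2_eqI) (simp add: l2c_diag_op[of _ 0])
    then show ?thesis using diag_op_tendsto[of cm "\<lambda>_. 0" x] cb cl by simp
  qed
  have s: "(\<lambda>n. diag_op (sm n) x) \<longlonglongrightarrow> x" for x :: "('a \<Rightarrow> int) l2"
  proof -
    have "diag_op (\<lambda>k. 1) x = x" by (rule l2_eqI) (simp add: l2c_diag_op[of _ 1])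
    then show ?thesis using diag_op_tendsto[of sm "\<lambda>_. 1" x] sb sl by simp
  qed
  have e: "(1 / h n) *\<^sub>R (wave_rot (h n) U - U) = (diag_op (sm n) ?B - diag_op (cm n) ?A, diag_op (sm n) ?A + diag_op (cm n) ?B)" for n
    by (rule energy_eqI) (use h0[of n] in \<open>simp_all add: l2c_diag_op[OF cb] l2c_diag_op[OF sb] l2c_energy_gen[OF U] l2c_wave_rot cm_def sm_def field_simps\<close>)
  have "(\<lambda>n. (diag_op (sm n) ?B - diag_op (cm n) ?A, diag_op (sm n) ?A + diag_op (cm n) ?B)) \<longlonglongrightarrow> (?B - 0, ?A + 0)"
    by (intro tendsto_intros c s)
  then show "(\<lambda>n. (1 / h n) *\<^sub>R (wave_rot (h n) U - U)) \<longlonglongrightarrow> energy_gen U"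
    unfolding e by simp
qed

lemma DA_facts:
  assumes W: "DA W"
  shows "Xsp W" "energy_dom (coords W)" "Xsp (Aop W)" "coords (Aop W) = energy_gen (coords W)"
proof -
  let ?f = "fst W" and ?g = "snd W"
  have H: "H1_fun ?f" "\<And>j. H1_fun (wd j ?f)" "H1_fun ?g"
    using W by (auto simp: DA_def H2_fun_def)
  then show X: "Xsp W" by (simp add: Xsp_iff H1_fun_iff)
  have s: "square_int tmeas ?f" "square_int tmeas ?g" "square_int (count_space UNIV) (\<lambda>k. freq k * fcoeff ?g k)"
    using H by (auto simp: H1_fun_iff)
  have wds: "square_int tmeas (wd j (wd j ?f))" for j using wd_fcoeff(1)[OF H(2)] .
  have cl: "fcoeff (\<lambda>x. wlap ?f x - ?f x) k = - (freq k)\<^sup>2 * fcoeff ?f k" for k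
  proof -
    have "fcoeff (wlap ?f) k = (\<Sum>j\<in>UNIV. fcoeff (wd j (wd j ?f)) k)"
      unfolding wlap_def[abs_def] fcoeff_def sum_distrib_right
      by (intro Bochner_Integration.integral_sum square_int_mult_integrable wds trig_basis_square_int)
    also have "\<dots> = (\<Sum>j\<in>UNIV. - (of_int (k j))\<^sup>2 * fcoeff ?f k)"
      by (intro sum.cong) (auto simp: wd_fcoeff(2)[OF H(2)] wd_fcoeff(2)[OF H(1)] power2_eq_square)
    finally have "fcoeff (wlap ?f) k = - ((\<Sum>j\<in>UNIV. (of_int (k j))\<^sup>2) * fcoeff ?f k)"
      by (simp add: sum_negf sum_distrib_right)
    moreover have "square_int tmeas (wlap ?f)" unfolding wlap_def[abs_def] by (intro square_int_sum wds)
    ultimately show ?thesis using fcoeff_diff[of "wlap ?f" ?f k] s(1)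
      by (simp add: freq_sq algebra_simps)
  qed
  have ls: "square_int tmeas (\<lambda>x. wlap ?f x - ?f x)"
    unfolding wlap_def[abs_def] by (intro square_int_diff square_int_sum wds s)
  show XA: "Xsp (Aop W)" using s ls by (simp add: Xsp_iff Aop_def)
  have "square_int (count_space UNIV) (\<lambda>k. - ((freq k)\<^sup>2 * fcoeff ?f k))"
  proof -
    have "fcoeff (\<lambda>x. wlap ?f x - ?f x) = (\<lambda>k. - ((freq k)\<^sup>2 * fcoeff ?f k))" by (rule ext) (simp add: cl)
    then show ?thesis using fcoeff_square_int[OF ls] by simp
  qed
  from square_int_uminus[OF this] have s2: "square_int (count_space UNIV) (\<lambda>k. freq k * (freq k * fcoeff ?f k))"
    by (simp add: power2_eq_square mult.assoc)
  show D: "energy_dom (coords W)" unfolding energy_dom_def l2c_coords[OF X] using s s2 by simp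
  show "coords (Aop W) = energy_gen (coords W)"
    by (rule coords_eqI[OF XA]) (simp_all add: l2c_energy_gen[OF D] l2c_coords[OF X] Aop_def cl power2_eq_square)
qed

text \<open>Makes every state that is smooth in coordinates admissible in the generator clause of
  \<open>wave_group\<close>.\<close>

lemma DA_uncoords:
  assumes U: "energy_dom U" shows "DA (uncoords U)"
proof -
  let ?f = "fst (uncoords U)" and ?g = "snd (uncoords U)"
  have H1: "H1_fun ?f" using Xsp_uncoords[of U] by (simp add: Xsp_def)
  have cf1: "freq k * fcoeff ?f k = l2c (fst U) k" and cf2: "fcoeff ?g k = l2c (snd U) k" for k
    using l2c_coords[OF Xsp_uncoords[of U], of k] by simp_all
  have H2: "H1_fun (wd j ?f)" for j
    unfolding H1_fun_iff
  proof
    show "square_int tmeas (wd j ?f)" by (rule wd_fcoeff(1)[OF H1])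
    show "square_int (count_space UNIV) (\<lambda>k. freq k * fcoeff (wd j ?f) k)"
    proof (rule square_int_bound)
      show "square_int (count_space UNIV) (\<lambda>k. freq k * l2c (fst U) (\<lambda>i. - k i))"
        using U square_int_reflect[of "\<lambda>k. freq k * l2c (fst U) k"] by (simp add: energy_dom_def)
      show "AE k in count_space UNIV. \<bar>freq k * fcoeff (wd j ?f) k\<bar> \<le> \<bar>freq k * l2c (fst U) (\<lambda>i. - k i)\<bar>"
      proof (rule AE_I2)
        fix k
        have "\<bar>freq k * fcoeff (wd j ?f) k\<bar> = \<bar>of_int (k j)\<bar> * \<bar>freq k * fcoeff ?f (\<lambda>i. - k i)\<bar>"
          by (simp add: wd_fcoeff(2)[OF H1] abs_mult)
        also have "freq k * fcoeff ?f (\<lambda>i. - k i) = l2c (fst U) (\<lambda>i. - k i)"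
          using cf1[of "\<lambda>i. - k i"] by simp
        also have "\<bar>of_int (k j)\<bar> * \<bar>l2c (fst U) (\<lambda>i. - k i)\<bar> \<le> freq k * \<bar>l2c (fst U) (\<lambda>i. - k i)\<bar>"
          by (intro mult_right_mono abs_le_freq) simp
        finally show "\<bar>freq k * fcoeff (wd j ?f) k\<bar> \<le> \<bar>freq k * l2c (fst U) (\<lambda>i. - k i)\<bar>"
          by (simp add: abs_mult)
      qed
    qed simp
  qed
  have H3: "H1_fun ?g"
    using U Xsp_uncoords[of U] by (simp add: H1_fun_iff cf2 energy_dom_def Xsp_iff)
  show ?thesis using H1 H2 H3 by (simp add: DA_def H2_fun_def)
qed

lemma coords_combination:
  assumes "Xsp W" "Xsp U"
  shows "Xsp (sadd (sscale a W) U)" "coords (sadd (sscale a W) U) = a *\<^sub>R coords W + coords U"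
proof -
  note b = Xsp_sscale[OF assms(1), of a]
  note c = Xsp_sadd[OF conjunct1[OF b] assms(2)]
  show "Xsp (sadd (sscale a W) U)" "coords (sadd (sscale a W) U) = a *\<^sub>R coords W + coords U"
    using b c by simp_all
qed

lemma wave_group_exists: "wave_group (\<lambda>t W. uncoords (wave_rot t (coords (W :: 'd::finite st))))"
proof -
  let ?S = "\<lambda>t W. uncoords (wave_rot t (coords (W :: 'd st)))"
  have nz: "snorm (sdiff W U) = norm (coords W - coords U)" if "Xsp W" "Xsp U" for W U :: "'d st"
    using snorm_sdiff that .
  have lin: "\<forall>t a W U. Xsp W \<and> Xsp U \<longrightarrow>
        snorm (sdiff (?S t (sadd (sscale a W) U)) (sadd (sscale a (?S t W)) (?S t U))) = 0"
  proof (intro allI impI)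
    fix t a and W U :: "'d st" assume "Xsp W \<and> Xsp U"
    then have W: "Xsp W" and U: "Xsp U" by auto
    note 1 = coords_combination(2)[OF W U, of a]
    have 2: "Xsp (sadd (sscale a (?S t W)) (?S t U))" "coords (sadd (sscale a (?S t W)) (?S t U)) = a *\<^sub>R wave_rot t (coords W) + wave_rot t (coords U)"
      using coords_combination[OF Xsp_uncoords Xsp_uncoords] by simp_all
    show "snorm (sdiff (?S t (sadd (sscale a W) U)) (sadd (sscale a (?S t W)) (?S t U))) = 0"
      by (simp add: nz[OF Xsp_uncoords 2(1)] 2(2) 1 wave_rot_simps)
  qed
  have cont: "\<forall>W t0. Xsp W \<longrightarrow> ((\<lambda>t. snorm (sdiff (?S t W) (?S t0 W))) \<longlongrightarrow> 0) (at t0)"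
  proof (intro allI impI)
    fix W :: "'d st" and t0
    have "((\<lambda>t. wave_rot t (coords W)) \<longlongrightarrow> wave_rot t0 (coords W)) (at t0)" using wave_rot_isCont by (simp add: isCont_def)
    then have "((\<lambda>t. norm (wave_rot t (coords W) - wave_rot t0 (coords W))) \<longlongrightarrow> 0) (at t0)"
      by (simp add: tendsto_norm_zero_iff LIM_zero_iff)
    then show "((\<lambda>t. snorm (sdiff (?S t W) (?S t0 W))) \<longlongrightarrow> 0) (at t0)"
      by (simp add: nz Xsp_uncoords)
  qed
  have der: "\<forall>W. DA W \<longrightarrow>
        ((\<lambda>h. snorm (sdiff (sscale (1 / h) (sdiff (?S h W) W)) (Aop W))) \<longlongrightarrow> 0) (at 0)"
  proof (intro allI impI)
    fix W :: "'d st" assume W: "DA W"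
    note D = DA_facts[OF W]
    have "snorm (sdiff (sscale (1 / h) (sdiff (?S h W) W)) (Aop W)) = norm ((1 / h) *\<^sub>R (wave_rot h (coords W) - coords W) - energy_gen (coords W))" for h
      using Xsp_sscale[of "sdiff (?S h W) W" "1 / h"] Xsp_sdiff[OF Xsp_uncoords D(1), of "wave_rot h (coords W)"] D
      by (simp add: nz)
    moreover have "((\<lambda>h. norm ((1 / h) *\<^sub>R (wave_rot h (coords W) - coords W) - energy_gen (coords W))) \<longlongrightarrow> 0) (at 0)"
      using wave_rot_derivative[OF D(2)] by (simp add: tendsto_norm_zero_iff LIM_zero_iff)
    ultimately show "((\<lambda>h. snorm (sdiff (sscale (1 / h) (sdiff (?S h W) W)) (Aop W))) \<longlongrightarrow> 0) (at 0)" by simp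
  qed
  have bd: "\<forall>t. \<exists>M. \<forall>W. Xsp W \<longrightarrow> snorm (?S t W) \<le> M * snorm W"
    by (intro allI exI[of _ 1]) (simp add: snorm_coords Xsp_uncoords)
  have cong: "\<forall>t W U. Xsp W \<and> Xsp U \<and> snorm (sdiff W U) = 0 \<longrightarrow> snorm (sdiff (?S t W) (?S t U)) = 0"
  proof (intro allI impI, elim conjE)
    fix t and W U :: "'d st" assume "Xsp W" "Xsp U" "snorm (sdiff W U) = 0"
    then show "snorm (sdiff (?S t W) (?S t U)) = 0" by (simp add: nz Xsp_uncoords)
  qed
  show ?thesis
    unfolding wave_group_def
    by (intro conjI lin cont der bd cong) (simp_all add: nz Xsp_uncoords wave_rot_add)
qed

section \<open>Single frequency modes and uniqueness of the wave group\<close>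

definition unit_l2 :: "'i \<Rightarrow> 'i l2" where
  "unit_l2 k = Abs_l2 (\<lambda>i. if i = k then 1 else 0)"

lemma l2c_unit: "l2c (unit_l2 k) i = (if i = k then 1 else 0)"
  using square_int_finite_support[of "{k}" "\<lambda>_. 1"] by (simp add: unit_l2_def l2c_Abs)

lemma l2c_sum: "l2c (\<Sum>k\<in>F. f k) i = (\<Sum>k\<in>F. l2c (f k) i)"
  by (induction F rule: infinite_finite_induct) auto

lemma l2_partial_sums:
  "(\<lambda>n. \<Sum>k\<in>kbox n. l2c x k *\<^sub>R unit_l2 k) \<longlonglongrightarrow> (x :: ('d::finite \<Rightarrow> int) l2)"
proof (rule l2_dominated[where g=x])
  have e: "l2c (\<Sum>k\<in>kbox n. l2c x k *\<^sub>R unit_l2 k) i = (if i \<in> kbox n then l2c x i else 0)" for n i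
  proof -
    have "l2c (\<Sum>k\<in>kbox n. l2c x k *\<^sub>R unit_l2 k) i = (\<Sum>k\<in>kbox n. if i = k then l2c x i else 0)"
      unfolding l2c_sum by (intro sum.cong) (auto simp: l2c_unit)
    then show ?thesis by simp
  qed
  show "(\<lambda>n. l2c (\<Sum>k\<in>kbox n. l2c x k *\<^sub>R unit_l2 k) i) \<longlonglongrightarrow> l2c x i" for i
    using kbox_ev[of i] unfolding e by (intro tendsto_eventually) (auto simp: eventually_sequentially)
  show "\<bar>l2c (\<Sum>k\<in>kbox n. l2c x k *\<^sub>R unit_l2 k) i - l2c x i\<bar> \<le> \<bar>l2c x i\<bar>" for n i
    by (simp add: e)
qed

lemma energy_partial_sums:
  "(\<lambda>n. \<Sum>k\<in>kbox n. l2c (fst U) k *\<^sub>R (unit_l2 k, 0) + l2c (snd U) k *\<^sub>R (0, unit_l2 k)) \<longlonglongrightarrow> (U :: 'd::finite energy)"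
proof -
  have e: "(\<Sum>k\<in>F. l2c (fst U) k *\<^sub>R (unit_l2 k, 0) + l2c (snd U) k *\<^sub>R (0, unit_l2 k))
    = (\<Sum>k\<in>F. l2c (fst U) k *\<^sub>R unit_l2 k, \<Sum>k\<in>F. l2c (snd U) k *\<^sub>R unit_l2 k)" for F
    by (simp add: prod_eq_iff fst_sum snd_sum)
  show ?thesis unfolding e using tendsto_Pair[OF l2_partial_sums l2_partial_sums, of "fst U" "snd U"] by simp
qed

lemma bounded_linear_energy_eqI:
  fixes f g :: "'d::finite energy \<Rightarrow> 'd energy"
  assumes f: "bounded_linear f" and g: "bounded_linear g"
    and "\<And>k. f (unit_l2 k, 0) = g (unit_l2 k, 0)" "\<And>k. f (0, unit_l2 k) = g (0, unit_l2 k)"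
  shows "f U = g U"
proof -
  let ?P = "\<lambda>n. \<Sum>k\<in>kbox n. l2c (fst U) k *\<^sub>R (unit_l2 k, 0) + l2c (snd U) k *\<^sub>R (0, unit_l2 k)"
  have ex: "h (?P n) = (\<Sum>k\<in>kbox n. l2c (fst U) k *\<^sub>R h (unit_l2 k, 0) + l2c (snd U) k *\<^sub>R h (0, unit_l2 k))"
    if "bounded_linear h" for h :: "'d energy \<Rightarrow> 'd energy" and n
    unfolding linear_sum[OF bounded_linear.linear[OF that]] linear_simps(1)[OF that] linear_simps(5)[OF that] ..
  have eq: "f (?P n) = g (?P n)" for n
    unfolding ex[OF f] ex[OF g] assms(3,4) ..
  have "(\<lambda>n. f (?P n)) \<longlonglongrightarrow> f U" "(\<lambda>n. g (?P n)) \<longlonglongrightarrow> g U"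
    by (intro bounded_linear.tendsto[OF f] bounded_linear.tendsto[OF g] energy_partial_sums)+
  then show ?thesis unfolding eq by (rule LIMSEQ_unique)
qed

lemma energy_dom_unit: "energy_dom (a *\<^sub>R unit_l2 k, b *\<^sub>R unit_l2 k)"
proof -
  have "(\<lambda>i. freq i * (c * (if i = k then 1 else 0))) = (\<lambda>i. if i \<in> {k} then freq k * c else 0)" for c by auto
  then show ?thesis
    using square_int_finite_support[of "{k}"] by (simp add: energy_dom_def l2c_unit)
qed

lemma wave_groupD:
  assumes "wave_group S"
  shows "Xsp W \<Longrightarrow> Xsp (S t W)"
    "Xsp W \<Longrightarrow> Xsp U \<Longrightarrow> snorm (sdiff W U) = 0 \<Longrightarrow> snorm (sdiff (S t W) (S t U)) = 0"
    "Xsp W \<Longrightarrow> Xsp U \<Longrightarrow> snorm (sdiff (S t (sadd (sscale a W) U)) (sadd (sscale a (S t W)) (S t U))) = 0"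
    "\<exists>M. \<forall>W. Xsp W \<longrightarrow> snorm (S t W) \<le> M * snorm W"
    "Xsp W \<Longrightarrow> snorm (sdiff (S 0 W) W) = 0"
    "Xsp W \<Longrightarrow> snorm (sdiff (S (t + s) W) (S t (S s W))) = 0"
    "DA W \<Longrightarrow> ((\<lambda>h. snorm (sdiff (sscale (1 / h) (sdiff (S h W) W)) (Aop W))) \<longlongrightarrow> 0) (at 0)"
  by (insert assms[unfolded wave_group_def]) blast+

text \<open>On a single frequency the generator is a \<open>2 \<times> 2\<close> matrix, so the group is known there by solving an
  ordinary differential equation; boundedness at each fixed time and density do the rest.\<close>

lemma wave_group_unique:
  assumes S: "wave_group S" and W: "Xsp W"
  shows "Xsp (S t W)" "coords (S t W) = wave_rot t (coords (W :: 'd::finite st))"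
proof -
  note D = wave_groupD[OF S]
  note SX = D(1)
  show "Xsp (S t W)" by (rule SX[OF W])
  have nz: "coords W = coords U" if "snorm (sdiff W U) = 0" "Xsp W" "Xsp U" for W U :: "'d st"
    using snorm_sdiff[OF that(2,3)] that(1) by simp
  have S1: "coords (S t W) = coords (S t U)" if "Xsp W" "Xsp U" "coords W = coords U" for t W U
    by (intro nz SX D(2) that) (simp add: snorm_sdiff that)
  \<comment> \<open>The group transported to coordinates, where almost everywhere equality becomes
    equality and the axioms hold literally.\<close>
  define T where "T t U = coords (S t (uncoords U))" for t U
  have ST: "coords (S t W) = T t (coords W)" if "Xsp W" for t W
    unfolding T_def by (rule S1[OF that Xsp_uncoords]) simp
  have T0: "T 0 U = U" for U
  proof -
    have "coords (S 0 (uncoords U)) = coords (uncoords U)"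
      by (intro nz SX D Xsp_uncoords)
    then show ?thesis by (simp add: T_def)
  qed
  have Tadd: "T (t + s) U = T t (T s U)" for t s U
  proof -
    have "coords (S (t + s) (uncoords U)) = coords (S t (S s (uncoords U)))"
      by (intro nz SX D Xsp_uncoords)
    then show ?thesis by (simp add: T_def ST[OF SX[OF Xsp_uncoords]])
  qed
  have Tlin: "T t (a *\<^sub>R U + V) = a *\<^sub>R T t U + T t V" for t a U V
  proof -
    have a: "Xsp (sadd (sscale a (uncoords U)) (uncoords V))" "coords (sadd (sscale a (uncoords U)) (uncoords V)) = a *\<^sub>R U + V"
      using coords_combination[OF Xsp_uncoords Xsp_uncoords] by simp_all
    have b: "Xsp (sadd (sscale a (S t (uncoords U))) (S t (uncoords V)))"
      "coords (sadd (sscale a (S t (uncoords U))) (S t (uncoords V))) = a *\<^sub>R T t U + T t V"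
      using coords_combination[OF SX[OF Xsp_uncoords] SX[OF Xsp_uncoords]] by (simp_all only: T_def)
    have "coords (S t (sadd (sscale a (uncoords U)) (uncoords V))) = coords (sadd (sscale a (S t (uncoords U))) (S t (uncoords V)))"
      by (intro nz D(3) SX a b Xsp_uncoords)
    then show ?thesis using ST[OF a(1), of t] a(2) b(2) by simp
  qed
  have Tbl: "bounded_linear (T t)" for t
  proof -
    obtain M where M: "\<And>W. Xsp W \<Longrightarrow> snorm (S t W) \<le> M * snorm W"
      using D(4)[of t] by blast
    have T00: "T t 0 = 0" using Tlin[of t "-1" 0 0] by simp
    show ?thesis
    proof (rule bounded_linear_intro[where K=M])
      show "T t (x + y) = T t x + T t y" for x y using Tlin[of t 1 x y] by simp
      show "T t (r *\<^sub>R x) = r *\<^sub>R T t x" for r x using Tlin[of t r x 0] T00 by simp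
      show "norm (T t x) \<le> norm x * M" for x
        using M[OF Xsp_uncoords[of x]] by (simp add: snorm_coords SX Xsp_uncoords T_def mult.commute)
    qed
  qed
  have Tder: "((\<lambda>h. (1 / h) *\<^sub>R (T (t + h) U - T t U)) \<longlongrightarrow> T t (energy_gen U)) (at 0)" if U: "energy_dom U" for U t
  proof -
    note DA = DA_facts[OF DA_uncoords[OF U]]
    have "snorm (sdiff (sscale (1 / h) (sdiff (S h (uncoords U)) (uncoords U))) (Aop (uncoords U))) = norm ((1 / h) *\<^sub>R (T h U - U) - energy_gen U)" for h
      using Xsp_sscale[of "sdiff (S h (uncoords U)) (uncoords U)" "1 / h"] Xsp_sdiff[OF SX[OF Xsp_uncoords] Xsp_uncoords, of h U U] DA
      by (simp add: snorm_sdiff T_def)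
    moreover have "((\<lambda>h. snorm (sdiff (sscale (1 / h) (sdiff (S h (uncoords U)) (uncoords U))) (Aop (uncoords U)))) \<longlongrightarrow> 0) (at 0)"
      by (rule D(7)[OF DA_uncoords[OF U]])
    ultimately have "((\<lambda>h. (1 / h) *\<^sub>R (T h U - U)) \<longlongrightarrow> energy_gen U) (at 0)"
      by (simp add: tendsto_norm_zero_iff LIM_zero_iff)
    from bounded_linear.tendsto[OF Tbl this, of t] show ?thesis
      by (simp add: linear_simps[OF Tbl] Tadd)
  qed
  have main: "T t (unit_l2 k, 0) = wave_rot t (unit_l2 k, 0) \<and> T t (0, unit_l2 k) = wave_rot t (0, unit_l2 k)" for k
  proof -
    let ?w = "freq k"
    define x1 x2 where "x1 = ((unit_l2 k, 0) :: 'd energy)" and "x2 = ((0, unit_l2 k) :: 'd energy)"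
    have dom: "energy_dom x1" "energy_dom x2"
      using energy_dom_unit[of 1 k 0] energy_dom_unit[of 0 k 1] by (simp_all add: x1_def x2_def)
    have g: "energy_gen x1 = - ?w *\<^sub>R x2" "energy_gen x2 = ?w *\<^sub>R x1"
      by (rule energy_eqI; simp add: l2c_energy_gen dom; simp add: x1_def x2_def l2c_unit)+
    \<comment> \<open>Pairing with a fixed \<open>z\<close> reduces the vector equation to a scalar
      linear system in two unknowns.\<close>
    have in_eq: "inner (T t x1) z = inner (cos (?w * t) *\<^sub>R x1 - sin (?w * t) *\<^sub>R x2) z \<and>
          inner (T t x2) z = inner (sin (?w * t) *\<^sub>R x1 + cos (?w * t) *\<^sub>R x2) z" for z
    proof -
      define f1 f2 where "f1 s = inner (T s x1) z" and "f2 s = inner (T s x2) z" for s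
      have der: "((\<lambda>s. inner (T s x) z) has_field_derivative inner (T s (energy_gen x)) z) (at s)" if "energy_dom x" for x s
        using tendsto_inner[OF Tder[OF that, of s] tendsto_const[of z]]
        by (simp add: DERIV_def inner_diff_left)
      have d1: "(f1 has_field_derivative - ?w * f2 s) (at s)" and d2: "(f2 has_field_derivative ?w * f1 s) (at s)" for s
        using der[OF dom(1), of s] der[OF dom(2), of s]
        by (simp_all add: f1_def[abs_def] f2_def[abs_def] g linear_simps[OF Tbl])
      \<comment> \<open>In the rotating frame both combinations are constant, and their values at
        time 0 determine the solution.\<close>
      have "\<forall>s. ((\<lambda>s. cos (?w * s) * f1 s + sin (?w * s) * f2 s) has_field_derivative 0) (at s)"
        by (auto intro!: derivative_eq_intros d1 d2 simp: algebra_simps)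
      from DERIV_isconst_all[OF this, of t 0]
      have A: "cos (?w * t) * f1 t + sin (?w * t) * f2 t = f1 0" by simp
      have "\<forall>s. ((\<lambda>s. cos (?w * s) * f2 s - sin (?w * s) * f1 s) has_field_derivative 0) (at s)"
        by (auto intro!: derivative_eq_intros d1 d2 simp: algebra_simps)
      from DERIV_isconst_all[OF this, of t 0]
      have B: "cos (?w * t) * f2 t - sin (?w * t) * f1 t = f2 0" by simp
      let ?c = "cos (?w * t)" and ?s = "sin (?w * t)"
      have cs: "?c * ?c + ?s * ?s = 1" using sin_cos_squared_add2[of "?w * t"] by (simp add: power2_eq_square)
      have "?c * f1 0 - ?s * f2 0 = (?c * ?c + ?s * ?s) * f1 t"
        unfolding A[symmetric] B[symmetric] by algebra
      moreover have "?s * f1 0 + ?c * f2 0 = (?c * ?c + ?s * ?s) * f2 t"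
        unfolding A[symmetric] B[symmetric] by algebra
      ultimately show ?thesis unfolding cs
        by (simp add: f1_def f2_def T0 inner_diff_left inner_add_left)
    qed
    have "T t x1 = cos (?w * t) *\<^sub>R x1 - sin (?w * t) *\<^sub>R x2"
      "T t x2 = sin (?w * t) *\<^sub>R x1 + cos (?w * t) *\<^sub>R x2"
      using in_eq vector_eq_ldot[of "T t x1"] vector_eq_ldot[of "T t x2"] by (metis inner_commute)+
    moreover have "wave_rot t x1 = cos (?w * t) *\<^sub>R x1 - sin (?w * t) *\<^sub>R x2"
      "wave_rot t x2 = sin (?w * t) *\<^sub>R x1 + cos (?w * t) *\<^sub>R x2"
      by (rule energy_eqI; simp add: l2c_wave_rot x1_def x2_def l2c_unit)+
    ultimately show ?thesis by (simp add: x1_def x2_def)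
  qed
  have "T t (coords W) = wave_rot t (coords W)"
    by (rule bounded_linear_energy_eqI[OF Tbl wave_rot_bounded_linear]) (use main in auto)
  then show "coords (S t W) = wave_rot t (coords W)" by (simp add: ST[OF W])
qed

text \<open>The choice in \<open>expA\<close> is harmless: a wave group exists, and all of them
  agree in coordinates.\<close>

lemma expA:
  assumes "Xsp W" shows "Xsp (expA t W)" "coords (expA t W) = wave_rot t (coords W)"
proof -
  have "wave_group (expA :: real \<Rightarrow> 'a st \<Rightarrow> 'a st)"
    unfolding expA_def by (rule someI[of wave_group, OF wave_group_exists])
  from wave_group_unique[OF this assms] show "Xsp (expA t W)" "coords (expA t W) = wave_rot t (coords W)" by auto
qed

subsection \<open>Multiplication operators in coefficients\<close>

definition mult_op :: "(real^'d::finite \<Rightarrow> real) \<Rightarrow> 'd energy \<Rightarrow> 'd energy" where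
  "mult_op c U = (0, fcoeffs (\<lambda>x. c x * fst (uncoords U) x))"

lemma multiplier_square_int:
  assumes "multiplier c" "Xsp W" shows "square_int tmeas (\<lambda>x. c x * fst W x)"
  using assms by (auto simp: multiplier_def Xsp_def)

lemma mult_op_coords:
  assumes c: "multiplier c" and W: "Xsp W"
  shows "mult_op c (coords W) = (0, fcoeffs (\<lambda>x. c x * fst W x))"
proof -
  have "AE x in tmeas. fst (uncoords (coords W)) x = fst W x"
    using coords_eq_fcoeff[OF Xsp_uncoords W, of "coords W"] by simp
  then have "AE x in tmeas. c x * fst (uncoords (coords W)) x = c x * fst W x" by eventually_elim simp
  then show ?thesis
    unfolding mult_op_def using fcoeffs_eq_iff[OF multiplier_square_int[OF c Xsp_uncoords] multiplier_square_int[OF c W]] by simp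
qed

lemma mulpot_coords:
  assumes c: "multiplier c" and W: "Xsp W"
  shows "Xsp (mulpot c W)" "coords (mulpot c W) = mult_op c (coords W)"
proof -
  show X: "Xsp (mulpot c W)"
    using multiplier_square_int[OF assms] by (simp add: Xsp_iff mulpot_def)
  show "coords (mulpot c W) = mult_op c (coords W)"
    by (rule coords_eqI[OF X]) (simp_all add: mult_op_coords[OF assms], simp_all add: mulpot_def l2c_fcoeffs multiplier_square_int[OF assms])
qed

lemma mult_op_bounded_linear:
  assumes c: "multiplier c" shows "bounded_linear (mult_op c)"
proof -
  obtain C where C: "\<And>w. H1_fun w \<Longrightarrow> (LINT x|tmeas. (c x * w x)\<^sup>2) \<le> C * h1_norm_sq w"
    using c by (auto simp: multiplier_def)
  have lin: "mult_op c (a *\<^sub>R U + V) = a *\<^sub>R mult_op c U + mult_op c V" for a U V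
  proof -
    let ?W = "sadd (sscale a (uncoords U)) (uncoords V)"
    have a: "Xsp ?W" "coords ?W = a *\<^sub>R U + V"
      using coords_combination[OF Xsp_uncoords Xsp_uncoords] by simp_all
    have s: "square_int tmeas (\<lambda>x. c x * fst (uncoords U) x)" "square_int tmeas (\<lambda>x. c x * fst (uncoords V) x)"
      by (intro multiplier_square_int[OF c Xsp_uncoords])+
    have "mult_op c (coords ?W) = (0, fcoeffs (\<lambda>x. a * (c x * fst (uncoords U) x) + c x * fst (uncoords V) x))"
      unfolding mult_op_coords[OF c a(1)] by (simp add: sadd_def sscale_def algebra_simps)
    also have "\<dots> = a *\<^sub>R mult_op c U + mult_op c V"
      by (simp add: mult_op_def fcoeffs_add square_int_scale s fcoeffs_scale)
    finally show ?thesis using a by simp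
  qed
  have K0: "mult_op c 0 = 0" using lin[of "-1" 0 0] by simp
  show ?thesis
  proof (rule bounded_linear_intro[where K="sqrt \<bar>C\<bar>"])
    show "mult_op c (x + y) = mult_op c x + mult_op c y" for x y using lin[of 1 x y] by simp
    show "mult_op c (r *\<^sub>R x) = r *\<^sub>R mult_op c x" for r x using lin[of r x 0] K0 by simp
    show "norm (mult_op c U) \<le> norm U * sqrt \<bar>C\<bar>" for U
    proof (rule power2_le_imp_le)
      have h: "h1_norm_sq (fst (uncoords U)) = (norm (fst U))\<^sup>2"
        using l2c_coords(1)[OF Xsp_uncoords[of U]] by (simp add: h1_norm_sq_def l2_norm_sq)
      have "(norm (mult_op c U))\<^sup>2 = (LINT x|tmeas. (c x * fst (uncoords U) x)\<^sup>2)"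
        using Parseval_norm[OF multiplier_square_int[OF c Xsp_uncoords[of U]]] by (simp add: mult_op_def norm_Pair)
      also have "\<dots> \<le> C * (norm (fst U))\<^sup>2"
        using C[of "fst (uncoords U)"] Xsp_uncoords[of U] h by (simp add: Xsp_def)
      also have "\<dots> \<le> \<bar>C\<bar> * (norm U)\<^sup>2"
        by (intro mult_mono) (use norm_fst_le[of "fst U" "snd U"] in \<open>auto simp: power_mono\<close>)
      finally show "(norm (mult_op c U))\<^sup>2 \<le> (norm U * sqrt \<bar>C\<bar>)\<^sup>2"
        by (simp add: power_mult_distrib mult.commute)
    qed simp
  qed
qed

lemma mult_op_add:
  assumes "multiplier c" "multiplier c'"
  shows "mult_op (\<lambda>x. c x + c' x) U = mult_op c U + mult_op c' U"
  using multiplier_square_int[OF assms(1) Xsp_uncoords[of U]] multiplier_square_int[OF assms(2) Xsp_uncoords[of U]]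
  by (simp add: mult_op_def distrib_right fcoeffs_add)

lemma mult_op_scale:
  assumes "multiplier c"
  shows "mult_op (\<lambda>x. a * c x) U = a *\<^sub>R mult_op c U"
  using multiplier_square_int[OF assms(1) Xsp_uncoords[of U]]
  by (simp add: mult_op_def mult.assoc fcoeffs_scale)

subsection \<open>Mild solutions\<close>

definition oriented_int :: "(real \<Rightarrow> 'a::banach) \<Rightarrow> real \<Rightarrow> 'a" where
  "oriented_int f t = (if 0 \<le> t then integral {0..t} f else - integral {t..0} f)"

text \<open>The substitution s = t \<theta> treats both signs of \<open>t\<close> over one fixed
  interval, where continuity in the parameter \<open>t\<close> is available.\<close>

lemma oriented_int_rescale:
  fixes g :: "real \<Rightarrow> 'a::banach"
  assumes g: "continuous_on UNIV g"
  shows "t *\<^sub>R integral {0..1} (\<lambda>\<theta>. g (t * \<theta>)) = oriented_int g t"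
proof -
  consider "t = 0" | "t > 0" | "t < 0" by linarith
  then show ?thesis
  proof cases
    case 1 then show ?thesis by (simp add: oriented_int_def)
  next
    case 2
    have "(g has_integral integral {0..t} g) (cbox 0 t)"
      using g by (auto intro!: integrable_integral integrable_continuous_real continuous_on_subset[OF g])
    from has_integral_affinity[OF this, of t 0] 2
    have "((\<lambda>\<theta>. g (t * \<theta>)) has_integral (1 / t) *\<^sub>R integral {0..t} g) ((\<lambda>x. x / t) ` {0..t})"
      by simp
    moreover have "(\<lambda>x. x / t) ` {0..t} = {0..1}"
      using 2 by (auto simp: image_iff field_simps intro!: bexI[of _ "t * _"])
    ultimately have "integral {0..1} (\<lambda>\<theta>. g (t * \<theta>)) = (1 / t) *\<^sub>R integral {0..t} g"
      by (simp add: integral_unique)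
    then show ?thesis using 2 by (simp add: oriented_int_def)
  next
    case 3
    have "(g has_integral integral {t..0} g) (cbox t 0)"
      using g by (auto intro!: integrable_integral integrable_continuous_real continuous_on_subset[OF g])
    from has_integral_affinity[OF this, of t 0] 3
    have "((\<lambda>\<theta>. g (t * \<theta>)) has_integral (1 / - t) *\<^sub>R integral {t..0} g) ((\<lambda>x. x / t) ` {t..0})"
      by simp
    moreover have "(\<lambda>x. x / t) ` {t..0} = {0..1}"
      using 3 by (auto simp: image_iff field_simps mult_le_0_iff intro!: bexI[of _ "t * _"])
    ultimately have "integral {0..1} (\<lambda>\<theta>. g (t * \<theta>)) = (1 / - t) *\<^sub>R integral {t..0} g"
      by (simp add: integral_unique)
    then show ?thesis using 3 by (simp add: oriented_int_def)
  qed
qed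

text \<open>Duhamel's formula in the interaction picture: with the free evolution factored out, the
  integrand no longer depends on \<open>t\<close>.\<close>

definition mild_sol :: "('d::finite energy \<Rightarrow> 'd energy) \<Rightarrow> 'd energy \<Rightarrow> (real \<Rightarrow> 'd energy) \<Rightarrow> bool" where
  "mild_sol K U0 U \<longleftrightarrow> continuous_on UNIV U \<and> (\<forall>t. U t = wave_rot t (U0 + oriented_int (\<lambda>s. wave_rot (- s) (K (U s))) t))"

lemma msolD:
  assumes "mild_sol K U0 U"
  shows "continuous_on S U" "U t = wave_rot t (U0 + oriented_int (\<lambda>s. wave_rot (- s) (K (U s))) t)"
proof -
  have "continuous_on UNIV U" using assms unfolding mild_sol_def by (rule conjunct1)
  then show "continuous_on S U" by (rule continuous_on_subset) simp
  show "U t = wave_rot t (U0 + oriented_int (\<lambda>s. wave_rot (- s) (K (U s))) t)"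
    using assms unfolding mild_sol_def by blast
qed

lemma exp_weight_integral:
  fixes lam t :: real
  assumes "lam > 0"
  shows "((\<lambda>\<theta>. \<bar>t\<bar> * exp (lam * \<bar>t\<bar> * \<theta>)) has_integral (exp (lam * \<bar>t\<bar>) - 1) / lam) {0..1}"
proof -
  have "((\<lambda>\<theta>. \<bar>t\<bar> * exp (lam * \<bar>t\<bar> * \<theta>)) has_integral exp (lam * \<bar>t\<bar> * 1) / lam - exp (lam * \<bar>t\<bar> * 0) / lam) {0..1}"
  proof (rule fundamental_theorem_of_calculus)
    fix x :: real
    show "((\<lambda>\<theta>. exp (lam * \<bar>t\<bar> * \<theta>) / lam) has_vector_derivative \<bar>t\<bar> * exp (lam * \<bar>t\<bar> * x)) (at x within {0..1})"
      unfolding has_real_derivative_iff_has_vector_derivative[symmetric]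
      using assms by (auto intro!: derivative_eq_intros)
  qed simp
  then show ?thesis by (simp add: diff_divide_distrib)
qed

text \<open>Contraction in the interaction picture, for the norm weighted by the exponential of
  minus a multiple of the modulus of time; this gives the solution on the whole line at once.\<close>

lemma mild_sol_exists:
  fixes K :: "'d::finite energy \<Rightarrow> 'd energy"
  assumes K: "bounded_linear K"
  obtains U where "mild_sol K U0 U"
proof -
  obtain B where B: "B > 0" "\<And>U. norm (K U) \<le> norm U * B" using bounded_linear.pos_bounded[OF K] by blast
  \<comment> \<open>The Duhamel term contributes a factor B / lam in the weighted norm; this choice
    makes it 1/2.\<close>
  define lam where "lam = 2 * B"
  have lam: "lam > 0" using B by (simp add: lam_def)
  define M where "M s Z = wave_rot (- s) (K (wave_rot s Z))" for s Z
  have Mb: "norm (M s Z) \<le> B * norm Z" for s Z using B(2)[of "wave_rot s Z"] by (simp add: M_def mult.commute)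
  have Mdiff: "M s (Z - Y) = M s Z - M s Y" and M0: "M s 0 = 0" and Msc: "M s (a *\<^sub>R Z) = a *\<^sub>R M s Z" for s Z Y a
    by (simp_all add: M_def wave_rot_simps linear_simps[OF K])
  have Mc: "continuous_on S (\<lambda>x. M (f x) (g x))" if "continuous_on S f" "continuous_on S g"
    for S and f :: "'x::metric_space \<Rightarrow> real" and g
    unfolding M_def by (intro continuous_on_wave_rot bounded_linear.continuous_on[OF K] continuous_intros that)
  \<comment> \<open>The Duhamel map for the unknown exp(-lam |t|) times the back-rotated solution;
    the weight makes a fixed point bounded on the whole line.\<close>
  define F where "F v t = exp (- lam * \<bar>t\<bar>) *\<^sub>R (U0 + t *\<^sub>R integral {0..1} (\<lambda>\<theta>. exp (lam * \<bar>t * \<theta>\<bar>) *\<^sub>R M (t * \<theta>) (v (t * \<theta>))))"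
    for v :: "real \<Rightarrow> 'd energy" and t
  have vint: "(\<lambda>\<theta>. exp (lam * \<bar>t * \<theta>\<bar>) *\<^sub>R M (t * \<theta>) (v (t * \<theta>))) integrable_on {0..1}"
    if "continuous_on UNIV v" for v :: "real \<Rightarrow> 'd energy" and t
    by (intro integrable_continuous_real continuous_intros Mc continuous_on_compose2[OF that]) auto
  have est: "norm (F v t - F w t) \<le> D / 2"
    if v: "continuous_on UNIV v" and w: "continuous_on UNIV w" and D: "\<And>s. norm (v s - w s) \<le> D" for v w t D
  proof -
    have D0: "D \<ge> 0" using D[of 0] norm_ge_zero order_trans by blast
    define f where "f v \<theta> = exp (lam * \<bar>t * \<theta>\<bar>) *\<^sub>R M (t * \<theta>) (v (t * \<theta>))" for v :: "real \<Rightarrow> 'd energy" and \<theta>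
    define G where "G \<theta> = B * D * (\<bar>t\<bar> * exp (lam * \<bar>t\<bar> * \<theta>))" for \<theta>
    have fi: "f v integrable_on {0..1}" "f w integrable_on {0..1}"
      using vint[OF v, of t] vint[OF w, of t] by (simp_all add: f_def[abs_def])
    have Gi: "(G has_integral B * D * ((exp (lam * \<bar>t\<bar>) - 1) / lam)) {0..1}"
      unfolding G_def[abs_def] by (rule has_integral_mult_right[OF exp_weight_integral[OF lam]])
    have "norm (t *\<^sub>R (integral {0..1} (f v) - integral {0..1} (f w))) = norm (integral {0..1} (\<lambda>\<theta>. t *\<^sub>R (f v \<theta> - f w \<theta>)))"
      by (simp only: integral_cmul integral_diff[OF fi])
    also have "\<dots> \<le> integral {0..1} G"
    proof (rule integral_norm_bound_integral)
      show "(\<lambda>\<theta>. t *\<^sub>R (f v \<theta> - f w \<theta>)) integrable_on {0..1}"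
        by (rule integrable_cmul[OF integrable_diff[OF fi]])
      show "G integrable_on {0..1}" using Gi by blast
      fix \<theta> :: real assume \<theta>: "\<theta> \<in> {0..1}"
      have "f v \<theta> - f w \<theta> = exp (lam * \<bar>t\<bar> * \<theta>) *\<^sub>R M (t * \<theta>) (v (t * \<theta>) - w (t * \<theta>))"
        using \<theta> by (simp add: f_def Mdiff abs_mult mult.assoc scaleR_diff_right)
      then have "norm (t *\<^sub>R (f v \<theta> - f w \<theta>)) = \<bar>t\<bar> * exp (lam * \<bar>t\<bar> * \<theta>) * norm (M (t * \<theta>) (v (t * \<theta>) - w (t * \<theta>)))"
        by (simp add: abs_mult)
      also have "\<dots> \<le> \<bar>t\<bar> * exp (lam * \<bar>t\<bar> * \<theta>) * (B * D)"
        using B(1) by (intro mult_left_mono order_trans[OF Mb] D) auto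
      finally show "norm (t *\<^sub>R (f v \<theta> - f w \<theta>)) \<le> G \<theta>" by (simp add: G_def mult_ac)
    qed
    also have "integral {0..1} G = D / 2 * (exp (lam * \<bar>t\<bar>) - 1)"
      using integral_unique[OF Gi] B(1) by (simp add: lam_def)
    also have "\<dots> \<le> D / 2 * exp (lam * \<bar>t\<bar>)" using D0 by (intro mult_left_mono) auto
    finally have le: "norm (t *\<^sub>R (integral {0..1} (f v) - integral {0..1} (f w))) \<le> D / 2 * exp (lam * \<bar>t\<bar>)" .
    have Ff: "F v t - F w t = exp (- lam * \<bar>t\<bar>) *\<^sub>R (t *\<^sub>R (integral {0..1} (f v) - integral {0..1} (f w)))"
      unfolding F_def f_def[abs_def] by (simp add: scaleR_diff_right scaleR_add_right)
    have "norm (F v t - F w t) = exp (- lam * \<bar>t\<bar>) * norm (t *\<^sub>R (integral {0..1} (f v) - integral {0..1} (f w)))"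
      unfolding Ff by (simp add: abs_mult)
    also have "\<dots> \<le> exp (- lam * \<bar>t\<bar>) * (D / 2 * exp (lam * \<bar>t\<bar>))"
      using le by (rule mult_left_mono) simp
    also have "\<dots> = D / 2" by (simp add: exp_minus)
    finally show ?thesis .
  qed
  have fcoeffs: "continuous_on UNIV (F v)" if "continuous_on UNIV v" for v
  proof -
    have "continuous_on UNIV (\<lambda>t. integral (cbox 0 1) (\<lambda>\<theta>. exp (lam * \<bar>t * \<theta>\<bar>) *\<^sub>R M (t * \<theta>) (v (t * \<theta>))))"
      by (rule integral_continuous_on_param)
        (auto simp: split_beta intro!: continuous_intros Mc continuous_on_compose2[OF that])
    then show ?thesis unfolding F_def by (intro continuous_intros) simp
  qed
  have bc: "F (apply_bcontfun v) \<in> bcontfun" for v :: "real \<Rightarrow>\<^sub>C 'd energy"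
  proof -
    have cv: "continuous_on UNIV (apply_bcontfun v)" using apply_bcontfun[of v] by (simp add: bcontfun_def)
    have bv: "norm (apply_bcontfun v s - 0) \<le> norm v" for s using norm_bounded[of v s] by simp
    have F0: "F (\<lambda>_. 0) t = exp (- lam * \<bar>t\<bar>) *\<^sub>R U0" for t by (simp add: F_def M0)
    have "norm (F (apply_bcontfun v) t) \<le> norm U0 + norm v / 2" for t
    proof -
      have "norm (F (apply_bcontfun v) t - F (\<lambda>_. 0) t) \<le> norm v / 2"
        by (rule est[OF cv continuous_on_const bv])
      moreover have "norm (F (\<lambda>_. 0) t) \<le> 1 * norm U0"
        unfolding F0 norm_scaleR using lam by (intro mult_right_mono) auto
      ultimately show ?thesis
        using norm_triangle_sub[of "F (apply_bcontfun v) t" "F (\<lambda>_. 0) t"] by simp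
    qed
    then have "bounded (range (F (apply_bcontfun v)))" by (auto simp: bounded_iff)
    then show ?thesis using fcoeffs[OF cv] by (simp add: bcontfun_def)
  qed
  have "\<exists>!v. Bcontfun (F (apply_bcontfun v)) = v"
  proof (rule banach_fix_type[where c="1/2"])
    show "\<forall>v w. dist (Bcontfun (F (apply_bcontfun v))) (Bcontfun (F (apply_bcontfun w))) \<le> 1 / 2 * dist v w"
    proof (intro allI)
      fix v w :: "real \<Rightarrow>\<^sub>C 'd energy"
      show "dist (Bcontfun (F (apply_bcontfun v))) (Bcontfun (F (apply_bcontfun w))) \<le> 1 / 2 * dist v w"
      proof (rule dist_bound)
        fix t
        have c: "continuous_on UNIV (apply_bcontfun v)" "continuous_on UNIV (apply_bcontfun w)"
          using apply_bcontfun[of v] apply_bcontfun[of w] by (simp_all add: bcontfun_def)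
        have "norm (F (apply_bcontfun v) t - F (apply_bcontfun w) t) \<le> dist v w / 2"
          by (rule est[OF c]) (simp add: dist_bounded flip: dist_norm)
        then show "dist (Bcontfun (F (apply_bcontfun v)) t) (Bcontfun (F (apply_bcontfun w)) t) \<le> 1 / 2 * dist v w"
          by (simp add: Bcontfun_inverse[OF bc] dist_norm)
      qed
    qed
  qed auto
  then obtain v where "Bcontfun (F (apply_bcontfun v)) = v" by blast
  then have fixp: "F (apply_bcontfun v) = apply_bcontfun v" using Bcontfun_inverse[OF bc[of v]] by simp
  have cv: "continuous_on UNIV (apply_bcontfun v)" using apply_bcontfun[of v] by (simp add: bcontfun_def)
  define Z where "Z t = exp (lam * \<bar>t\<bar>) *\<^sub>R apply_bcontfun v t" for t
  have cZ: "continuous_on UNIV Z" unfolding Z_def by (intro continuous_intros cv)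
  have Zeq: "Z t = U0 + oriented_int (\<lambda>s. M s (Z s)) t" for t
  proof -
    have "Z t = exp (lam * \<bar>t\<bar>) *\<^sub>R F (apply_bcontfun v) t" unfolding fixp Z_def ..
    also have "\<dots> = U0 + t *\<^sub>R integral {0..1} (\<lambda>\<theta>. M (t * \<theta>) (Z (t * \<theta>)))"
      by (simp add: F_def Z_def Msc flip: exp_add)
    also have "t *\<^sub>R integral {0..1} (\<lambda>\<theta>. M (t * \<theta>) (Z (t * \<theta>))) = oriented_int (\<lambda>s. M s (Z s)) t"
      by (rule oriented_int_rescale) (intro Mc continuous_intros cZ)
    finally show ?thesis .
  qed
  have "mild_sol K U0 (\<lambda>t. wave_rot t (Z t))"
    unfolding mild_sol_def
  proof
    show "continuous_on UNIV (\<lambda>t. wave_rot t (Z t))" by (intro continuous_on_wave_rot continuous_intros cZ)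
    show "\<forall>t. wave_rot t (Z t) = wave_rot t (U0 + oriented_int (\<lambda>s. wave_rot (- s) (K (wave_rot s (Z s)))) t)"
      by (intro allI arg_cong[OF Zeq[unfolded M_def]])
  qed
  then show ?thesis by (rule that)
qed

lemma mild_sol_integrand_continuous:
  assumes K: "bounded_linear K" and U: "mild_sol K U0 U"
  shows "continuous_on S (\<lambda>s. wave_rot (t - s) (K (U s)))" "continuous_on S (\<lambda>s. wave_rot (- s) (K (U s)))"
  by (intro continuous_on_wave_rot continuous_intros bounded_linear.continuous_on[OF K] msolD(1)[OF U])+

lemma mild_sol_Duhamel:
  assumes K: "bounded_linear K" and U: "mild_sol K U0 U" and t: "t \<ge> 0"
  shows "((\<lambda>s. wave_rot (t - s) (K (U s))) has_integral (U t - wave_rot t U0)) {0..t}"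
proof -
  have "((\<lambda>s. wave_rot (- s) (K (U s))) has_integral integral {0..t} (\<lambda>s. wave_rot (- s) (K (U s)))) {0..t}"
    by (intro integrable_integral integrable_continuous_real mild_sol_integrand_continuous[OF K U])
  from has_integral_linear[OF this wave_rot_bounded_linear[of t]]
  have "((\<lambda>s. wave_rot (t - s) (K (U s))) has_integral wave_rot t (integral {0..t} (\<lambda>s. wave_rot (- s) (K (U s))))) {0..t}"
    by (simp add: o_def flip: wave_rot_add)
  moreover have "wave_rot t (integral {0..t} (\<lambda>s. wave_rot (- s) (K (U s)))) = U t - wave_rot t U0"
    using t by (subst msolD(2)[OF U]) (simp add: oriented_int_def wave_rot_simps)
  ultimately show ?thesis by simp
qed

text \<open>Transfers a coordinate solution back to functions; \<open>flow\<close> asks for some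
  trajectory, so exhibiting this one is enough.\<close>

lemma traj_mild_sol:
  assumes c: "multiplier c" and W0: "Xsp W0" and U: "mild_sol (mult_op c) (coords W0) U"
  shows "traj c W0 (\<lambda>t. uncoords (U t))"
proof -
  note K = mult_op_bounded_linear[OF c]
  have cU: "continuous_on UNIV U" using msolD(1)[OF U] .
  let ?g = "\<lambda>s. wave_rot (- s) (mult_op c (U s))"
  have cont: "((\<lambda>t. snorm (sdiff (uncoords (U t)) (uncoords (U t0)))) \<longlongrightarrow> 0) (at t0)" for t0
  proof -
    have "(U \<longlongrightarrow> U t0) (at t0)" using cU by (simp add: continuous_on_def)
    then have "((\<lambda>t. norm (U t - U t0)) \<longlongrightarrow> 0) (at t0)"
      by (simp add: tendsto_norm_zero_iff LIM_zero_iff)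
    then show ?thesis by (simp add: snorm_sdiff Xsp_uncoords)
  qed
  have duh: "\<exists>I. sint_eq (\<lambda>s. expA (t - s) (mulpot c (uncoords (U s)))) t I \<and>
      snorm (sdiff (uncoords (U t)) (sadd (expA t W0) I)) = 0" for t
  proof (intro exI conjI)
    let ?I = "uncoords (wave_rot t (oriented_int ?g t))"
    have X: "Xsp (expA (t - s) (mulpot c (uncoords (U s))))" and
      T: "coords (expA (t - s) (mulpot c (uncoords (U s)))) = wave_rot t (?g s)" for s
      using expA[OF mulpot_coords(1)[OF c Xsp_uncoords]] mulpot_coords(2)[OF c Xsp_uncoords[of "U s"]] by (simp_all flip: wave_rot_add)
    have hi: "((\<lambda>s. inner (wave_rot t (?g s)) Y) has_integral inner (wave_rot t (integral {a..b} ?g)) Y) {a..b}" for a b Y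
    proof -
      have 1: "(?g has_integral integral {a..b} ?g) {a..b}"
        by (intro integrable_integral integrable_continuous_real mild_sol_integrand_continuous[OF K U])
      have 2: "bounded_linear (\<lambda>x. inner (wave_rot t x) Y)"
        by (rule bounded_linear_compose[OF bounded_linear_inner_left wave_rot_bounded_linear])
      from has_integral_linear[OF 1 2] show ?thesis by (simp only: o_def)
    qed
    \<comment> \<open>The vector-valued integral is characterised by its pairings, and each pairing
      is a bounded linear functional that passes under the integral.\<close>
    show "sint_eq (\<lambda>s. expA (t - s) (mulpot c (uncoords (U s)))) t ?I"
      unfolding sint_eq_def
    proof (intro conjI allI impI Xsp_uncoords)
      fix \<Phi> :: "'a st" assume \<Phi>: "Xsp \<Phi>"
      show "if 0 \<le> t then ((\<lambda>s. sinner (expA (t - s) (mulpot c (uncoords (U s)))) \<Phi>) has_integral sinner ?I \<Phi>) {0..t}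
        else ((\<lambda>s. sinner (expA (t - s) (mulpot c (uncoords (U s)))) \<Phi>) has_integral - sinner ?I \<Phi>) {t..0}"
        using hi[where Y="coords \<Phi>", of 0 t] hi[where Y="coords \<Phi>", of t 0]
        by (simp add: sinner_coords X \<Phi> T Xsp_uncoords oriented_int_def wave_rot_simps)
    qed
    have "coords (sadd (expA t W0) ?I) = wave_rot t (coords W0) + wave_rot t (oriented_int ?g t)" "Xsp (sadd (expA t W0) ?I)"
      using Xsp_sadd[OF expA(1)[OF W0] Xsp_uncoords] expA(2)[OF W0] by simp_all
    moreover have "U t = wave_rot t (coords W0 + oriented_int ?g t)" by (rule msolD(2)[OF U])
    ultimately show "snorm (sdiff (uncoords (U t)) (sadd (expA t W0) ?I)) = 0"
      by (simp add: snorm_sdiff Xsp_uncoords wave_rot_simps)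
  qed
  show ?thesis
    unfolding traj_def using cont duh Xsp_uncoords by blast
qed

section \<open>Growth and continuous dependence of mild solutions\<close>

lemma Gronwall:
  fixes u :: "real \<Rightarrow> real"
  assumes c: "continuous_on {0..T} u" and M: "M \<ge> 0" and t: "0 \<le> t" "t \<le> T"
    and le: "\<And>t. 0 \<le> t \<Longrightarrow> t \<le> T \<Longrightarrow> u t \<le> \<alpha> + M * integral {0..t} u"
  shows "u t \<le> \<alpha> * exp (M * t)"
proof -
  \<comment> \<open>The hypothesis says precisely that this weighted majorant has nonpositive
    derivative.\<close>
  define w where "w s = exp (- M * s) * (\<alpha> + M * integral {0..s} u)" for s
  have ci: "continuous_on {0..T} (\<lambda>s. integral {0..s} u)"
    by (intro indefinite_integral_continuous_1 integrable_continuous_real c)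
  have cw: "continuous_on {0..T} w" unfolding w_def by (intro continuous_intros ci)
  have diag_op: "w t \<le> w 0"
  proof (cases "t = 0")
    case False
    show ?thesis
    proof (rule DERIV_nonpos_imp_decreasing_open[of 0 t w])
      show "0 \<le> t" by (rule t)
      show "continuous_on {0..t} w" using cw t by (auto intro: continuous_on_subset)
      fix x assume x: "0 < x" "x < t"
      then have xi: "x \<in> interior {0..T}" using t by simp
      have "((\<lambda>s. integral {0..s} u) has_real_derivative u x) (at x within {0..T})"
        using x t by (intro integral_has_real_derivative c) auto
      then have d: "((\<lambda>s. integral {0..s} u) has_real_derivative u x) (at x)"
        using at_within_interior[OF xi] by simp
      have "(w has_real_derivative exp (- M * x) * (M * u x) + (exp (- M * x) * (- M)) * (\<alpha> + M * integral {0..x} u)) (at x)"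
        unfolding w_def[abs_def] by (auto intro!: derivative_eq_intros d)
      moreover have "exp (- M * x) * (M * u x) + (exp (- M * x) * (- M)) * (\<alpha> + M * integral {0..x} u)
         = exp (- M * x) * M * (u x - (\<alpha> + M * integral {0..x} u))" by (simp add: algebra_simps)
      moreover have "\<dots> \<le> 0"
        using M le[of x] x t by (intro mult_nonneg_nonpos) auto
      ultimately show "\<exists>y. (w has_real_derivative y) (at x) \<and> y \<le> 0" by auto
    qed
  qed simp
  have "u t \<le> exp (M * t) * w t"
  proof -
    have "exp (M * t) * w t = (exp (M * t) * exp (- M * t)) * (\<alpha> + M * integral {0..t} u)"
      by (simp only: w_def mult.assoc)
    also have "exp (M * t) * exp (- M * t) = 1" by (simp flip: exp_add)
    finally show ?thesis using le[OF t] by simp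
  qed
  also have "\<dots> \<le> exp (M * t) * w 0" using diag_op by (intro mult_left_mono) auto
  finally show ?thesis by (simp add: w_def mult.commute)
qed

lemma mild_sol_bound:
  assumes K: "bounded_linear K" and B: "B \<ge> 0" "\<And>U. norm (K U) \<le> B * norm U" and U: "mild_sol K U0 U" and t: "t \<ge> 0"
  shows "norm (U t) \<le> norm U0 * exp (B * t)"
proof (rule Gronwall[OF _ B(1) t order_refl])
  note cU = msolD(1)[OF U]
  show "continuous_on {0..t} (\<lambda>t. norm (U t))" by (intro continuous_intros cU)
  fix s assume s: "0 \<le> s" "s \<le> t"
  note D = mild_sol_Duhamel[OF K U s(1)]
  have "norm (U s - wave_rot s U0) \<le> integral {0..s} (\<lambda>r. B * norm (U r))"
    unfolding integral_unique[OF D, symmetric]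
  proof (rule integral_norm_bound_integral)
    show "(\<lambda>r. wave_rot (s - r) (K (U r))) integrable_on {0..s}" using D by blast
    show "(\<lambda>r. B * norm (U r)) integrable_on {0..s}"
      by (intro integrable_continuous_real continuous_intros cU)
  qed (simp add: B)
  then show "norm (U s) \<le> norm U0 + B * integral {0..s} (\<lambda>t. norm (U t))"
    using norm_triangle_sub[of "U s" "wave_rot s U0"] by simp
qed

text \<open>Linearity reduces continuous dependence on the initial state to the growth
  bound.\<close>

lemma mild_sol_diff:
  assumes K: "bounded_linear K" and U: "mild_sol K U0 U" and V: "mild_sol K V0 V"
  shows "mild_sol K (U0 - V0) (\<lambda>t. U t - V t)"
  unfolding mild_sol_def
proof (intro conjI allI)
  show "continuous_on UNIV (\<lambda>t. U t - V t)" by (intro continuous_intros msolD(1)[OF U] msolD(1)[OF V])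
  fix t
  have i: "(\<lambda>s. wave_rot (- s) (K (U s))) integrable_on {a..b}" "(\<lambda>s. wave_rot (- s) (K (V s))) integrable_on {a..b}" for a b
    by (intro integrable_continuous_real mild_sol_integrand_continuous[OF K U] mild_sol_integrand_continuous[OF K V])+
  have "oriented_int (\<lambda>s. wave_rot (- s) (K (U s - V s))) t = oriented_int (\<lambda>s. wave_rot (- s) (K (U s))) t - oriented_int (\<lambda>s. wave_rot (- s) (K (V s))) t"
    by (simp add: oriented_int_def linear_simps[OF K] wave_rot_simps integral_diff[OF i])
  moreover have "U t = wave_rot t (U0 + oriented_int (\<lambda>s. wave_rot (- s) (K (U s))) t)" "V t = wave_rot t (V0 + oriented_int (\<lambda>s. wave_rot (- s) (K (V s))) t)"
    by (rule msolD(2)[OF U], rule msolD(2)[OF V])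
  ultimately show "U t - V t = wave_rot t (U0 - V0 + oriented_int (\<lambda>s. wave_rot (- s) (K (U s - V s))) t)"
    by (simp only: wave_rot_simps) (simp add: algebra_simps)
qed

subsection \<open>Reachability in coefficients\<close>

definition energy_step :: "(real^'d::finite \<Rightarrow> real) \<Rightarrow> real \<Rightarrow> 'd energy \<Rightarrow> 'd energy \<Rightarrow> bool" where
  "energy_step c \<tau> U0 U1 \<longleftrightarrow> (\<exists>U. mild_sol (mult_op c) U0 U \<and> U1 = U \<tau>)"

fun energy_run :: "(real^'d::finite \<Rightarrow> real) \<Rightarrow> (real \<times> real \<times> (real^'d) \<times> (real^'d)) list \<Rightarrow> 'd energy \<Rightarrow> 'd energy \<Rightarrow> bool" where
  "energy_run V [] U0 U1 \<longleftrightarrow> U1 = U0"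
| "energy_run V ((\<tau>, u0, us, uc) # cs) U0 U2 \<longleftrightarrow> (\<exists>U1. energy_step (pot V u0 us uc) \<tau> U0 U1 \<and> energy_run V cs U1 U2)"

definition ctrl :: "real \<Rightarrow> real^'d \<Rightarrow> real^'d::finite \<Rightarrow> real^'d \<Rightarrow> real" where
  "ctrl u0 us uc x = u0 + (\<Sum>j\<in>UNIV. us $ j * sin (x $ j) + uc $ j * cos (x $ j))"

lemma pot_ctrl: "pot V u0 us uc = (\<lambda>x. V x + ctrl u0 us uc x)"
  by (simp add: fun_eq_iff pot_def ctrl_def)

lemma ctrl_trigpoly: "ctrl u0 us uc \<in> trigpoly"
  unfolding ctrl_def[abs_def]
  by (intro trigpoly.add trigpoly_const trigpoly_sum trigpoly.scale trigpoly_coord)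

lemma trigpoly_multiplier:
  assumes "f \<in> trigpoly" shows "multiplier f"
proof -
  note c = trigpoly_continuous[OF assms]
  obtain B where "\<And>x. x \<in> Qcube \<Longrightarrow> \<bar>f x\<bar> \<le> B" using cube_continuous_bounded[OF c] by blast
  then show ?thesis by (rule multiplier_bounded[OF cube_continuous_measurable[OF c]])
qed

lemma pot_multiplier: "multiplier V \<Longrightarrow> multiplier (pot V u0 us uc)"
  unfolding pot_ctrl by (rule multiplier_add[OF _ trigpoly_multiplier[OF ctrl_trigpoly]])

lemma energy_run_run:
  assumes V: "multiplier V"
  shows "Xsp W0 \<Longrightarrow> energy_run V cs (coords W0) U1 \<Longrightarrow> \<exists>W1. run V cs W0 W1 \<and> Xsp W1 \<and> coords W1 = U1"
proof (induction cs arbitrary: W0)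
  case Nil then show ?case by auto
next
  case (Cons p cs)
  obtain \<tau> u0 us uc where p: "p = (\<tau>, u0, us, uc)" by (cases p)
  obtain U where U: "mild_sol (mult_op (pot V u0 us uc)) (coords W0) U" "energy_run V cs (U \<tau>) U1"
    using Cons.prems(2) by (auto simp: p energy_step_def)
  have "flow (pot V u0 us uc) \<tau> W0 (uncoords (U \<tau>))"
    unfolding flow_def using traj_mild_sol[OF pot_multiplier[OF V] Cons.prems(1) U(1)] by blast
  moreover obtain W1 where W1: "run V cs (uncoords (U \<tau>)) W1" "Xsp W1" "coords W1 = U1"
    using Cons.IH[OF Xsp_uncoords[of "U \<tau>"]] U(2) by auto
  ultimately have "run V (p # cs) W0 W1" unfolding p run.simps by blast
  then show ?case using W1 by blast
qed

lemma energy_step_continuous: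
  assumes c: "multiplier c" and \<tau>: "\<tau> > 0" and st: "energy_step c \<tau> U0 U1" and e: "e > 0"
  shows "\<exists>d>0. \<forall>V0. norm (V0 - U0) < d \<longrightarrow> (\<exists>V1. energy_step c \<tau> V0 V1 \<and> norm (V1 - U1) < e)"
proof -
  note K = mult_op_bounded_linear[OF c]
  obtain B where B: "B > 0" "\<And>U. norm (mult_op c U) \<le> norm U * B" using bounded_linear.pos_bounded[OF K] by blast
  obtain U where U: "mild_sol (mult_op c) U0 U" "U1 = U \<tau>" using st by (auto simp: energy_step_def)
  have "\<exists>V1. energy_step c \<tau> V0 V1 \<and> norm (V1 - U1) < e" if V0: "norm (V0 - U0) < e * exp (- B * \<tau>)" for V0
  proof -
    obtain V where V: "mild_sol (mult_op c) V0 V" using mild_sol_exists[OF K] .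
    have "norm (V \<tau> - U \<tau>) \<le> norm (V0 - U0) * exp (B * \<tau>)"
      using B \<tau> by (intro mild_sol_bound[OF K _ _ mild_sol_diff[OF K V U(1)]]) (auto simp: mult.commute)
    also have "\<dots> < e * exp (- B * \<tau>) * exp (B * \<tau>)" using V0 by (intro mult_strict_right_mono) auto
    also have "\<dots> = e" by (simp add: exp_minus)
    finally show ?thesis using V unfolding energy_step_def U(2) by blast
  qed
  then show ?thesis using e by (intro exI[of _ "e * exp (- B * \<tau>)"]) auto
qed

text \<open>A leg that ends only near its target must not spoil the next one: the same controls
  started nearby still end nearby.\<close>

lemma energy_run_continuous:
  assumes V: "multiplier V"
  shows "(\<forall>p\<in>set cs. fst p > 0) \<Longrightarrow> energy_run V cs U0 U1 \<Longrightarrow> e > 0 \<Longrightarrow>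
    \<exists>d>0. \<forall>V0. norm (V0 - U0) < d \<longrightarrow> (\<exists>V1. energy_run V cs V0 V1 \<and> norm (V1 - U1) < e)"
proof (induction cs arbitrary: U0)
  case Nil then show ?case by auto
next
  case (Cons p cs)
  obtain \<tau> u0 us uc where p: "p = (\<tau>, u0, us, uc)" by (cases p)
  obtain U' where U': "energy_step (pot V u0 us uc) \<tau> U0 U'" "energy_run V cs U' U1"
    using Cons.prems(2) by (auto simp: p)
  obtain d where d: "d > 0" "\<And>V0. norm (V0 - U') < d \<Longrightarrow> \<exists>V1. energy_run V cs V0 V1 \<and> norm (V1 - U1) < e"
    using Cons.IH[OF _ U'(2) Cons.prems(3)] Cons.prems(1) by auto
  obtain d' where d': "d' > 0" "\<And>V0. norm (V0 - U0) < d' \<Longrightarrow> \<exists>V1. energy_step (pot V u0 us uc) \<tau> V0 V1 \<and> norm (V1 - U') < d"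
    using energy_step_continuous[OF pot_multiplier[OF V] _ U'(1) d(1)] Cons.prems(1) by (auto simp: p)
  have "\<exists>V1. energy_run V (p # cs) V0 V1 \<and> norm (V1 - U1) < e" if "norm (V0 - U0) < d'" for V0
    using d'(2)[OF that] d(2) by (fastforce simp: p)
  then show ?case using d'(1) by blast
qed

lemma energy_run_append: "energy_run V cs U0 U1 \<Longrightarrow> energy_run V cs' U1 U2 \<Longrightarrow> energy_run V (cs @ cs') U0 U2"
proof (induction cs arbitrary: U0)
  case (Cons p cs) then show ?case by (cases p) auto
qed simp

text \<open>The slack \<open>e\<close> in the duration as well as in the state makes the relation
  composable and closed under limits; \<open>T = 0\<close> is small-time reachability.\<close>

definition reach :: "(real^'d::finite \<Rightarrow> real) \<Rightarrow> real \<Rightarrow> 'd energy \<Rightarrow> 'd energy \<Rightarrow> bool" where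
  "reach V T U0 U1 \<longleftrightarrow> (\<forall>e>0. \<exists>cs Ue. (\<forall>p\<in>set cs. fst p > 0) \<and> sum_list (map fst cs) \<le> T + e \<and>
     energy_run V cs U0 Ue \<and> norm (Ue - U1) < e)"

lemma reach_trans:
  assumes V: "multiplier V" and r1: "reach V T U0 U1" and r2: "reach V T' U1 U2"
  shows "reach V (T + T') U0 U2"
  unfolding reach_def
proof (intro allI impI)
  fix e :: real assume e: "e > 0"
  obtain cs2 X2 where 2: "\<forall>p\<in>set cs2. fst p > 0" "sum_list (map fst cs2) \<le> T' + e / 2" "energy_run V cs2 U1 X2" "norm (X2 - U2) < e / 2"
    using r2 e unfolding reach_def by (metis half_gt_zero)
  obtain d where d: "d > 0" "\<And>V0. norm (V0 - U1) < d \<Longrightarrow> \<exists>V1. energy_run V cs2 V0 V1 \<and> norm (V1 - X2) < e / 2"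
    using energy_run_continuous[OF V 2(1,3), of "e / 2"] e by auto
  have "min d (e / 2) > 0" using d e by simp
  then obtain cs1 X1 where 1: "\<forall>p\<in>set cs1. fst p > 0" "sum_list (map fst cs1) \<le> T + min d (e / 2)" "energy_run V cs1 U0 X1" "norm (X1 - U1) < min d (e / 2)"
    using r1 unfolding reach_def by blast
  obtain Y where Y: "energy_run V cs2 X1 Y" "norm (Y - X2) < e / 2" using d(2)[of X1] 1(4) by auto
  have "norm (Y - U2) < e" using norm_triangle_ineq[of "Y - X2" "X2 - U2"] Y(2) 2(4) by simp
  moreover have "sum_list (map fst (cs1 @ cs2)) \<le> T + T' + e" using 1(2) 2(2) by simp
  moreover have "\<forall>p\<in>set (cs1 @ cs2). fst p > 0" using 1(1) 2(1) by auto
  ultimately show "\<exists>cs Ue. (\<forall>p\<in>set cs. fst p > 0) \<and> sum_list (map fst cs) \<le> T + T' + e \<and> energy_run V cs U0 Ue \<and> norm (Ue - U2) < e"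
    using energy_run_append[OF 1(3) Y(1)] by blast
qed

text \<open>The device for all impulsive limits: nearby states reached in times of order
  \<open>e\<close> are enough.\<close>

lemma reach_limit:
  assumes "\<And>e. e > 0 \<Longrightarrow> \<exists>T U. T \<le> e \<and> reach V T U0 U \<and> norm (U - U1) < e"
  shows "reach V 0 U0 U1"
  unfolding reach_def
proof (intro allI impI)
  fix e :: real assume e: "e > 0"
  then obtain T U where T: "T \<le> e / 2" "reach V T U0 U" "norm (U - U1) < e / 2" using assms[of "e / 2"] by auto
  obtain cs X where cs: "\<forall>p\<in>set cs. fst p > 0" "sum_list (map fst cs) \<le> T + e / 2" "energy_run V cs U0 X" "norm (X - U) < e / 2"
    using T(2) e unfolding reach_def by (metis half_gt_zero)
  have "norm (X - U1) < e" using norm_triangle_ineq[of "X - U" "U - U1"] T(3) cs(4) by simp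
  then show "\<exists>cs Ue. (\<forall>p\<in>set cs. fst p > 0) \<and> sum_list (map fst cs) \<le> 0 + e \<and> energy_run V cs U0 Ue \<and> norm (Ue - U1) < e"
    using cs T(1) by (intro exI[of _ cs] exI[of _ X]) auto
qed

lemma reach_step:
  assumes "energy_step (pot V u0 us uc) \<tau> U0 U1" "\<tau> > 0"
  shows "reach V \<tau> U0 U1"
proof -
  have "energy_run V [(\<tau>, u0, us, uc)] U0 U1" unfolding energy_run.simps using assms(1) by blast
  then show ?thesis
    unfolding reach_def using assms(2)
    by (intro allI impI exI[of _ "[(\<tau>, u0, us, uc)]"] exI[of _ U1]) simp
qed

lemma reach_approx_reachable:
  assumes V: "multiplier V" and W0: "Xsp W0" and Wf: "Xsp Wf" and r: "reach V 0 (coords W0) (coords Wf)"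
  shows "approx_reachable V 0 W0 Wf"
  unfolding approx_reachable_def
proof (intro allI impI)
  fix e :: real assume "e > 0"
  then obtain cs X where cs: "\<forall>p\<in>set cs. fst p > 0" "sum_list (map fst cs) \<le> 0 + e" "energy_run V cs (coords W0) X" "norm (X - coords Wf) < e"
    using r unfolding reach_def by blast
  obtain W1 where W1: "run V cs W0 W1" "Xsp W1" "coords W1 = X" using energy_run_run[OF V W0 cs(3)] by blast
  have "0 \<le> sum_list (map fst cs)" using cs(1) by (intro sum_list_nonneg) (auto intro: less_imp_le)
  then show "\<exists>cs Wend. (\<forall>p\<in>set cs. fst p > 0) \<and> 0 \<le> sum_list (map fst cs) \<and> sum_list (map fst cs) \<le> 0 + e \<and>
      run V cs W0 Wend \<and> snorm (sdiff Wend Wf) < e"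
    using cs W1 Wf by (intro exI[of _ cs] exI[of _ W1]) (auto simp: snorm_sdiff)
qed

subsection \<open>Impulsive limits\<close>

lemma mult_op_cong_fst: "fst U = fst V \<Longrightarrow> mult_op c U = mult_op c V"
  by (simp add: mult_op_def uncoords_def)

lemma fst_mult_op[simp]: "fst (mult_op c U) = 0"
  by (simp add: mult_op_def)

text \<open>Multiplication reads the position and writes only the velocity, so products vanish.
  Consequently impulses compose by adding their profiles.\<close>

lemma mult_op_mult_op: "multiplier c \<Longrightarrow> mult_op c (mult_op c' U) = 0"
proof -
  assume c: "multiplier c"
  have "mult_op c (mult_op c' U) = mult_op c 0" by (rule mult_op_cong_fst) simp
  then show ?thesis using linear_simps(3)[OF mult_op_bounded_linear[OF c]] by simp
qed

lemma wave_rot_small: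
  assumes "e > 0"
  shows "\<exists>\<delta>>0. \<forall>h. \<bar>h\<bar> \<le> \<delta> \<longrightarrow> norm (wave_rot h U - U) \<le> e"
proof -
  have "((\<lambda>h. wave_rot h U) \<longlongrightarrow> U) (at 0)" using wave_rot_isCont[of 0 U] by (simp add: isCont_def)
  then obtain d where d: "d > 0" "\<And>h. h \<noteq> 0 \<Longrightarrow> dist h 0 < d \<Longrightarrow> dist (wave_rot h U) U < e"
    using assms unfolding tendsto_iff eventually_at by (metis UNIV_I)
  have "norm (wave_rot h U - U) \<le> e" if "\<bar>h\<bar> \<le> d / 2" for h
  proof (cases "h = 0")
    case False
    then show ?thesis using d(2)[of h] that d(1) by (simp add: dist_norm)
  qed (use assms in simp)
  then show ?thesis using d(1) by (intro exI[of _ "d / 2"]) auto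
qed

text \<open>Nilpotency makes the exponential of the impulse equal to identity plus
  \<open>mult_op \<phi>\<close>; it must be approximable in small time from every state.\<close>

definition attainable :: "(real^'d::finite \<Rightarrow> real) \<Rightarrow> (real^'d \<Rightarrow> real) \<Rightarrow> bool" where
  "attainable V \<phi> \<longleftrightarrow> \<phi> \<in> trigpoly \<and> (\<forall>U. reach V 0 U (U + mult_op \<phi> U))"

lemma ctrl_scale: "ctrl (a * u0) (a *\<^sub>R us) (a *\<^sub>R uc) = (\<lambda>x. a * ctrl u0 us uc x)"
  by (simp add: fun_eq_iff ctrl_def distrib_left sum_distrib_left mult.assoc)

text \<open>The solution is compared with the straight line from \<open>U0\<close> to
  \<open>U0 + mult_op \<phi> U0\<close>. The Gronwall rate is of order 1/\<tau>, but it acts only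
  for a time \<tau>, so the exponential stays bounded.\<close>

lemma impulse_estimate:
  fixes U :: "real \<Rightarrow> 'd::finite energy"
  assumes V: "multiplier V" and \<phi>: "multiplier \<phi>" and \<tau>: "0 < \<tau>" "\<tau> \<le> 1" and \<eta>: "\<eta> \<ge> 0"
    and BV: "BV \<ge> 0" "\<And>X. norm (mult_op V X) \<le> BV * norm X"
    and Bp: "Bp \<ge> 0" "\<And>X. norm (mult_op \<phi> X) \<le> Bp * norm X"
    and U: "mild_sol (mult_op (\<lambda>x. V x + 1 / \<tau> * \<phi> x)) U0 U"
    and sm: "\<And>h. 0 \<le> h \<Longrightarrow> h \<le> \<tau> \<Longrightarrow> norm (wave_rot h U0 - U0) \<le> \<eta>"
      "\<And>h. 0 \<le> h \<Longrightarrow> h \<le> \<tau> \<Longrightarrow> norm (wave_rot h (mult_op \<phi> U0) - mult_op \<phi> U0) \<le> \<eta>"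
  shows "norm (U \<tau> - (U0 + mult_op \<phi> U0)) \<le> (2 * \<eta> + \<tau> * (BV * (norm U0 + norm (mult_op \<phi> U0)))) * exp (BV + Bp)"
proof -
  let ?k = "mult_op \<phi> U0"
  define P where "P = norm U0 + norm ?k"
  note KV = mult_op_bounded_linear[OF V] and Kp = mult_op_bounded_linear[OF \<phi>]
  note m\<phi> = multiplier_scale[OF \<phi>, of "1 / \<tau>"]
  have mc: "multiplier (\<lambda>x. V x + 1 / \<tau> * \<phi> x)" by (rule multiplier_add[OF V m\<phi>])
  note Kc = mult_op_bounded_linear[OF mc]
  have Kc_eq: "mult_op (\<lambda>x. V x + 1 / \<tau> * \<phi> x) X = mult_op V X + (1 / \<tau>) *\<^sub>R mult_op \<phi> X" for X
    by (simp only: mult_op_add[OF V m\<phi>] mult_op_scale[OF \<phi>])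
  define D where "D t = U t - (U0 + (t / \<tau>) *\<^sub>R ?k)" for t
  note cU = msolD(1)[OF U]
  have cD: "continuous_on S D" for S unfolding D_def[abs_def] using \<tau> by (intro continuous_intros cU) auto
  \<comment> \<open>Along the straight line the control term is constant in time, because
    \<open>\<phi>\<close> annihilates the velocity increment.\<close>
  have KpU: "mult_op \<phi> (U s) = mult_op \<phi> (D s) + ?k" for s
    by (simp add: D_def linear_simps[OF Kp] mult_op_mult_op[OF \<phi>])
  have Ub: "norm (U s) \<le> norm (D s) + P" if "0 \<le> s" "s \<le> \<tau>" for s
  proof -
    have eq: "U s = D s + (U0 + (s / \<tau>) *\<^sub>R ?k)" by (simp add: D_def)
    have "norm (U s) \<le> norm (D s) + (norm U0 + norm ((s / \<tau>) *\<^sub>R ?k))"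
      unfolding eq by (intro order_trans[OF norm_triangle_ineq] add_left_mono norm_triangle_ineq)
    moreover have "norm ((s / \<tau>) *\<^sub>R ?k) \<le> 1 * norm ?k"
      unfolding norm_scaleR using that \<tau> by (intro mult_right_mono) auto
    ultimately show ?thesis by (simp add: P_def)
  qed
  have ineq: "norm (D t) \<le> (2 * \<eta> + \<tau> * (BV * P)) + (BV + Bp / \<tau>) * integral {0..t} (\<lambda>s. norm (D s))"
    if t: "0 \<le> t" "t \<le> \<tau>" for t
  proof -
    let ?F = "\<lambda>s. wave_rot (t - s) (mult_op (\<lambda>x. V x + 1 / \<tau> * \<phi> x) (U s)) - (1 / \<tau>) *\<^sub>R ?k"
    let ?G = "\<lambda>s. (BV * P + \<eta> / \<tau>) + (BV + Bp / \<tau>) * norm (D s)"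
    have hF: "(?F has_integral (U t - wave_rot t U0) - (t / \<tau>) *\<^sub>R ?k) {0..t}"
      using has_integral_diff[OF mild_sol_Duhamel[OF Kc U t(1)] has_integral_const_real[of "(1 / \<tau>) *\<^sub>R ?k" 0 t]] t by simp
    have iG: "?G integrable_on {0..t}" by (intro integrable_continuous_real continuous_intros cD)
    have "norm ((U t - wave_rot t U0) - (t / \<tau>) *\<^sub>R ?k) \<le> integral {0..t} ?G"
      unfolding integral_unique[OF hF, symmetric]
    proof (rule integral_norm_bound_integral[OF has_integral_integrable[OF hF] iG])
      fix s assume s: "s \<in> {0..t}"
      have "?F s = wave_rot (t - s) (mult_op V (U s)) + (1 / \<tau>) *\<^sub>R (wave_rot (t - s) (mult_op \<phi> (D s)) + (wave_rot (t - s) ?k - ?k))"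
        by (simp only: Kc_eq KpU wave_rot_simps scaleR_add_right scaleR_diff_right add_diff_eq diff_add_eq add.assoc)
      also have "norm \<dots> \<le> norm (mult_op V (U s)) + (1 / \<tau>) * (norm (mult_op \<phi> (D s)) + norm (wave_rot (t - s) ?k - ?k))"
      proof -
        have "norm (wave_rot (t - s) (mult_op V (U s)) + (1 / \<tau>) *\<^sub>R (wave_rot (t - s) (mult_op \<phi> (D s)) + (wave_rot (t - s) ?k - ?k)))
          \<le> norm (mult_op V (U s)) + norm ((1 / \<tau>) *\<^sub>R (wave_rot (t - s) (mult_op \<phi> (D s)) + (wave_rot (t - s) ?k - ?k)))"
          by (rule order_trans[OF norm_triangle_ineq]) simp
        moreover have "norm ((1 / \<tau>) *\<^sub>R (wave_rot (t - s) (mult_op \<phi> (D s)) + (wave_rot (t - s) ?k - ?k))) \<le> (1 / \<tau>) * (norm (mult_op \<phi> (D s)) + norm (wave_rot (t - s) ?k - ?k))"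
          unfolding norm_scaleR using \<tau> by (intro mult_mono order_trans[OF norm_triangle_ineq]) auto
        ultimately show ?thesis by linarith
      qed
      also have "\<dots> \<le> BV * (norm (D s) + P) + (1 / \<tau>) * (Bp * norm (D s) + \<eta>)"
      proof (intro add_mono mult_left_mono)
        show "norm (mult_op V (U s)) \<le> BV * (norm (D s) + P)"
          using s t by (intro order_trans[OF BV(2)] mult_left_mono Ub BV) auto
        show "norm (wave_rot (t - s) ?k - ?k) \<le> \<eta>" using s t by (intro sm) auto
      qed (use \<tau> Bp in auto)
      also have "\<dots> = ?G s" by (simp add: algebra_simps add_divide_distrib)
      finally show "norm (?F s) \<le> ?G s" .
    qed
    also have "integral {0..t} ?G = t * (BV * P + \<eta> / \<tau>) + (BV + Bp / \<tau>) * integral {0..t} (\<lambda>s. norm (D s))"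
    proof -
      have "(\<lambda>s. norm (D s)) integrable_on {0..t}" by (intro integrable_continuous_real continuous_intros cD)
      then have "(?G has_integral (t * (BV * P + \<eta> / \<tau>) + (BV + Bp / \<tau>) * integral {0..t} (\<lambda>s. norm (D s)))) {0..t}"
        using has_integral_const_real[of "BV * P + \<eta> / \<tau>" 0 t] t
        by (intro has_integral_add has_integral_mult_right integrable_integral) auto
      then show ?thesis by (rule integral_unique)
    qed
    also have "t * (BV * P + \<eta> / \<tau>) \<le> \<tau> * (BV * P + \<eta> / \<tau>)"
      using t \<tau> BV \<eta> by (intro mult_right_mono) (auto simp: P_def)
    also have "\<tau> * (BV * P + \<eta> / \<tau>) = \<tau> * (BV * P) + \<eta>" using \<tau> by (simp add: distrib_left)
    finally have 1: "norm ((U t - wave_rot t U0) - (t / \<tau>) *\<^sub>R ?k) \<le> \<tau> * (BV * P) + \<eta> + (BV + Bp / \<tau>) * integral {0..t} (\<lambda>s. norm (D s))"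
      by simp
    have "D t = ((U t - wave_rot t U0) - (t / \<tau>) *\<^sub>R ?k) + (wave_rot t U0 - U0)" by (simp add: D_def)
    then have "norm (D t) \<le> norm ((U t - wave_rot t U0) - (t / \<tau>) *\<^sub>R ?k) + norm (wave_rot t U0 - U0)"
      by (simp only: norm_triangle_ineq)
    then show ?thesis using 1 sm(1)[OF t] by linarith
  qed
  have "norm (D \<tau>) \<le> (2 * \<eta> + \<tau> * (BV * P)) * exp ((BV + Bp / \<tau>) * \<tau>)"
  proof (rule Gronwall[where T=\<tau>])
    show "continuous_on {0..\<tau>} (\<lambda>t. norm (D t))" by (intro continuous_intros cD)
  qed (use \<tau> BV Bp ineq in auto)
  also have "\<dots> \<le> (2 * \<eta> + \<tau> * (BV * P)) * exp (BV + Bp)"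
  proof (rule mult_left_mono)
    have "BV * \<tau> \<le> BV * 1" using \<tau> BV by (intro mult_left_mono) auto
    then show "exp ((BV + Bp / \<tau>) * \<tau>) \<le> exp (BV + Bp)" using \<tau> by (simp add: distrib_right)
    show "0 \<le> 2 * \<eta> + \<tau> * (BV * P)" using \<tau> \<eta> BV by (simp add: P_def)
  qed
  finally show ?thesis using \<tau> by (simp add: D_def P_def)
qed

lemma mult_op_bound:
  assumes "multiplier c" obtains B where "B \<ge> 0" "\<And>X. norm (mult_op c X) \<le> B * norm X"
proof -
  obtain B where "B > 0" "\<And>X. norm (mult_op c X) \<le> norm X * B"
    using bounded_linear.pos_bounded[OF mult_op_bounded_linear[OF assms]] by blast
  then show ?thesis using that[of B] by (simp add: mult.commute)
qed

lemma attainable_ctrl: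
  assumes V: "multiplier V" shows "attainable V (ctrl u0 us uc)"
  unfolding attainable_def
proof (intro conjI allI ctrl_trigpoly)
  fix U0 :: "'a energy"
  let ?\<phi> = "ctrl u0 us uc" and ?k = "mult_op (ctrl u0 us uc) U0"
  have \<phi>: "multiplier ?\<phi>" by (rule trigpoly_multiplier[OF ctrl_trigpoly])
  obtain BV where BV: "BV \<ge> 0" "\<And>X. norm (mult_op V X) \<le> BV * norm X" using mult_op_bound[OF V] by blast
  obtain Bp where Bp: "Bp \<ge> 0" "\<And>X. norm (mult_op ?\<phi> X) \<le> Bp * norm X" using mult_op_bound[OF \<phi>] by blast
  show "reach V 0 U0 (U0 + ?k)"
  proof (rule reach_limit)
    fix e :: real assume e: "e > 0"
    define E where "E = exp (BV + Bp)"
    define P where "P = norm U0 + norm ?k"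
    have E: "E > 0" and P: "P \<ge> 0" by (simp_all add: E_def P_def)
    define \<eta> where "\<eta> = e / (8 * E)"
    have \<eta>: "\<eta> > 0" using e E by (simp add: \<eta>_def)
    obtain \<delta>1 where \<delta>1: "\<delta>1 > 0" "\<And>h. \<bar>h\<bar> \<le> \<delta>1 \<Longrightarrow> norm (wave_rot h U0 - U0) \<le> \<eta>" using wave_rot_small[OF \<eta>] by blast
    obtain \<delta>2 where \<delta>2: "\<delta>2 > 0" "\<And>h. \<bar>h\<bar> \<le> \<delta>2 \<Longrightarrow> norm (wave_rot h ?k - ?k) \<le> \<eta>" using wave_rot_small[OF \<eta>] by blast
    \<comment> \<open>The first two bounds come from strong continuity on the two relevant states,
      \<open>e\<close> limits the duration, and the last one makes the contribution of
      \<open>V\<close> at most \<open>e / 4\<close>; the added 1 avoids division by zero.\<close>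
    define \<tau> where "\<tau> = min (min \<delta>1 \<delta>2) (min (min 1 e) (e / (4 * E * (BV * P + 1))))"
    have pos: "E * (BV * P + 1) > 0" using E BV P by (simp add: add_nonneg_pos)
    have \<tau>: "\<tau> > 0" "\<tau> \<le> 1" "\<tau> \<le> e" "\<tau> \<le> \<delta>1" "\<tau> \<le> \<delta>2" "\<tau> \<le> e / (4 * E * (BV * P + 1))"
      using \<delta>1 \<delta>2 e pos by (auto simp: \<tau>_def mult.assoc)
    have ceq: "pot V (1 / \<tau> * u0) ((1 / \<tau>) *\<^sub>R us) ((1 / \<tau>) *\<^sub>R uc) = (\<lambda>x. V x + 1 / \<tau> * ?\<phi> x)"
      unfolding pot_ctrl ctrl_scale ..
    obtain U where U: "mild_sol (mult_op (pot V (1 / \<tau> * u0) ((1 / \<tau>) *\<^sub>R us) ((1 / \<tau>) *\<^sub>R uc))) U0 U"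
      using mild_sol_exists[OF mult_op_bounded_linear[OF pot_multiplier[OF V]]] by blast
    have "norm (U \<tau> - (U0 + ?k)) \<le> (2 * \<eta> + \<tau> * (BV * (norm U0 + norm ?k))) * exp (BV + Bp)"
    proof (rule impulse_estimate[OF V \<phi> \<tau>(1,2) _ BV Bp U[unfolded ceq]])
      show "norm (wave_rot h U0 - U0) \<le> \<eta>" if "0 \<le> h" "h \<le> \<tau>" for h using \<delta>1(2)[of h] that \<tau> by simp
      show "norm (wave_rot h ?k - ?k) \<le> \<eta>" if "0 \<le> h" "h \<le> \<tau>" for h using \<delta>2(2)[of h] that \<tau> by simp
    qed (use \<eta> in simp)
    also have "\<dots> = 2 * \<eta> * E + \<tau> * (E * (BV * P))" by (simp add: E_def P_def algebra_simps)
    also have "\<dots> \<le> e / 4 + e / 4"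
    proof (rule add_mono)
      show "2 * \<eta> * E \<le> e / 4" using E by (simp add: \<eta>_def)
      have "\<tau> * (E * (BV * P)) \<le> \<tau> * (E * (BV * P + 1))"
        using \<tau>(1) E by (intro mult_left_mono) auto
      also have "\<dots> \<le> e / (4 * E * (BV * P + 1)) * (E * (BV * P + 1))"
        using pos \<tau>(6) by (intro mult_right_mono) auto
      also have "\<dots> = e / 4"
      proof -
        have "x / (4 * y * z) * (y * z) = x / 4" if "y * z > 0" for x y z :: real
          using that by (auto simp: field_simps)
        then show ?thesis using pos by blast
      qed
      finally show "\<tau> * (E * (BV * P)) \<le> e / 4" .
    qed
    finally have "norm (U \<tau> - (U0 + ?k)) < e" using e by simp
    moreover have "reach V \<tau> U0 (U \<tau>)"
      by (rule reach_step[OF _ \<tau>(1)]) (use U in \<open>unfold energy_step_def, blast\<close>)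
    ultimately show "\<exists>T U. T \<le> e \<and> reach V T U0 U \<and> norm (U - (U0 + ?k)) < e" using \<tau>(3) by blast
  qed
qed

lemma attainable_add:
  assumes V: "multiplier V" and g: "attainable V \<phi>" "attainable V \<psi>"
  shows "attainable V (\<lambda>x. \<phi> x + \<psi> x)"
  unfolding attainable_def
proof (intro conjI allI)
  show "(\<lambda>x. \<phi> x + \<psi> x) \<in> trigpoly" using g by (auto simp: attainable_def intro: trigpoly.add)
  fix U :: "'a energy"
  have m: "multiplier \<phi>" "multiplier \<psi>" using g by (auto simp: attainable_def intro: trigpoly_multiplier)
  have "reach V (0 + 0) U ((U + mult_op \<phi> U) + mult_op \<psi> (U + mult_op \<phi> U))"
    using g unfolding attainable_def by (intro reach_trans[OF V]) blast+
  moreover have "(U + mult_op \<phi> U) + mult_op \<psi> (U + mult_op \<phi> U) = U + mult_op (\<lambda>x. \<phi> x + \<psi> x) U"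
    by (simp add: linear_simps[OF mult_op_bounded_linear[OF m(2)]] mult_op_mult_op[OF m(2)] mult_op_add[OF m])
  ultimately show "reach V 0 U (U + mult_op (\<lambda>x. \<phi> x + \<psi> x) U)" by simp
qed

subsection \<open>Multiplication by trigonometric polynomials\<close>

definition mult_l2 :: "(real^'d::finite \<Rightarrow> real) \<Rightarrow> ('d \<Rightarrow> int) l2 \<Rightarrow> ('d \<Rightarrow> int) l2" where
  "mult_l2 c y = fcoeffs (\<lambda>x. c x * fsynth y x)"

lemma trigpoly_times_bound:
  assumes c: "c \<in> trigpoly"
  obtains B where "B \<ge> 0" "\<And>f. square_int tmeas f \<Longrightarrow> square_int tmeas (\<lambda>x. c x * f x)"
    "\<And>f. square_int tmeas f \<Longrightarrow> norm (fcoeffs (\<lambda>x. c x * f x)) \<le> B * norm (fcoeffs f)"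
proof -
  note cc = trigpoly_continuous[OF c]
  obtain B where B: "B > 0" "\<And>x. x \<in> Qcube \<Longrightarrow> \<bar>c x\<bar> \<le> B" using cube_continuous_bounded[OF cc] by blast
  have s: "square_int tmeas (\<lambda>x. c x * f x)" if "square_int tmeas f" for f
    using B by (intro square_int_bounded_mult[OF that cube_continuous_measurable[OF cc]] AE_I2) auto
  have "norm (fcoeffs (\<lambda>x. c x * f x)) \<le> B * norm (fcoeffs f)" if f: "square_int tmeas f" for f
  proof (rule power2_le_imp_le)
    have "(LINT x|tmeas. (c x * f x)\<^sup>2) \<le> (LINT x|tmeas. B\<^sup>2 * (f x)\<^sup>2)"
    proof (rule integral_mono)
      fix x :: "real^'a" assume "x \<in> space tmeas"
      then have "\<bar>c x\<bar> \<le> \<bar>B\<bar>" using B(2)[of x] by simp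
      then have "(c x)\<^sup>2 \<le> B\<^sup>2" by (simp only: abs_le_square_iff)
      then show "(c x * f x)\<^sup>2 \<le> B\<^sup>2 * (f x)\<^sup>2" by (simp add: power_mult_distrib mult_right_mono)
    qed (use s[OF f] f in \<open>auto simp: square_int_def\<close>)
    then show "(norm (fcoeffs (\<lambda>x. c x * f x)))\<^sup>2 \<le> (B * norm (fcoeffs f))\<^sup>2"
      by (simp add: Parseval_norm[OF s[OF f]] power_mult_distrib Parseval_norm[OF f])
  qed (use B in simp)
  then show ?thesis using that[of B] s B by simp
qed

lemma trigpoly_times_square_int:
  assumes "c \<in> trigpoly" "square_int tmeas f" shows "square_int tmeas (\<lambda>x. c x * f x)"
  using trigpoly_times_bound[OF assms(1)] assms(2) by metis

lemma mult_l2_fcoeffs: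
  assumes c: "c \<in> trigpoly" and f: "square_int tmeas f"
  shows "mult_l2 c (fcoeffs f) = fcoeffs (\<lambda>x. c x * f x)"
proof -
  note s = trigpoly_times_square_int[OF c]
  have "AE x in tmeas. fsynth (fcoeffs f) x = f x"
    using fcoeffs_eq_iff[OF fsynth(1) f] fsynth(2) by blast
  then have "AE x in tmeas. c x * fsynth (fcoeffs f) x = c x * f x" by eventually_elim simp
  then show ?thesis unfolding mult_l2_def using fcoeffs_eq_iff[OF s[OF fsynth(1)] s[OF f]] by blast
qed

lemma mult_l2_bounded_linear:
  assumes c: "c \<in> trigpoly" shows "bounded_linear (mult_l2 c)"
proof -
  obtain B where B: "B \<ge> 0" "\<And>f. square_int tmeas f \<Longrightarrow> square_int tmeas (\<lambda>x. c x * f x)"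
    "\<And>f. square_int tmeas f \<Longrightarrow> norm (fcoeffs (\<lambda>x. c x * f x)) \<le> B * norm (fcoeffs f)"
    using trigpoly_times_bound[OF c] by blast
  show ?thesis
  proof (rule bounded_linear_intro[where K=B])
    fix x y r
    have "mult_l2 c (fcoeffs (\<lambda>z. fsynth x z + fsynth y z)) = fcoeffs (\<lambda>z. c z * (fsynth x z + fsynth y z))"
      by (intro mult_l2_fcoeffs c square_int_add fsynth)
    then show "mult_l2 c (x + y) = mult_l2 c x + mult_l2 c y"
      by (simp add: fcoeffs_add fsynth distrib_left B(2) mult_l2_def)
    have "mult_l2 c (fcoeffs (\<lambda>z. r * fsynth x z)) = fcoeffs (\<lambda>z. c z * (r * fsynth x z))"
      by (intro mult_l2_fcoeffs c square_int_scale fsynth)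
    then show "mult_l2 c (r *\<^sub>R x) = r *\<^sub>R mult_l2 c x"
      using fcoeffs_scale[OF B(2)[OF fsynth(1)], of r x] by (simp add: fcoeffs_scale fsynth mult_l2_def mult.left_commute)
    show "norm (mult_l2 c x) \<le> norm x * B"
      using B(3)[OF fsynth(1)[of x]] by (simp add: mult_l2_def fsynth mult.commute)
  qed
qed

text \<open>A trigonometric polynomial is bounded, so its impulse is controlled by the L^2 norm of
  the position, \<open>freq_inv (fst U)\<close>, instead of its H^1 norm. The squaring step depends
  on this gain of one derivative.\<close>

lemma mult_op_mult_l2: "mult_op c U = (0, mult_l2 c (diag_op (\<lambda>k. 1 / freq k) (fst U)))"
  by (simp add: mult_op_def mult_l2_def uncoords_def)

text \<open>The Leibniz rule for weak derivatives, obtained by testing \<open>w\<close> against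
  \<open>p\<close> times a basis element.\<close>

lemma H1_fun_trigpoly_mult:
  fixes w :: "real^'d::finite \<Rightarrow> real"
  assumes p: "p \<in> trigpoly" and w: "H1_fun w"
  shows "H1_fun (\<lambda>x. p x * w x)"
proof -
  note ts = trigpoly_times_square_int
  have ws: "square_int tmeas w" using w by (simp add: H1_fun_iff)
  have "\<exists>g. square_int tmeas g \<and> weak_pd j (\<lambda>x. p x * w x) g" for j
  proof -
    obtain v where v: "square_int tmeas v" "weak_pd j w v" using w by (auto simp: H1_fun_def L2_fun_square_int)
    let ?g = "\<lambda>x. pd j p x * w x + p x * v x"
    have dp: "pd j p \<in> trigpoly" using trigpoly_pd[OF p] by blast
    have gs: "square_int tmeas ?g" by (intro square_int_add ts dp p ws v)
    have "fcoeff ?g k = - of_int (k j) * fcoeff (\<lambda>x. p x * w x) (\<lambda>i. - k i)" for k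
    proof -
      note bk = trigpoly.trig_basis[of k]
      note pbk = trigpoly_mult[OF p bk]
      have "(LINT x|tmeas. w x * pd j (\<lambda>x. p x * trig_basis k x) x) = - (LINT x|tmeas. v x * (p x * trig_basis k x))"
        using v(2) trigpoly_smooth[OF pbk] trigpoly_periodic[OF pbk] unfolding weak_pd_def by blast
      moreover have "(LINT x|tmeas. w x * pd j (\<lambda>x. p x * trig_basis k x) x)
        = (LINT x|tmeas. w x * p x * pd j (trig_basis k) x) + (LINT x|tmeas. pd j p x * w x * trig_basis k x)"
      proof -
        have e: "w x * pd j (\<lambda>x. p x * trig_basis k x) x = w x * p x * pd j (trig_basis k) x + pd j p x * w x * trig_basis k x" for x
          unfolding pd_mult[OF trigpoly_smooth[OF p] trigpoly_smooth[OF bk]] by (simp add: algebra_simps)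
        have i1: "integrable tmeas (\<lambda>x. w x * p x * pd j (trig_basis k) x)"
          using square_int_mult_integrable[OF ts[OF p ws], of "pd j (trig_basis k)"] continuous_square_int[OF trigpoly_continuous, of "pd j (trig_basis k)"] trigpoly_pd[OF bk]
          by (simp add: mult.commute)
        have i2: "integrable tmeas (\<lambda>x. pd j p x * w x * trig_basis k x)"
          by (intro square_int_mult_integrable ts dp ws trig_basis_square_int)
        show ?thesis unfolding e by (rule Bochner_Integration.integral_add[OF i1 i2])
      qed
      moreover have "(LINT x|tmeas. w x * p x * pd j (trig_basis k) x) = of_int (k j) * fcoeff (\<lambda>x. p x * w x) (\<lambda>i. - k i)"
        unfolding pd_trig_basis integral_mult_middle by (simp add: fcoeff_def mult.commute)
      moreover have "fcoeff ?g k = (LINT x|tmeas. pd j p x * w x * trig_basis k x) + (LINT x|tmeas. v x * (p x * trig_basis k x))"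
      proof -
        have "fcoeff ?g k = fcoeff (\<lambda>x. pd j p x * w x) k + fcoeff (\<lambda>x. p x * v x) k"
          by (intro fcoeff_add ts dp p ws v)
        then show ?thesis by (simp add: fcoeff_def mult_ac)
      qed
      ultimately show ?thesis by linarith
    qed
    then show ?thesis using gs ts[OF p ws] weak_pd_iff by blast
  qed
  then show ?thesis using ts[OF p ws] by (simp add: H1_fun_def L2_fun_square_int)
qed

text \<open>The velocity produced by a smooth impulse is in H^1. The free evolution therefore moves
  it at a linear rate in time, which is needed against the amplitude 1/h.\<close>

lemma mult_op_snd_regular:
  assumes p: "p \<in> trigpoly"
  shows "square_int (count_space UNIV) (\<lambda>k. freq k * l2c (snd (mult_op p U)) k)"
proof -
  have w: "H1_fun (fst (uncoords U))" using Xsp_uncoords[of U] by (simp add: Xsp_def)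
  have "H1_fun (\<lambda>x. p x * fst (uncoords U) x)" by (rule H1_fun_trigpoly_mult[OF p w])
  then show ?thesis
    by (simp add: H1_fun_iff mult_op_def l2c_fcoeffs)
qed

subsection \<open>The squaring step\<close>

lemma sin_diff_le:
  fixes x :: real assumes "x \<ge> 0" shows "\<bar>sin x - x\<bar> \<le> x\<^sup>2"
proof -
  have "norm ((sin x - x) - (sin 0 - 0)) \<le> x * norm (x - 0)"
  proof (rule field_differentiable_bound[where S="{0..x}" and f'="\<lambda>t. cos t - 1" and f="\<lambda>t. sin t - t"])
    show "((\<lambda>t. sin t - t) has_field_derivative cos t - 1) (at t within {0..x})" for t :: real
      by (auto intro!: derivative_eq_intros)
    show "norm (cos t - 1) \<le> x" if "t \<in> {0..x}" for t
      using abs_cos_diff_le[of t] that by simp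
  qed (use assms in auto)
  then show ?thesis using assms by (simp add: power2_eq_square)
qed

lemma diag_op_bounded_linear:
  assumes "\<And>k. \<bar>m k\<bar> \<le> C" shows "bounded_linear (diag_op m)"
proof (rule bounded_linear_intro[where K=C])
  show "diag_op m (x + y) = diag_op m x + diag_op m y" for x y
    by (rule l2_eqI) (simp add: l2c_diag_op[OF assms] distrib_left)
  show "diag_op m (r *\<^sub>R x) = r *\<^sub>R diag_op m x" for r x
    by (rule l2_eqI) (simp add: l2c_diag_op[OF assms])
  show "norm (diag_op m x) \<le> norm x * C" for x
    using norm_diag_op_le[OF assms, where x=x] order_trans[OF abs_ge_zero assms] by (simp add: mult.commute)
qed

abbreviation freq_inv :: "('d::finite \<Rightarrow> int) l2 \<Rightarrow> ('d \<Rightarrow> int) l2" where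
  "freq_inv \<equiv> diag_op (\<lambda>k. 1 / freq k)"

lemmas l2c_freq_inv = l2c_diag_op[where m="\<lambda>k. 1 / freq k", OF freq_inv_le]
lemmas freq_inv_bl = diag_op_bounded_linear[where m="\<lambda>k. 1 / freq k", OF freq_inv_le]

lemma fst_wave_rot: "fst (wave_rot t U) = diag_op (\<lambda>k. cos (freq k * t)) (fst U) + diag_op (\<lambda>k. sin (freq k * t)) (snd U)"
  by (simp add: wave_rot_def)

text \<open>One derivative is traded for one factor of time: |sin (freq t)| \<le> freq |t|, and
  \<open>freq_inv\<close> absorbs the frequency.\<close>

lemma freq_inv_sin_le: "norm (freq_inv (diag_op (\<lambda>k. sin (freq k * t)) b)) \<le> \<bar>t\<bar> * norm b"
proof (rule l2_norm_mono)
  fix k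
  have "\<bar>sin (freq k * t)\<bar> * \<bar>l2c b k\<bar> \<le> \<bar>freq k * t\<bar> * \<bar>l2c b k\<bar>"
    by (intro mult_right_mono abs_sin_x_le_abs_x) simp
  then show "\<bar>l2c (freq_inv (diag_op (\<lambda>k. sin (freq k * t)) b)) k\<bar> \<le> \<bar>t\<bar> * \<bar>l2c b k\<bar>"
    unfolding l2c_freq_inv l2c_diag_op_sin by (simp add: abs_mult divide_le_eq mult_ac)
qed simp

lemma freq_inv_cos_le: "norm (freq_inv (diag_op (\<lambda>k. cos (freq k * t)) a - a)) \<le> \<bar>t\<bar> * norm a"
proof (rule l2_norm_mono)
  fix k
  have "\<bar>cos (freq k * t) - 1\<bar> * \<bar>l2c a k\<bar> \<le> \<bar>freq k * t\<bar> * \<bar>l2c a k\<bar>"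
    by (intro mult_right_mono abs_cos_diff_le) simp
  moreover have eq: "cos (freq k * t) * l2c a k - l2c a k = (cos (freq k * t) - 1) * l2c a k" by (simp add: algebra_simps)
  ultimately show "\<bar>l2c (freq_inv (diag_op (\<lambda>k. cos (freq k * t)) a - a)) k\<bar> \<le> \<bar>t\<bar> * \<bar>l2c a k\<bar>"
    unfolding l2c_freq_inv l2c_diff l2c_diag_op_cos eq by (simp add: abs_mult divide_le_eq mult_ac)
qed simp

lemma freq_inv_wave_rot_diff_le: "norm (freq_inv (fst (wave_rot t U - U))) \<le> 2 * \<bar>t\<bar> * norm U"
proof -
  have "freq_inv (fst (wave_rot t U - U)) = freq_inv (diag_op (\<lambda>k. cos (freq k * t)) (fst U) - fst U) + freq_inv (diag_op (\<lambda>k. sin (freq k * t)) (snd U))"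
    by (simp add: fst_wave_rot linear_simps[OF freq_inv_bl])
  also have "norm \<dots> \<le> \<bar>t\<bar> * norm (fst U) + \<bar>t\<bar> * norm (snd U)"
    by (intro order_trans[OF norm_triangle_ineq] add_mono freq_inv_cos_le freq_inv_sin_le)
  also have "\<dots> \<le> \<bar>t\<bar> * norm U + \<bar>t\<bar> * norm U"
    using norm_fst_le[of "fst U" "snd U"] norm_snd_le[of "snd U" "fst U"]
    by (intro add_mono mult_left_mono) auto
  finally show ?thesis by simp
qed

text \<open>Here the extra frequency is absorbed by the regularity of \<open>g\<close>:
  \<open>q\<close> holds its H^1-weighted coefficients.\<close>

lemma regular_sin_le:
  assumes "\<And>k. l2c q k = freq k * l2c g k"
  shows "norm (diag_op (\<lambda>k. sin (freq k * t)) g) \<le> \<bar>t\<bar> * norm q"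
proof (rule l2_norm_mono)
  fix k
  have "\<bar>sin (freq k * t)\<bar> * \<bar>l2c g k\<bar> \<le> \<bar>freq k * t\<bar> * \<bar>l2c g k\<bar>"
    by (intro mult_right_mono abs_sin_x_le_abs_x) simp
  then show "\<bar>l2c (diag_op (\<lambda>k. sin (freq k * t)) g) k\<bar> \<le> \<bar>t\<bar> * \<bar>l2c q k\<bar>"
    unfolding l2c_diag_op_sin assms by (simp add: abs_mult mult_ac)
qed simp

lemma regular_cos_le:
  assumes "\<And>k. l2c q k = freq k * l2c g k"
  shows "norm (diag_op (\<lambda>k. cos (freq k * t)) g - g) \<le> \<bar>t\<bar> * norm q"
proof (rule l2_norm_mono)
  fix k
  have "\<bar>cos (freq k * t) - 1\<bar> * \<bar>l2c g k\<bar> \<le> \<bar>freq k * t\<bar> * \<bar>l2c g k\<bar>"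
    by (intro mult_right_mono abs_cos_diff_le) simp
  moreover have eq: "cos (freq k * t) * l2c g k - l2c g k = (cos (freq k * t) - 1) * l2c g k" by (simp add: algebra_simps)
  ultimately show "\<bar>l2c (diag_op (\<lambda>k. cos (freq k * t)) g - g) k\<bar> \<le> \<bar>t\<bar> * \<bar>l2c q k\<bar>"
    unfolding l2c_diff l2c_diag_op_cos assms eq by (simp add: abs_mult mult_ac)
qed simp

text \<open>In time \<open>t\<close> a velocity \<open>g\<close> produces the displacement t g to
  first order. This displacement, multiplied once more by the impulse profile, is the source of the
  square.\<close>

lemma regular_sinc_le:
  fixes g q :: "('d::finite \<Rightarrow> int) l2"
  assumes q: "\<And>k. l2c q k = freq k * l2c g k" and t: "t > 0"
  shows "norm ((1 / t) *\<^sub>R freq_inv (diag_op (\<lambda>k. sin (freq k * t)) g) - g) \<le> t * norm q"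
proof (rule l2_norm_mono)
  fix k :: "'d \<Rightarrow> int"
  let ?x = "freq k * t"
  have x: "?x > 0" using t by simp
  have "l2c ((1 / t) *\<^sub>R freq_inv (diag_op (\<lambda>k. sin (freq k * t)) g) - g) k = (sin ?x - ?x) / ?x * l2c g k"
    unfolding l2c_diff l2c_scaleR l2c_freq_inv l2c_diag_op_sin using x t by (simp add: field_simps)
  moreover have "\<bar>(sin ?x - ?x) / ?x\<bar> \<le> ?x"
    using sin_diff_le[of ?x] x by (simp add: divide_le_eq power2_eq_square)
  ultimately have "\<bar>l2c ((1 / t) *\<^sub>R freq_inv (diag_op (\<lambda>k. sin (freq k * t)) g) - g) k\<bar> \<le> ?x * \<bar>l2c g k\<bar>"
    by (simp only: abs_mult) (intro mult_right_mono, auto)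
  then show "\<bar>l2c ((1 / t) *\<^sub>R freq_inv (diag_op (\<lambda>k. sin (freq k * t)) g) - g) k\<bar> \<le> t * \<bar>l2c q k\<bar>"
    by (simp add: q abs_mult mult_ac)
qed (use t in simp)

text \<open>The conjugated evolution over time \<open>h\<^sup>2\<close> with impulses of size \<open>\<plusminus>1/h\<close>. The potential \<open>V\<close> enters only
  through the Duhamel remainder; its first component gains a factor of the time in \<open>L\<^sup>2\<close>, which
  compensates the two large impulses.\<close>

lemma square_estimate:
  fixes U0 :: "'d::finite energy"
  assumes V: "multiplier V" and p: "p \<in> trigpoly"
  obtains C where "C \<ge> 0"
    "\<And>h U. 0 < h \<Longrightarrow> h \<le> 1 \<Longrightarrow> mild_sol (mult_op V) (U0 + (1 / h) *\<^sub>R mult_op p U0) U \<Longrightarrow>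
      norm (U (h\<^sup>2) - (1 / h) *\<^sub>R mult_op p (U (h\<^sup>2)) - (U0 - (0, mult_l2 p (snd (mult_op p U0))))) \<le> norm (wave_rot (h\<^sup>2) U0 - U0) + C * h"
proof -
  have mp: "multiplier p" by (rule trigpoly_multiplier[OF p])
  note Kp = mult_op_bounded_linear[OF mp] and KV = mult_op_bounded_linear[OF V] and Mp = mult_l2_bounded_linear[OF p]
  obtain BV where BV: "BV \<ge> 0" "\<And>X. norm (mult_op V X) \<le> BV * norm X" using mult_op_bound[OF V] by blast
  obtain Bm where Bm: "Bm \<ge> 0" "\<And>y. norm (mult_l2 p y) \<le> Bm * norm y"
    using bounded_linear.nonneg_bounded[OF Mp] by (metis mult.commute)
  have KpB: "norm (mult_op p X) \<le> Bm * norm (freq_inv (fst X))" for X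
    using Bm(2) by (simp add: mult_op_mult_l2 norm_Pair)
  define k where "k = mult_op p U0"
  define g where "g = snd k"
  have kg: "k = (0, g)" by (simp add: g_def k_def prod_eq_iff)
  \<comment> \<open>Square summable because the impulse has produced an H^1 velocity.\<close>
  define q where "q = Abs_l2 (\<lambda>i. freq i * l2c g i)"
  have q: "l2c q i = freq i * l2c g i" for i
    unfolding q_def g_def k_def by (simp add: l2c_Abs[OF mult_op_snd_regular[OF p]])
  define E where "E = exp BV"
  define N where "N = (norm U0 + norm g) * E"
  have N: "N \<ge> 0" by (simp add: N_def E_def)
  define C where "C = 2 * norm q + BV * N + 2 * Bm * norm U0 + Bm * norm q + Bm * (BV * N)"
  have "norm (U (h\<^sup>2) - (1 / h) *\<^sub>R mult_op p (U (h\<^sup>2)) - (U0 - (0, mult_l2 p (snd (mult_op p U0))))) \<le> norm (wave_rot (h\<^sup>2) U0 - U0) + C * h"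
    if h: "0 < h" "h \<le> 1" and U: "mild_sol (mult_op V) (U0 + (1 / h) *\<^sub>R mult_op p U0) U" for h U
  proof -
    let ?t = "h\<^sup>2" and ?s = "1 / h"
    have t: "?t > 0" "?t \<le> h" "?t \<le> 1" using h by (auto simp: power2_eq_square mult_le_one mult_left_le)
    define U1 where "U1 = U0 + ?s *\<^sub>R k"
    have U': "mild_sol (mult_op V) U1 U" using U by (simp add: U1_def k_def)
    define R where "R = U ?t - wave_rot ?t U1"
    define Q where "Q = norm U1 * E"
    have Q0: "Q \<ge> 0" by (simp add: Q_def E_def)
    \<comment> \<open>After the first impulse the state has size of order 1/h, so only
      \<open>h\<close> times its bound is uniform in \<open>h\<close>.\<close>
    have hQ: "h * Q \<le> N"
    proof -
      have "norm U1 \<le> norm U0 + ?s * norm g"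
        using norm_triangle_ineq[of U0 "?s *\<^sub>R k"] h by (simp add: U1_def kg norm_Pair)
      then have "h * norm U1 \<le> h * (norm U0 + ?s * norm g)" using h by (intro mult_left_mono) auto
      also have "\<dots> = h * norm U0 + norm g" using h by (simp add: distrib_left)
      also have "\<dots> \<le> norm U0 + norm g" using h by (simp add: mult_left_le_one_le)
      finally have "h * norm U1 * E \<le> N" unfolding N_def by (intro mult_right_mono) (auto simp: E_def)
      then show ?thesis by (simp add: Q_def mult.assoc)
    qed
    have UQ: "norm (U r) \<le> Q" if "0 \<le> r" "r \<le> ?t" for r
    proof -
      have "norm (U r) \<le> norm U1 * exp (BV * r)" by (rule mild_sol_bound[OF KV BV U' that(1)])
      also have "\<dots> \<le> norm U1 * E" unfolding E_def using that t BV(1)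
        by (intro mult_left_mono) (auto intro!: mult_left_le)
      finally show ?thesis by (simp add: Q_def)
    qed
    note D = mild_sol_Duhamel[OF KV U' less_imp_le[OF t(1)]]
    have Rb: "norm R \<le> ?t * (BV * Q)"
    proof -
      have "norm (U ?t - wave_rot ?t U1) \<le> (BV * Q) * measure lborel {0..?t}"
      proof (rule has_integral_bound_real[OF _ _ D])
        fix r assume "r \<in> {0..?t} - {}"
        then show "norm (wave_rot (?t - r) (mult_op V (U r))) \<le> BV * Q"
          using UQ[of r] BV by (auto intro!: order_trans[OF BV(2)] mult_left_mono)
      qed (use BV Q0 in auto)
      then show ?thesis using t by (simp add: R_def mult.commute)
    qed
    \<comment> \<open>\<open>Rb\<close> alone would leave a bounded but not small term after the
      second impulse of size 1/h. The forcing by \<open>V\<close> enters through the velocity, so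
      the position carries a second factor of time in L^2.\<close>
    have Rw: "norm (freq_inv (fst R)) \<le> ?t * (?t * (BV * Q))"
    proof -
      have bl: "bounded_linear (\<lambda>X. freq_inv (fst (X :: 'd energy)))"
        by (rule bounded_linear_compose[OF freq_inv_bl bounded_linear_fst])
      have "norm (freq_inv (fst (U ?t - wave_rot ?t U1))) \<le> (?t * (BV * Q)) * measure lborel {0..?t}"
      proof (rule has_integral_bound_real[OF _ _ has_integral_linear[OF D bl]])
        fix r assume r: "r \<in> {0..?t} - {}"
        have "freq_inv (fst (wave_rot (?t - r) (mult_op V (U r)))) = freq_inv (diag_op (\<lambda>k. sin (freq k * (?t - r))) (snd (mult_op V (U r))))"
        proof -
          have "diag_op (\<lambda>k. cos (freq k * (?t - r))) 0 = (0 :: ('d \<Rightarrow> int) l2)"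
            by (rule l2_eqI) (simp add: l2c_diag_op_cos)
          then show ?thesis by (simp add: fst_wave_rot)
        qed
        also have "norm \<dots> \<le> \<bar>?t - r\<bar> * norm (snd (mult_op V (U r)))" by (rule freq_inv_sin_le)
        also have "\<dots> \<le> ?t * (BV * Q)"
        proof (rule mult_mono)
          have "norm (snd (mult_op V (U r))) \<le> norm (mult_op V (U r))"
            using norm_snd_le[of "snd (mult_op V (U r))" "fst (mult_op V (U r))"] unfolding prod.collapse .
          also have "\<dots> \<le> BV * norm (U r)" by (rule BV)
          also have "\<dots> \<le> BV * Q" using UQ[of r] r BV by (intro mult_left_mono) auto
          finally show "norm (snd (mult_op V (U r))) \<le> BV * Q" .
        qed (use r in auto)
        finally show "norm (((\<lambda>X. freq_inv (fst X)) \<circ> (\<lambda>s. wave_rot (?t - s) (mult_op V (U s)))) r) \<le> ?t * (BV * Q)" by simp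
      qed (use BV Q0 in auto)
      then show ?thesis using t by (simp add: R_def mult.commute)
    qed
    have split: "U ?t = wave_rot ?t U0 + ?s *\<^sub>R wave_rot ?t k + R"
      by (simp add: R_def U1_def wave_rot_simps)
    let ?S = "diag_op (\<lambda>k. sin (freq k * ?t)) g"
    have Ek: "wave_rot ?t k = (?S, diag_op (\<lambda>k. cos (freq k * ?t)) g)"
    proof -
      have "diag_op (\<lambda>k. cos (freq k * ?t)) 0 = (0 :: ('d \<Rightarrow> int) l2)" "diag_op (\<lambda>k. sin (freq k * ?t)) 0 = (0 :: ('d \<Rightarrow> int) l2)"
        by (rule l2_eqI; simp add: l2c_diag_op_cos l2c_diag_op_sin)+
      then show ?thesis by (simp add: wave_rot_def kg)
    qed
    have K1: "mult_op p (wave_rot ?t U0) = k + mult_op p (wave_rot ?t U0 - U0)"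
      by (simp add: linear_simps[OF Kp] k_def)
    \<comment> \<open>The two amplitudes 1/h multiply to the inverse of the elapsed time, which
      normalises the displacement to \<open>g\<close>; the second summand is the error.\<close>
    have K2: "?s *\<^sub>R (?s *\<^sub>R mult_op p (wave_rot ?t k)) = (0, mult_l2 p g) + (0, mult_l2 p ((1 / ?t) *\<^sub>R freq_inv ?S - g))"
    proof -
      have "mult_op p (wave_rot ?t k) = (0, mult_l2 p (freq_inv ?S))" by (simp only: mult_op_mult_l2 Ek fst_conv)
      then have "?s *\<^sub>R (?s *\<^sub>R mult_op p (wave_rot ?t k)) = (0, (1 / ?t) *\<^sub>R mult_l2 p (freq_inv ?S))"
        by (simp add: power2_eq_square)
      then show ?thesis by (simp add: linear_simps[OF Mp])
    qed
    \<comment> \<open>The two large terms \<open>?s *\<^sub>R k\<close> cancel: one is the opening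
      impulse carried along by the evolution, the other the closing impulse acting on the nearly
      unchanged position.\<close>
    have id: "U ?t - ?s *\<^sub>R mult_op p (U ?t) - (U0 - (0, mult_l2 p g))
      = (wave_rot ?t U0 - U0) + ?s *\<^sub>R (wave_rot ?t k - k) + R - ?s *\<^sub>R mult_op p (wave_rot ?t U0 - U0)
        - (0, mult_l2 p ((1 / ?t) *\<^sub>R freq_inv ?S - g)) - ?s *\<^sub>R mult_op p R"
    proof -
      have "?s *\<^sub>R mult_op p (U ?t) = ?s *\<^sub>R mult_op p (wave_rot ?t U0) + ?s *\<^sub>R (?s *\<^sub>R mult_op p (wave_rot ?t k)) + ?s *\<^sub>R mult_op p R"
        unfolding split by (simp only: linear_simps[OF Kp] scaleR_add_right)
      then have "?s *\<^sub>R mult_op p (U ?t) = (?s *\<^sub>R k + ?s *\<^sub>R mult_op p (wave_rot ?t U0 - U0))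
         + ((0, mult_l2 p g) + (0, mult_l2 p ((1 / ?t) *\<^sub>R freq_inv ?S - g))) + ?s *\<^sub>R mult_op p R"
        unfolding K1 K2 scaleR_add_right .
      moreover have "U ?t = wave_rot ?t U0 + ?s *\<^sub>R (wave_rot ?t k - k) + ?s *\<^sub>R k + R"
        unfolding split by (simp add: scaleR_diff_right)
      ultimately show ?thesis by (simp only:) (simp only: algebra_simps)
    qed
    have n2: "norm (?s *\<^sub>R (wave_rot ?t k - k)) \<le> 2 * norm q * h"
    proof -
      have "norm (wave_rot ?t k - k) \<le> norm ?S + norm (diag_op (\<lambda>k. cos (freq k * ?t)) g - g)"
      proof -
        have "wave_rot ?t k - k = (?S, diag_op (\<lambda>k. cos (freq k * ?t)) g - g)" unfolding Ek by (simp add: kg)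
        then show ?thesis by (simp only: norm_Pair_le)
      qed
      also have "\<dots> \<le> \<bar>?t\<bar> * norm q + \<bar>?t\<bar> * norm q"
        by (intro add_mono regular_sin_le regular_cos_le q)
      finally have "?s * norm (wave_rot ?t k - k) \<le> ?s * (2 * ?t * norm q)" using h by (intro mult_left_mono) (auto simp: mult_ac)
      also have "\<dots> = 2 * norm q * h" using h by (simp add: power2_eq_square)
      finally show ?thesis using h by simp
    qed
    have n4: "norm (?s *\<^sub>R mult_op p (wave_rot ?t U0 - U0)) \<le> 2 * Bm * norm U0 * h"
    proof -
      have "norm (mult_op p (wave_rot ?t U0 - U0)) \<le> Bm * (2 * \<bar>?t\<bar> * norm U0)"
        by (intro order_trans[OF KpB] mult_left_mono freq_inv_wave_rot_diff_le Bm)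
      then have "?s * norm (mult_op p (wave_rot ?t U0 - U0)) \<le> ?s * (Bm * (2 * ?t * norm U0))" using h by (intro mult_left_mono) auto
      also have "\<dots> = 2 * Bm * norm U0 * h" using h by (simp add: power2_eq_square)
      finally show ?thesis using h by simp
    qed
    have n5: "norm ((0 :: ('d \<Rightarrow> int) l2, mult_l2 p ((1 / ?t) *\<^sub>R freq_inv ?S - g))) \<le> Bm * norm q * h"
    proof -
      have "norm (mult_l2 p ((1 / ?t) *\<^sub>R freq_inv ?S - g)) \<le> Bm * (?t * norm q)"
        by (intro order_trans[OF Bm(2)] mult_left_mono regular_sinc_le q t Bm)
      also have "\<dots> \<le> Bm * (h * norm q)" using t Bm by (intro mult_left_mono mult_right_mono) auto
      finally show ?thesis by (simp add: norm_Pair mult_ac)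
    qed
    have n3: "norm R \<le> BV * N * h"
    proof -
      have "?t * (BV * Q) = BV * (h * Q) * h" by (simp add: power2_eq_square)
      also have "\<dots> \<le> BV * N * h" using hQ BV h by (intro mult_right_mono mult_left_mono) auto
      finally show ?thesis using Rb by simp
    qed
    have n6: "norm (?s *\<^sub>R mult_op p R) \<le> Bm * (BV * N) * h"
    proof -
      have "norm (mult_op p R) \<le> Bm * (?t * (?t * (BV * Q)))"
        by (intro order_trans[OF KpB] mult_left_mono Rw Bm)
      then have "?s * norm (mult_op p R) \<le> ?s * (Bm * (?t * (?t * (BV * Q))))" using h by (intro mult_left_mono) auto
      also have "\<dots> = h * (Bm * (BV * (h * Q)) * h)" using h by (simp add: power2_eq_square)
      also have "\<dots> \<le> 1 * (Bm * (BV * (h * Q)) * h)"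
        using h Bm BV Q0 by (intro mult_right_mono) auto
      also have "\<dots> \<le> Bm * (BV * N) * h" using hQ Bm BV h by (simp add: mult_left_mono mult_right_mono)
      finally show ?thesis using h by simp
    qed
    have "norm (U ?t - ?s *\<^sub>R mult_op p (U ?t) - (U0 - (0, mult_l2 p g)))
      \<le> norm (wave_rot ?t U0 - U0) + norm (?s *\<^sub>R (wave_rot ?t k - k)) + norm R + norm (?s *\<^sub>R mult_op p (wave_rot ?t U0 - U0))
        + norm ((0 :: ('d \<Rightarrow> int) l2, mult_l2 p ((1 / ?t) *\<^sub>R freq_inv ?S - g))) + norm (?s *\<^sub>R mult_op p R)"
      unfolding id
      by (intro order_trans[OF norm_triangle_ineq4] order_trans[OF norm_triangle_ineq] add_mono order_refl)
    also have "\<dots> \<le> norm (wave_rot ?t U0 - U0) + C * h"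
      using n2 n3 n4 n5 n6 unfolding C_def distrib_right by linarith
    finally show ?thesis by (simp add: g_def k_def)
  qed
  moreover have "C \<ge> 0" using Bm BV N by (simp add: C_def)
  ultimately show ?thesis using that by blast
qed

lemma mult_op_neg_square:
  assumes p: "p \<in> trigpoly"
  shows "U + mult_op (\<lambda>x. - (p x * p x)) U = U - (0, mult_l2 p (snd (mult_op p U)))"
proof -
  let ?w = "fst (uncoords U)"
  have ws: "square_int tmeas ?w" using Xsp_uncoords[of U] by (simp add: Xsp_iff)
  note ts = trigpoly_times_square_int[OF p]
  have "mult_op (\<lambda>x. - (p x * p x)) U = (0, fcoeffs (\<lambda>x. (-1) * (p x * (p x * ?w x))))"
    by (simp add: mult_op_def mult.assoc)
  also have "\<dots> = (0, (-1) *\<^sub>R fcoeffs (\<lambda>x. p x * (p x * ?w x)))"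
    by (simp only: fcoeffs_scale[OF ts[OF ts[OF ws]]])
  also have "fcoeffs (\<lambda>x. p x * (p x * ?w x)) = mult_l2 p (snd (mult_op p U))"
    by (simp add: mult_op_def mult_l2_fcoeffs[OF p ts[OF ws]])
  finally show ?thesis by (simp add: prod_eq_iff)
qed

lemma attainable_neg_square:
  assumes V: "multiplier V" and g: "\<And>a. attainable V (\<lambda>x. a * p x)" and p: "p \<in> trigpoly"
  shows "attainable V (\<lambda>x. - (p x * p x))"
  unfolding attainable_def
proof (intro conjI allI)
  show "(\<lambda>x. - (p x * p x)) \<in> trigpoly"
    using trigpoly.scale[OF trigpoly_mult[OF p p], of "-1"] by simp
  fix U0 :: "'a energy"
  have mp: "multiplier p" by (rule trigpoly_multiplier[OF p])
  obtain C where C: "C \<ge> 0"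
    "\<And>h U. 0 < h \<Longrightarrow> h \<le> 1 \<Longrightarrow> mild_sol (mult_op V) (U0 + (1 / h) *\<^sub>R mult_op p U0) U \<Longrightarrow>
      norm (U (h\<^sup>2) - (1 / h) *\<^sub>R mult_op p (U (h\<^sup>2)) - (U0 - (0, mult_l2 p (snd (mult_op p U0))))) \<le> norm (wave_rot (h\<^sup>2) U0 - U0) + C * h"
    using square_estimate[OF V p, of U0] by blast
  have "reach V 0 U0 (U0 - (0, mult_l2 p (snd (mult_op p U0))))"
  proof (rule reach_limit)
    fix e :: real assume e: "e > 0"
    then have "e / 4 > 0" by simp
    from wave_rot_small[OF this, of U0] obtain \<delta> where \<delta>: "\<delta> > 0" "\<And>t. \<bar>t\<bar> \<le> \<delta> \<Longrightarrow> norm (wave_rot t U0 - U0) \<le> e / 4" by blast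
    \<comment> \<open>The bound by \<open>\<delta>\<close> handles the free drift over time
      \<open>h\<^sup>2\<close>, the one by \<open>e / (4 * (C + 1))\<close> the linear error, and
      the one by \<open>e\<close> the duration.\<close>
    define h where "h = min (min 1 e) (min \<delta> (e / (4 * (C + 1))))"
    have h: "0 < h" "h \<le> 1" "h \<le> e" "h \<le> \<delta>" "h \<le> e / (4 * (C + 1))"
      using e \<delta> C(1) by (auto simp: h_def)
    have h2: "h\<^sup>2 \<le> h" "h\<^sup>2 > 0" using h by (auto simp: power2_eq_square mult_left_le)
    obtain U where U: "mild_sol (mult_op V) (U0 + (1 / h) *\<^sub>R mult_op p U0) U"
      using mild_sol_exists[OF mult_op_bounded_linear[OF V]] by blast
    let ?X = "U (h\<^sup>2)" and ?Y = "U (h\<^sup>2) - (1 / h) *\<^sub>R mult_op p (U (h\<^sup>2))"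
    have r1: "reach V 0 U0 (U0 + (1 / h) *\<^sub>R mult_op p U0)"
      using g[of "1 / h"] unfolding attainable_def mult_op_scale[OF mp] by blast
    \<comment> \<open>Between the impulses all controls are switched off, but the potential
      \<open>V\<close> continues to act.\<close>
    have "pot V 0 0 0 = V" by (simp add: pot_def fun_eq_iff)
    then have "energy_step (pot V 0 0 0) (h\<^sup>2) (U0 + (1 / h) *\<^sub>R mult_op p U0) ?X"
      unfolding energy_step_def using U by auto
    from reach_step[OF this h2(2)] have r2: "reach V (h\<^sup>2) (U0 + (1 / h) *\<^sub>R mult_op p U0) ?X" .
    have r3: "reach V 0 ?X ?Y"
    proof -
      have "reach V 0 ?X (?X + (- (1 / h)) *\<^sub>R mult_op p ?X)"
        using g[of "- (1 / h)"] unfolding attainable_def mult_op_scale[OF mp] by blast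
      then show ?thesis by simp
    qed
    have r: "reach V (h\<^sup>2) U0 ?Y"
      using reach_trans[OF V reach_trans[OF V r1 r2] r3] by simp
    have "norm (?Y - (U0 - (0, mult_l2 p (snd (mult_op p U0))))) \<le> norm (wave_rot (h\<^sup>2) U0 - U0) + C * h"
      by (rule C(2)[OF h(1,2) U])
    also have "\<dots> \<le> e / 4 + e / 4"
    proof (rule add_mono)
      show "norm (wave_rot (h\<^sup>2) U0 - U0) \<le> e / 4" using h h2 by (intro \<delta>(2)) simp
      have "C * h \<le> (C + 1) * (e / (4 * (C + 1)))" using C(1) h by (intro mult_mono) auto
      also have "\<dots> = e / 4" using C(1) by (simp add: field_simps)
      finally show "C * h \<le> e / 4" .
    qed
    finally have "norm (?Y - (U0 - (0, mult_l2 p (snd (mult_op p U0))))) < e" using e by simp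
    then show "\<exists>T U. T \<le> e \<and> reach V T U0 U \<and> norm (U - (U0 - (0, mult_l2 p (snd (mult_op p U0))))) < e"
      using r h(3) h2(1) by (intro exI[of _ "h\<^sup>2"] exI[of _ ?Y]) auto
  qed
  then show "reach V 0 U0 (U0 + mult_op (\<lambda>x. - (p x * p x)) U0)" by (simp only: mult_op_neg_square[OF p])
qed

subsection \<open>All trigonometric polynomials are attainable\<close>

text \<open>The squaring step uses amplitudes 1/h of both signs, so an attainable profile can be
  reused only when all its real multiples are attainable.\<close>

definition attainable_all :: "(real^'d::finite \<Rightarrow> real) \<Rightarrow> (real^'d \<Rightarrow> real) \<Rightarrow> bool" where
  "attainable_all V \<phi> \<longleftrightarrow> (\<forall>a. attainable V (\<lambda>x. a * \<phi> x))"

lemma attainable_all_trigpoly: "attainable_all V \<phi> \<Longrightarrow> \<phi> \<in> trigpoly"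
  unfolding attainable_all_def attainable_def by (drule spec[of _ 1]) simp

lemma attainable_all_add:
  assumes "multiplier V" "attainable_all V \<phi>" "attainable_all V \<psi>" shows "attainable_all V (\<lambda>x. \<phi> x + \<psi> x)"
  unfolding attainable_all_def
proof
  fix a
  have "attainable V (\<lambda>x. a * \<phi> x + a * \<psi> x)"
    using assms by (intro attainable_add) (auto simp: attainable_all_def)
  then show "attainable V (\<lambda>x. a * (\<phi> x + \<psi> x))" by (simp add: distrib_left)
qed

lemma attainable_all_scale:
  assumes "attainable_all V \<phi>" shows "attainable_all V (\<lambda>x. a * \<phi> x)"
  using assms unfolding attainable_all_def by (simp flip: mult.assoc)

lemma attainable_all_ctrl:
  assumes "multiplier V" shows "attainable_all V (ctrl u0 us uc)"
  unfolding attainable_all_def ctrl_scale[symmetric] using attainable_ctrl[OF assms] by blast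

lemma attainable_neg_square_scale:
  assumes V: "multiplier V" and p: "attainable_all V p" and a: "a \<ge> 0"
  shows "attainable V (\<lambda>x. - (a * (p x * p x)))"
proof -
  let ?p = "\<lambda>x. sqrt a * p x"
  have "attainable V (\<lambda>x. - (?p x * ?p x))"
  proof (rule attainable_neg_square[OF V])
    show "attainable V (\<lambda>x. b * ?p x)" for b
      using attainable_all_scale[OF p, of "sqrt a"] by (simp add: attainable_all_def)
    show "?p \<in> trigpoly" by (intro trigpoly.scale attainable_all_trigpoly[OF p])
  qed
  moreover have "?p x * ?p x = a * (p x * p x)" for x
    using a real_sqrt_mult_self[of a] by (metis (no_types, opaque_lifting) abs_of_nonneg mult.assoc mult.left_commute)
  ultimately show ?thesis by simp
qed

lemma attainable_all_square:
  fixes V :: "real^'d::finite \<Rightarrow> real"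
  assumes V: "multiplier V" and c: "attainable_all V c" and s: "attainable_all V s" and 1: "\<And>x. c x * c x + s x * s x = 1"
  shows "attainable_all V (\<lambda>x. c x * c x)"
  unfolding attainable_all_def
proof
  fix a :: real
  show "attainable V (\<lambda>x. a * (c x * c x))"
  proof (cases "a \<ge> 0")
    \<comment> \<open>For a nonnegative coefficient, a c^2 = a - a s^2, where the constant is a
      control and the negative square is available.\<close>
    case True
    have "ctrl a 0 0 = (\<lambda>x :: real^'d. a)" by (simp add: ctrl_def fun_eq_iff)
    then have "attainable V (\<lambda>x. a)" using attainable_ctrl[OF V, of a 0 0] by simp
    from attainable_add[OF V this attainable_neg_square_scale[OF V s True]]
    have "attainable V (\<lambda>x. a + - (a * (s x * s x)))" .
    moreover have "a + - (a * (s x * s x)) = a * (c x * c x)" for x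
      using arg_cong[OF 1[of x], of "\<lambda>t. a * t"] by (simp add: distrib_left)
    ultimately show ?thesis by simp
  next
    case False
    then show ?thesis using attainable_neg_square_scale[OF V c, of "- a"] by simp
  qed
qed

lemma attainable_all_mult:
  assumes V: "multiplier V" and g: "attainable_all V f" "attainable_all V g"
    and sq: "attainable_all V (\<lambda>x. f x * f x)" "attainable_all V (\<lambda>x. g x * g x)"
  shows "attainable_all V (\<lambda>x. f x * g x)"
  unfolding attainable_all_def
proof
  fix a :: real
  \<comment> \<open>The factor -a/2 makes the cross term of the negated square equal to a f g;
    adding the two squares removes the rest.\<close>
  have "attainable_all V (\<lambda>x. (- a / 2) * f x + g x)" by (rule attainable_all_add[OF V attainable_all_scale[OF g(1)] g(2)])
  from attainable_neg_square_scale[OF V this, of 1]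
  have 1: "attainable V (\<lambda>x. - (1 * (((- a / 2) * f x + g x) * ((- a / 2) * f x + g x))))" by simp
  have 2: "attainable V (\<lambda>x. (a / 2)\<^sup>2 * (f x * f x))" "attainable V (\<lambda>x. 1 * (g x * g x))"
    using sq unfolding attainable_all_def by blast+
  have "attainable V (\<lambda>x. - (1 * (((- a / 2) * f x + g x) * ((- a / 2) * f x + g x))) + ((a / 2)\<^sup>2 * (f x * f x) + 1 * (g x * g x)))"
    by (intro attainable_add V 1 2)
  moreover have "- (1 * (((- a / 2) * f x + g x) * ((- a / 2) * f x + g x))) + ((a / 2)\<^sup>2 * (f x * f x) + 1 * (g x * g x)) = a * (f x * g x)" for x
    by (simp add: power2_eq_square algebra_simps)
  ultimately show "attainable V (\<lambda>x. a * (f x * g x))" by simp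
qed

definition char_attainable :: "(real^'d::finite \<Rightarrow> real) \<Rightarrow> ('d \<Rightarrow> int) \<Rightarrow> bool" where
  "char_attainable V k \<longleftrightarrow> attainable_all V (\<lambda>x. cos (kdot k x)) \<and> attainable_all V (\<lambda>x. sin (kdot k x))"

lemma char_attainable_uminus:
  assumes "char_attainable V k" shows "char_attainable V (\<lambda>j. - k j)"
  using assms attainable_all_scale[of V "\<lambda>x. sin (kdot k x)" "-1"] by (simp add: char_attainable_def)

lemma char_attainable_add:
  assumes V: "multiplier V" and k: "char_attainable V k" and l: "char_attainable V l"
  shows "char_attainable V (\<lambda>j. k j + l j)"
proof -
  have cs: "cos t * cos t + sin t * sin t = 1" "sin t * sin t + cos t * cos t = 1" for t :: real
    using sin_cos_squared_add[of t] by (simp_all add: power2_eq_square add.commute)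
  have c: "attainable_all V (\<lambda>x. cos (kdot k x))" "attainable_all V (\<lambda>x. sin (kdot k x))"
    "attainable_all V (\<lambda>x. cos (kdot l x))" "attainable_all V (\<lambda>x. sin (kdot l x))"
    using k l by (auto simp: char_attainable_def)
  note sq = attainable_all_square[OF V c(1,2) cs(1)] attainable_all_square[OF V c(2,1) cs(2)]
    attainable_all_square[OF V c(3,4) cs(1)] attainable_all_square[OF V c(4,3) cs(2)]
  have "attainable_all V (\<lambda>x. cos (kdot k x) * cos (kdot l x) + (-1) * (sin (kdot k x) * sin (kdot l x)))"
    by (rule attainable_all_add[OF V attainable_all_mult[OF V c(1,3) sq(1,3)] attainable_all_scale[OF attainable_all_mult[OF V c(2,4) sq(2,4)]]])
  moreover have "attainable_all V (\<lambda>x. sin (kdot k x) * cos (kdot l x) + cos (kdot k x) * sin (kdot l x))"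
    by (rule attainable_all_add[OF V attainable_all_mult[OF V c(2,3) sq(2,3)] attainable_all_mult[OF V c(1,4) sq(1,4)]])
  ultimately show ?thesis by (simp add: char_attainable_def kdot_add cos_add sin_add)
qed

lemma char_attainable_zero:
  fixes V :: "real^'d::finite \<Rightarrow> real"
  assumes V: "multiplier V" shows "char_attainable V (\<lambda>j. 0)"
proof -
  have "ctrl 1 0 0 = (\<lambda>x :: real^'d. 1)" "ctrl 0 0 0 = (\<lambda>x :: real^'d. 0)" by (simp_all add: ctrl_def fun_eq_iff)
  then show ?thesis
    using attainable_all_ctrl[OF V, of 1 0 0] attainable_all_ctrl[OF V, of 0 0 0] by (simp add: char_attainable_def kdot_def)
qed

lemma char_attainable_unit:
  assumes V: "multiplier V" shows "char_attainable V (\<lambda>i. if i = j then 1 else 0)"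
proof -
  have s: "(\<Sum>i\<in>UNIV. (axis j 1 :: real^'a) $ i * f i) = f j" for f
  proof -
    have "(\<Sum>i\<in>UNIV. (axis j 1 :: real^'a) $ i * f i) = (\<Sum>i\<in>UNIV. if i = j then f i else 0)"
      by (intro sum.cong) (auto simp: axis_def)
    then show ?thesis by simp
  qed
  have "ctrl 0 (axis j 1) 0 = (\<lambda>x. sin (x $ j))" "ctrl 0 0 (axis j 1) = (\<lambda>x. cos (x $ j))"
    by (simp_all add: ctrl_def fun_eq_iff s)
  then show ?thesis
    using attainable_all_ctrl[OF V, of 0 "axis j 1" 0] attainable_all_ctrl[OF V, of 0 0 "axis j 1"]
    by (simp add: char_attainable_def kdot_unit)
qed

text \<open>The admissible frequencies form a subgroup of Z^d, by the addition formulas and parity,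
  and it contains the unit vectors.\<close>

lemma char_attainable_all:
  assumes V: "multiplier V" shows "char_attainable V (k :: 'd::finite \<Rightarrow> int)"
proof -
  have nat: "char_attainable V (\<lambda>i. if i = j then int n else 0)" for j :: 'd and n
  proof (induction n)
    case 0
    have "(\<lambda>i. if i = j then int 0 else 0) = (\<lambda>i. 0)" by auto
    then show ?case using char_attainable_zero[OF V] by simp
  next
    case (Suc n)
    have "(\<lambda>i. if i = j then int (Suc n) else 0) = (\<lambda>i. (if i = j then int n else 0) + (if i = j then 1 else 0))" by auto
    then show ?case using char_attainable_add[OF V Suc char_attainable_unit[OF V, of j]] by simp
  qed
  have int: "char_attainable V (\<lambda>i. if i = j then m else 0)" for j :: 'd and m
  proof (cases "m \<ge> 0")
    case True
    then have e: "int (nat m) = m" by simp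
    show ?thesis using nat[of j "nat m"] unfolding e .
  next
    case False
    have "(\<lambda>i. - (if i = j then int (nat (- m)) else 0)) = (\<lambda>i. if i = j then m else 0)" using False by auto
    then show ?thesis using char_attainable_uminus[OF nat[of j "nat (- m)"]] by simp
  qed
  have "char_attainable V (\<lambda>i. if i \<in> F then k i else 0)" if "finite F" for F
    using that
  proof (induction F rule: finite_induct)
    case empty then show ?case using char_attainable_zero[OF V] by simp
  next
    case (insert j F)
    have "(\<lambda>i. if i \<in> insert j F then k i else 0) = (\<lambda>i. (if i \<in> F then k i else 0) + (if i = j then k j else 0))"
      using insert by auto
    then show ?case using char_attainable_add[OF V insert.IH int[of j "k j"]] by simp
  qed
  from this[of UNIV] show ?thesis by simp
qed

lemma trigpoly_attainable_all:
  assumes V: "multiplier V" and p: "p \<in> trigpoly" shows "attainable_all V p"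
  using p
proof induction
  case (trig_basis k)
  have "attainable_all V (\<lambda>x. 1 / sqrt (torus_vol TYPE('a)) * (cos (kdot k x) + sin (kdot k x)))"
    using char_attainable_all[OF V, of k] by (intro attainable_all_scale attainable_all_add V) (auto simp: char_attainable_def)
  moreover have "(\<lambda>x. 1 / sqrt (torus_vol TYPE('a)) * (cos (kdot k x) + sin (kdot k x))) = trig_basis k"
    by (simp add: trig_basis_def fun_eq_iff)
  ultimately show ?case by simp
qed (auto intro: attainable_all_add V attainable_all_scale)

text \<open>The condition on the zero set says that the velocity change is F w0 almost everywhere
  with F in L^2(w0^2 dx). Approximating F in this weighted space by an attainable profile
  approximates the change in L^2.\<close>

lemma velocity_reachable:
  fixes V w0 dw0 dwf :: "real^'d::finite \<Rightarrow> real"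
  assumes V: "multiplier V" and W0: "Xsp (w0, dw0)" and dwf: "L2_fun dwf"
    and Z: "AE x in tmeas. w0 x = 0 \<longrightarrow> dwf x - dw0 x = 0"
  shows "approx_reachable V 0 (w0, dw0) (w0, dwf)"
proof (rule reach_approx_reachable[OF V W0])
  have s: "square_int tmeas w0" "square_int tmeas dw0" "square_int tmeas dwf"
    using W0 dwf by (auto simp: Xsp_iff L2_fun_square_int)
  show Wf: "Xsp (w0, dwf)" using W0 dwf by (simp add: Xsp_def)
  define f where "f x = dwf x - dw0 x" for x
  have fs: "square_int tmeas f" unfolding f_def by (intro square_int_diff s)
  note [measurable] = s[THEN square_int_measurable] fs[THEN square_int_measurable]
  \<comment> \<open>On the zero set of \<open>w0\<close> the quotient is set to 0, which is
    consistent because the velocity change vanishes there almost everywhere.\<close>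
  define F where "F x = (if w0 x = 0 then 0 else f x / w0 x)" for x
  have Fm[measurable]: "F \<in> borel_measurable tmeas" unfolding F_def[abs_def] by measurable
  have Fw: "AE x in tmeas. F x * w0 x = f x"
    using Z by eventually_elim (auto simp: F_def f_def)
  have Fi: "integrable tmeas (\<lambda>x. (F x)\<^sup>2 * (w0 x)\<^sup>2)"
  proof (rule integrable_cong_AE_imp[OF square_int_integrable[OF fs]])
    show "AE x in tmeas. (f x)\<^sup>2 = (F x)\<^sup>2 * (w0 x)\<^sup>2"
      using Fw by eventually_elim (simp flip: power_mult_distrib)
  qed measurable
  have "fcoeffs f = fcoeffs dwf - fcoeffs dw0"
    using fcoeffs_diff[OF s(3,2)] by (simp add: f_def[abs_def])
  then have ThWf: "coords (w0, dwf) = coords (w0, dw0) + (0, fcoeffs f)"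
    by (simp add: coords_def)
  show "reach V 0 (coords (w0, dw0)) (coords (w0, dwf))"
  proof (rule reach_limit)
    fix e :: real assume e: "e > 0"
    \<comment> \<open>The tolerance is squared because Parseval identifies this weighted integral
      with the square of the final distance.\<close>
    obtain p where p: "p \<in> trigpoly" "(LINT x|tmeas. (F x - p x)\<^sup>2 * (w0 x)\<^sup>2) < e\<^sup>2"
      using trigpoly_dense[OF square_int_integrable[OF s(1)] _ Fm Fi, of "e\<^sup>2"] e by auto
    have mp: "multiplier p" by (rule trigpoly_multiplier[OF p(1)])
    have ps: "square_int tmeas (\<lambda>x. p x * w0 x)"
      using multiplier_square_int[OF mp W0] by simp
    have K: "mult_op p (coords (w0, dw0)) = (0, fcoeffs (\<lambda>x. p x * w0 x))"
      using mult_op_coords[OF mp W0] by simp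
    have "attainable V (\<lambda>x. 1 * p x)" using trigpoly_attainable_all[OF V p(1)] unfolding attainable_all_def by blast
    then have "attainable V p" by simp
    then have r: "reach V 0 (coords (w0, dw0)) (coords (w0, dw0) + mult_op p (coords (w0, dw0)))"
      unfolding attainable_def by blast
    have "(norm (fcoeffs f - fcoeffs (\<lambda>x. p x * w0 x)))\<^sup>2 = (LINT x|tmeas. (f x - p x * w0 x)\<^sup>2)"
      using Parseval_norm[OF square_int_diff[OF fs ps]] by (simp add: fcoeffs_diff fs ps)
    also have "\<dots> = (LINT x|tmeas. (F x - p x)\<^sup>2 * (w0 x)\<^sup>2)"
    proof (rule integral_cong_AE)
      have [measurable]: "p \<in> borel_measurable tmeas"
        by (rule cube_continuous_measurable[OF trigpoly_continuous[OF p(1)]])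
      show "(\<lambda>x. (f x - p x * w0 x)\<^sup>2) \<in> borel_measurable tmeas" by measurable
      show "(\<lambda>x. (F x - p x)\<^sup>2 * (w0 x)\<^sup>2) \<in> borel_measurable tmeas" by measurable
      show "AE x in tmeas. (f x - p x * w0 x)\<^sup>2 = (F x - p x)\<^sup>2 * (w0 x)\<^sup>2"
        using Fw by eventually_elim (simp add: left_diff_distrib flip: power_mult_distrib)
    qed
    finally have "(norm (fcoeffs f - fcoeffs (\<lambda>x. p x * w0 x)))\<^sup>2 < e\<^sup>2" using p(2) by simp
    then have "norm (fcoeffs f - fcoeffs (\<lambda>x. p x * w0 x)) < e" using e by (simp add: power_less_imp_less_base)
    then have "norm (coords (w0, dw0) + mult_op p (coords (w0, dw0)) - coords (w0, dwf)) < e"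
      by (simp add: ThWf K norm_Pair norm_minus_commute)
    then show "\<exists>T U. T \<le> e \<and> reach V T (coords (w0, dw0)) U \<and> norm (U - coords (w0, dwf)) < e"
      using r e by (intro exI[of _ 0] exI[of _ "coords (w0, dw0) + mult_op p (coords (w0, dw0))"]) auto
  qed
qed

theorem mainTheorem2:
  fixes \<rho> :: real and V :: "real^'d::finite \<Rightarrow> real"
    and w0 dw0 :: "real^'d \<Rightarrow> real"
  assumes rho: "(CARD('d) = 1 \<longrightarrow> \<rho> = 2) \<and> (CARD('d) = 2 \<longrightarrow> \<rho> > 2)
                \<and> (CARD('d) \<ge> 3 \<longrightarrow> \<rho> = real CARD('d))"
    and V: "Lp_fun \<rho> V"
    and W0: "Xsp (w0, dw0)"
  shows "(\<forall>dwf. L2_fun dwf \<longrightarrow> (AE x in tmeas. w0 x = 0 \<longrightarrow> dwf x - dw0 x = 0)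
            \<longrightarrow> approx_reachable V 0 (w0, dw0) (w0, dwf))
       \<and> (emeasure tmeas {x \<in> Qcube. w0 x = 0} = 0 \<longrightarrow>
            (\<forall>dwf. L2_fun dwf \<longrightarrow> approx_reachable V 0 (w0, dw0) (w0, dwf)))"
proof (intro conjI allI impI)
  note m = multiplier_potential[OF rho V]
  fix dwf :: "real^'d \<Rightarrow> real" assume dwf: "L2_fun dwf"
  show "approx_reachable V 0 (w0, dw0) (w0, dwf)" if "AE x in tmeas. w0 x = 0 \<longrightarrow> dwf x - dw0 x = 0"
    by (rule velocity_reachable[OF m W0 dwf that])
  assume Z: "emeasure tmeas {x \<in> Qcube. w0 x = 0} = 0"
  have [measurable]: "w0 \<in> borel_measurable tmeas" using W0 by (simp add: Xsp_iff square_int_def)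
  have "{x \<in> space tmeas. w0 x = 0} \<in> sets tmeas" by measurable
  then have "{x \<in> Qcube. w0 x = 0} \<in> null_sets tmeas"
    using Z by (intro null_setsI) (auto simp: Qcube_def)
  then have "AE x in tmeas. x \<notin> {x \<in> Qcube. w0 x = 0}" by (rule AE_not_in)
  then have "AE x in tmeas. w0 x \<noteq> 0"
    by (rule AE_mp) (auto intro!: AE_I2)
  then have "AE x in tmeas. w0 x = 0 \<longrightarrow> dwf x - dw0 x = 0" by eventually_elim simp
  then show "approx_reachable V 0 (w0, dw0) (w0, dwf)" by (rule velocity_reachable[OF m W0 dwf])
qed

end
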